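(* Let $p$ be a prime. There is a function $f$ with $f(\mathrm{nnz}) = O(\mathrm{nnz}\cdot\log^2 p/\log\log p)$ such that the class $\mathcal{LS}_{\mathbb{Z}_p}$ of Laplacian matrices over $\mathbb{Z}_p$ is efficiently $f$-reducible to the class $\mathcal{UWLS}_{\mathbb{Z}_p}$ of unit-weight Laplacian matrices over $\mathbb{Z}_p$.
   Context: $\mathbb{Z}_p$ is the field with $p$ elements; field operations cost $O(1)$. A Laplacian matrix over $\mathbb{Z}_p$ is a matrix $\mathbf{L}\in\mathbb{Z}_p^{n\times n}$ arising from a simple undirected graph $G=(V,E)$ with weights $w:E\to\mathbb{Z}_p\setminus\{0\}$ via $\mathbf{L}_{a,a}=\sum_{(a,u)\in E}w_{a,u}$, $\mathbf{L}_{a,b}=-w_{a,b}$ for $(a,b)\in E$, $0$ otherwise. It is unit-weight if all its non-zero off-diagonal entries equal $-1$. A linear system instance is $(\mathbf{M},\mathbf{c})$; solving means finding $\mathbf{x}$ with $\mathbf{M}\mathbf{x}=\mathbf{c}$ over $\mathbb{Z}_p$; $\mathcal{S}(\mathbf{M},\mathbf{c})=\mathrm{nnz}(\mathbf{M})$. $\mathcal{M}^1$ is efficiently $f$-reducible to $\mathcal{M}^2$ ($f$ non-decreasing) if there are algorithms $\mathcal{A}_{1\mapsto2}$, $\mathcal{A}_{2\mapsto1}$ such that for every instance $(\mathbf{M}^1,\mathbf{c}^1)$ with $\mathbf{M}^1\in\mathcal{M}^1$: $\mathcal{A}_{1\mapsto2}$ outputs $(\mathbf{M}^2,\mathbf{c}^2)$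 with $\mathbf{M}^2\in\mathcal{M}^2$ and $\mathcal{S}(\mathbf{M}^2,\mathbf{c}^2)\le f(\mathcal{S}(\mathbf{M}^1,\mathbf{c}^1))$; whenever $\mathbf{x}^2$ solves $(\mathbf{M}^2,\mathbf{c}^2)$, $\mathcal{A}_{2\mapsto1}(\mathbf{M}^2,\mathbf{c}^2,\mathbf{x}^2)$ solves $(\mathbf{M}^1,\mathbf{c}^1)$; and both run in time $\widetilde{O}(\mathrm{nnz}(\mathbf{M}^1))$. *)

theory Defs
  imports
    Complex_Main
    "HOL-Number_Theory.Cong"
    "HOL-Number_Theory.Modular_Inverse"
    "Jordan_Normal_Form.Matrix"
begin

section \<open>Linear systems over the field with p elements\<close>

text \<open>Elements of the prime field are the canonical residues \<open>0, \<dots>, p - 1\<close> in \<^typ>\<open>int\<close>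
  (rather than a type, so that \<open>p\<close> can be quantified inside a formula).\<close>

definition zp :: "nat \<Rightarrow> int set" where
  "zp p = {0..<int p}"

definition zp_system :: "nat \<Rightarrow> int mat \<Rightarrow> int vec \<Rightarrow> bool" where
  "zp_system p M c \<longleftrightarrow>
     elements_mat M \<subseteq> zp p \<and> dim_vec c = dim_row M \<and> set\<^sub>v c \<subseteq> zp p"

definition zp_vector :: "nat \<Rightarrow> nat \<Rightarrow> int vec \<Rightarrow> bool" where
  "zp_vector p n x \<longleftrightarrow> dim_vec x = n \<and> set\<^sub>v x \<subseteq> zp p"

definition solves :: "nat \<Rightarrow> int mat \<Rightarrow> int vec \<Rightarrow> int vec \<Rightarrow> bool" where
  "solves p M c x \<longleftrightarrow>
     zp_vector p (dim_col M) x \<and>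
     (\<forall>i<dim_row M. [(M *\<^sub>v x) $ i = c $ i] (mod int p))"

definition nnz :: "int mat \<Rightarrow> nat" where
  "nnz M = card {(i, j). i < dim_row M \<and> j < dim_col M \<and> M $$ (i, j) \<noteq> 0}"

section \<open>Laplacian matrices\<close>

text \<open>Vertices are \<open>0, \<dots>, n - 1\<close>; an undirected edge is a two-element set of vertices.\<close>

definition simple_edges :: "nat \<Rightarrow> nat set set \<Rightarrow> bool" where
  "simple_edges n E \<longleftrightarrow> (\<forall>e\<in>E. e \<subseteq> {..<n} \<and> card e = 2)"

definition laplacian_of :: "nat \<Rightarrow> nat \<Rightarrow> nat set set \<Rightarrow> (nat set \<Rightarrow> int) \<Rightarrow> int mat" where
  "laplacian_of p n E w = mat n n (\<lambda>(a, b).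
     if a = b then (\<Sum>u | {a, u} \<in> E. w {a, u}) mod int p
     else if {a, b} \<in> E then (- w {a, b}) mod int p
     else 0)"

definition LS :: "nat \<Rightarrow> int mat set" where
  "LS p = {L. \<exists>n E w. simple_edges n E \<and> (\<forall>e\<in>E. w e \<in> zp p - {0}) \<and> L = laplacian_of p n E w}"

definition UWLS :: "nat \<Rightarrow> int mat set" where
  "UWLS p = {L \<in> LS p. \<forall>i<dim_row L. \<forall>j<dim_col L.
     i \<noteq> j \<and> L $$ (i, j) \<noteq> 0 \<longrightarrow> L $$ (i, j) = (- 1) mod int p}"

section \<open>Machine model\<close>

text \<open>Algorithms are programs of a random access machine whose memory consists of named arrays
  of natural numbers (a scalar is cell 0 of its array).  Every operation costs 1: the field
  operations, comparison, indirect memory access and, on addresses, only successor and predecessor.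
  General integer arithmetic is deliberately absent: in \<open>t\<close> steps a program cannot build a number
  exceeding the largest of \<open>p\<close>, its input and its constants by more than \<open>t\<close>, so unit cost
  cannot be abused by packing data into huge integers.\<close>

type_synonym state = "string \<Rightarrow> nat \<Rightarrow> nat"

datatype exp =
    Lit nat
  | Read string exp
  | Succ exp
  | Pred exp
  | FAdd exp exp
  | FSub exp exp
  | FMul exp exp
  | FInv exp

datatype test = Less exp exp | Equal exp exp

datatype com =
    Skip
  | Write string exp exp
  | Seq com com
  | If test com com
  | While test com

fun eval_exp :: "nat \<Rightarrow> state \<Rightarrow> exp \<Rightarrow> nat" where
  "eval_exp p s (Lit k) = k"
| "eval_exp p s (Read a e) = s a (eval_exp p s e)"
| "eval_exp p s (Succ e) = eval_exp p s e + 1"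
| "eval_exp p s (Pred e) = eval_exp p s e - 1"
| "eval_exp p s (FAdd e d) = (eval_exp p s e + eval_exp p s d) mod p"
| "eval_exp p s (FSub e d) = nat ((int (eval_exp p s e) - int (eval_exp p s d)) mod int p)"
| "eval_exp p s (FMul e d) = (eval_exp p s e * eval_exp p s d) mod p"
| "eval_exp p s (FInv e) = nat (modular_inverse (int p) (int (eval_exp p s e)))"

fun cost_exp :: "exp \<Rightarrow> nat" where
  "cost_exp (Lit k) = 1"
| "cost_exp (Read a e) = cost_exp e + 1"
| "cost_exp (Succ e) = cost_exp e + 1"
| "cost_exp (Pred e) = cost_exp e + 1"
| "cost_exp (FAdd e d) = cost_exp e + cost_exp d + 1"
| "cost_exp (FSub e d) = cost_exp e + cost_exp d + 1"
| "cost_exp (FMul e d) = cost_exp e + cost_exp d + 1"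
| "cost_exp (FInv e) = cost_exp e + 1"

fun eval_test :: "nat \<Rightarrow> state \<Rightarrow> test \<Rightarrow> bool" where
  "eval_test p s (Less e d) \<longleftrightarrow> eval_exp p s e < eval_exp p s d"
| "eval_test p s (Equal e d) \<longleftrightarrow> eval_exp p s e = eval_exp p s d"

fun cost_test :: "test \<Rightarrow> nat" where
  "cost_test (Less e d) = cost_exp e + cost_exp d + 1"
| "cost_test (Equal e d) = cost_exp e + cost_exp d + 1"

text \<open>\<open>exec p P s t s'\<close>: over the field with \<open>p\<close> elements, program \<open>P\<close> started in \<open>s\<close> halts in
  \<open>s'\<close> after \<open>t\<close> steps.\<close>

inductive exec :: "nat \<Rightarrow> com \<Rightarrow> state \<Rightarrow> nat \<Rightarrow> state \<Rightarrow> bool" for p where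
  Skip: "exec p Skip s 1 s"
| Write: "exec p (Write a e d) s (cost_exp e + cost_exp d + 1)
            (s(a := (s a)(eval_exp p s e := eval_exp p s d)))"
| Seq: "exec p P s t s' \<Longrightarrow> exec p Q s' t' s'' \<Longrightarrow> exec p (Seq P Q) s (t + t') s''"
| IfTrue: "eval_test p s b \<Longrightarrow> exec p P s t s' \<Longrightarrow> exec p (If b P Q) s (cost_test b + t) s'"
| IfFalse: "\<not> eval_test p s b \<Longrightarrow> exec p Q s t s' \<Longrightarrow> exec p (If b P Q) s (cost_test b + t) s'"
| WhileFalse: "\<not> eval_test p s b \<Longrightarrow> exec p (While b P) s (cost_test b) s"
| WhileTrue: "eval_test p s b \<Longrightarrow> exec p P s t s' \<Longrightarrow> exec p (While b P) s' t' s'' \<Longrightarrow>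
    exec p (While b P) s (cost_test b + t + t') s''"

section \<open>Storage of instances and solutions\<close>

text \<open>Matrices are stored sparsely, as the list of their non-zero entries (row, column, value) in
  an arbitrary order, so that time linear in the number of non-zero entries is meaningful.
  Right-hand sides and solutions are stored densely.  Input and output use the same arrays,
  so that parts of an input kept in the output need not be copied.\<close>

definition stores_system :: "state \<Rightarrow> int mat \<Rightarrow> int vec \<Rightarrow> bool" where
  "stores_system s M c \<longleftrightarrow>
     s ''nrows'' 0 = dim_row M \<and> s ''ncols'' 0 = dim_col M \<and>
     dim_vec c = dim_row M \<and> (\<forall>i<dim_row M. int (s ''rhs'' i) = c $ i) \<and>
     (\<exists>es :: (nat \<times> nat \<times> int) list.
        distinct es \<and>
        set es = {(i, j, v). i < dim_row M \<and> j < dim_col M \<and> v = M $$ (i, j) \<and> v \<noteq> 0} \<and>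
        s ''nnz'' 0 = length es \<and>
        (\<forall>k<length es. es ! k = (s ''row'' k, s ''col'' k, int (s ''val'' k))))"

definition stores_solution :: "state \<Rightarrow> int vec \<Rightarrow> bool" where
  "stores_solution s x \<longleftrightarrow>
     s ''ncols'' 0 = dim_vec x \<and> (\<forall>i<dim_vec x. int (s ''sol'' i) = x $ i)"

definition system_cells :: "int mat \<Rightarrow> (string \<times> nat) set" where
  "system_cells M =
     {''nrows'', ''ncols'', ''nnz''} \<times> {0} \<union>
     {''row'', ''col'', ''val''} \<times> {..<nnz M} \<union>
     {''rhs''} \<times> {..<dim_row M}"

text \<open>Memory not used by the input is initially zero.\<close>

definition input_system :: "state \<Rightarrow> int mat \<Rightarrow> int vec \<Rightarrow> bool" where
  "input_system s M c \<longleftrightarrow>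
     stores_system s M c \<and> (\<forall>a i. (a, i) \<notin> system_cells M \<longrightarrow> s a i = 0)"

definition input_system_solution :: "state \<Rightarrow> int mat \<Rightarrow> int vec \<Rightarrow> int vec \<Rightarrow> bool" where
  "input_system_solution s M c x \<longleftrightarrow>
     stores_system s M c \<and> stores_solution s x \<and>
     (\<forall>a i. (a, i) \<notin> system_cells M \<union> {''sol''} \<times> {..<dim_vec x} \<longrightarrow> s a i = 0)"

section \<open>Efficient reducibility\<close>

text \<open>\<open>soft_linear C k p m\<close> is the bound hidden in soft-O of \<open>m\<close>, with the constant \<open>C\<close> and the
  exponent \<open>k\<close> of the logarithmic factor made explicit, so that they can be required not to
  depend on \<open>p\<close>.  The offsets account for the constant cost of running a program at all.\<close>

definition soft_linear :: "real \<Rightarrow> nat \<Rightarrow> nat \<Rightarrow> nat \<Rightarrow> real" where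
  "soft_linear C k p m = C * real (m + 1) * log 2 (real (p * (m + 2))) ^ k"

text \<open>\<open>efficiently_reducible C k p f \<M>1 \<M>2\<close>: for one fixed \<open>p\<close>, with \<open>C\<close> and \<open>k\<close> as in
  \<^const>\<open>soft_linear\<close>.  The requirement that a solvable instance be mapped to a solvable instance
  is what makes the notion non-vacuous: without it, an algorithm could answer every instance with
  a fixed unsolvable one.\<close>

definition efficiently_reducible ::
  "real \<Rightarrow> nat \<Rightarrow> nat \<Rightarrow> (nat \<Rightarrow> real) \<Rightarrow> int mat set \<Rightarrow> int mat set \<Rightarrow> bool" where
  "efficiently_reducible C k p f \<M>1 \<M>2 \<longleftrightarrow>
     mono f \<and>
     (\<exists>A12 A21. \<forall>M1 c1. M1 \<in> \<M>1 \<and> zp_system p M1 c1 \<longrightarrow>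
       (\<forall>s. input_system s M1 c1 \<longrightarrow>
         (\<exists>t s' M2 c2.
            exec p A12 s t s' \<and> real t \<le> soft_linear C k p (nnz M1) \<and>
            stores_system s' M2 c2 \<and> zp_system p M2 c2 \<and> M2 \<in> \<M>2 \<and>
            real (nnz M2) \<le> f (nnz M1) \<and>
            ((\<exists>x1. solves p M1 c1 x1) \<longrightarrow> (\<exists>x2. solves p M2 c2 x2)) \<and>
            (\<forall>x2 u. zp_vector p (dim_col M2) x2 \<and> input_system_solution u M2 c2 x2 \<longrightarrow>
              (\<exists>t' u'.
                 exec p A21 u t' u' \<and> real t' \<le> soft_linear C k p (nnz M1) \<and>
                 (solves p M2 c2 x2 \<longrightarrow>
                   (\<exists>x1. stores_solution u' x1 \<and> solves p M1 c1 x1)))))))"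

end

theory Submission
  imports Defs
begin

text \<open>
  An edge of weight \<open>w\<close> is replaced by a two-terminal unit-weight network of effective conductance
  \<open>w\<close> over the field.  The ladder network that follows the subtractive Euclidean algorithm on
  \<open>(a, b)\<close> has conductance \<open>a / b\<close> and as many edges as the algorithm has steps, and none of
  its series connections degenerates modulo \<open>p\<close> as long as \<open>a, b < p\<close>.  Counting the states of the
  algorithm shows that all but a small fraction of the pairs \<open>(a, b)\<close> in \<open>[1, p - 1]\<^sup>2\<close> need
  only \<open>S = O(log p * log log p)\<close> steps.  Every residue is represented by equally many pairs, so more
  than half of all residues are conductances of ladders of size \<open>S\<close>, and then every residue is the
  sum of two of them, i.e. the conductance of two ladders in parallel.

  Each edge is subdivided to keep the graph simple: into two edges of joint conductance \<open>1 / 2\<close>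
  for odd \<open>p\<close>, and into three for \<open>p = 2\<close>.
\<close>

section \<open>The cost of the subtractive Euclidean algorithm\<close>

text \<open>Plain averaging gives only about (log p)^2 steps per pair: a state with column sums
  (\<alpha>, \<beta>) in a run on a pair from [1, N]^2 has
  \<open>\<alpha> * u + \<beta> * v \<le> 2 * N\<close>, so at most 4 N^2 / (\<alpha> \<beta>)
  states share these sums, and summing 1 / (\<alpha> \<beta>) over all \<alpha>, \<beta> gives a
  product of two harmonic sums. If the ratio of \<alpha> and \<beta> stays below J in both
  directions, one of these sums shrinks to about ln J; with J of order log p, the pairs violating
  this are a small fraction. The resulting log p * log log p is, up to constants, at most (log p)^2
  / log log p. The obstacle over a finite field is that the conductance w1 w2 / (w1 + w2) of a
  series connection makes no sense when w1 + w2 = 0. In a ladder w1 + w2 is, up to invertible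
  factors, a positive integer below p. For p = 2 there is no 1 / 2, because the midpoint of a
  two-edge path has degree 0 in the field; three edges in series have conductance 1 / 3 = 1.\<close>

fun sub_cost :: "nat \<Rightarrow> nat \<Rightarrow> nat" where
  "sub_cost u v =
     (if u = 0 \<or> v = 0 \<or> u = v then 1
      else if v < u then Suc (sub_cost (u - v) v) else Suc (sub_cost u (v - u)))"

text \<open>Here \<open>(\<alpha>, \<beta>)\<close> are the column sums of the matrix accumulated by the subtractive Euclidean
  algorithm, so \<open>\<alpha> * u + \<beta> * v\<close> is invariant and \<open>(\<alpha>, \<beta>)\<close> alone determines all
  earlier steps: \<open>chain_root\<close> undoes them.\<close>

fun chain :: "nat \<Rightarrow> nat \<Rightarrow> nat \<Rightarrow> nat \<Rightarrow> (nat \<times> nat \<times> nat \<times> nat) list" where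
  "chain \<alpha> \<beta> u v = (\<alpha>, \<beta>, u, v) #
     (if u = 0 \<or> v = 0 \<or> u = v then []
      else if v < u then chain \<alpha> (\<alpha> + \<beta>) (u - v) v else chain (\<alpha> + \<beta>) \<beta> u (v - u))"

fun chain_root :: "nat \<Rightarrow> nat \<Rightarrow> nat \<Rightarrow> nat \<Rightarrow> nat \<times> nat" where
  "chain_root \<alpha> \<beta> u v =
     (if \<alpha> = 0 \<or> \<beta> = 0 \<or> \<alpha> = \<beta> then (u, v)
      else if \<alpha> < \<beta> then chain_root \<alpha> (\<beta> - \<alpha>) (u + v) v else chain_root (\<alpha> - \<beta>) \<beta> u (u + v))"

declare sub_cost.simps [simp del] chain.simps [simp del] chain_root.simps [simp del]

lemma length_chain: "length (chain \<alpha> \<beta> u v) = sub_cost u v"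
proof (induction \<alpha> \<beta> u v rule: chain.induct)
  case (1 \<alpha> \<beta> u v)
  then show ?case
    by (subst chain.simps, subst sub_cost.simps) auto
qed

text \<open>The conjuncts serve different ends: the conserved value of
  \<open>\<alpha> * u + \<beta> * v\<close> confines all states to a finite region,
  \<open>chain_root\<close> recovers the starting pair from any later state, and the growth of
  \<open>\<alpha> + \<beta>\<close> shows that no state repeats.\<close>

lemma chain_invariant:
  assumes "(\<alpha>', \<beta>', u', v') \<in> set (chain \<alpha> \<beta> u v)" "0 < \<alpha>" "0 < \<beta>" "0 < u" "0 < v"
  shows "0 < \<alpha>' \<and> 0 < \<beta>' \<and> 0 < u' \<and> 0 < v' \<and> \<alpha>' * u' + \<beta>' * v' = \<alpha> * u + \<beta> * v
    \<and> chain_root \<alpha>' \<beta>' u' v' = chain_root \<alpha> \<beta> u v \<and> \<alpha> + \<beta> \<le> \<alpha>' + \<beta>'"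
  using assms
proof (induction \<alpha> \<beta> u v rule: chain.induct)
  case (1 \<alpha> \<beta> u v)
  consider "u = v" | "v < u" | "u < v" by linarith
  then show ?case
  proof cases
    case 1
    then show ?thesis using "1.prems" by (subst (asm) chain.simps) simp
  next
    case 2
    have m: "(\<alpha>', \<beta>', u', v') = (\<alpha>, \<beta>, u, v) \<or> (\<alpha>', \<beta>', u', v') \<in> set (chain \<alpha> (\<alpha> + \<beta>) (u - v) v)"
      using "1.prems" 2 by (subst (asm) chain.simps) simp
    have r: "chain_root \<alpha> (\<alpha> + \<beta>) (u - v) v = chain_root \<alpha> \<beta> u v"
      using "1.prems" 2 by (subst chain_root.simps) simp
    have e: "\<alpha> * (u - v) + (\<alpha> + \<beta>) * v = \<alpha> * u + \<beta> * v"
    proof -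
      obtain d where "u = v + d" using 2 less_imp_add_positive by blast
      then show ?thesis by (simp add: algebra_simps)
    qed
    show ?thesis
      using m "1.IH"(1) "1.prems" 2 r e by fastforce
  next
    case 3
    have m: "(\<alpha>', \<beta>', u', v') = (\<alpha>, \<beta>, u, v) \<or> (\<alpha>', \<beta>', u', v') \<in> set (chain (\<alpha> + \<beta>) \<beta> u (v - u))"
      using "1.prems" 3 by (subst (asm) chain.simps) simp
    have r: "chain_root (\<alpha> + \<beta>) \<beta> u (v - u) = chain_root \<alpha> \<beta> u v"
      using "1.prems" 3 by (subst chain_root.simps) simp
    have e: "(\<alpha> + \<beta>) * u + \<beta> * (v - u) = \<alpha> * u + \<beta> * v"
    proof -
      obtain d where "v = u + d" using 3 less_imp_add_positive by blast
      then show ?thesis by (simp add: algebra_simps)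
    qed
    show ?thesis
      using m "1.IH"(2) "1.prems" 3 r e by fastforce
  qed
qed

lemma chain_root_start: "chain_root 1 1 u v = (u, v)"
  by (simp add: chain_root.simps)

lemma distinct_chain:
  assumes "0 < \<alpha>" "0 < \<beta>" "0 < u" "0 < v"
  shows "distinct (chain \<alpha> \<beta> u v)"
  using assms
proof (induction \<alpha> \<beta> u v rule: chain.induct)
  case (1 \<alpha> \<beta> u v)
  have "(\<alpha>, \<beta>, u, v) \<notin> set (chain \<alpha> (\<alpha> + \<beta>) (u - v) v)" if "v < u"
    using chain_invariant[of \<alpha> \<beta> u v \<alpha> "\<alpha> + \<beta>" "u - v" v] that "1.prems" by auto
  moreover have "(\<alpha>, \<beta>, u, v) \<notin> set (chain (\<alpha> + \<beta>) \<beta> u (v - u))" if "u < v"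
    using chain_invariant[of \<alpha> \<beta> u v "\<alpha> + \<beta>" \<beta> u "v - u"] that "1.prems" by auto
  ultimately show ?case
    using 1 by (subst chain.simps) auto
qed

text \<open>A discrete intermediate value argument: a step raises \<beta> / \<alpha> by exactly 1 or
  lowers it, so the quotient cannot jump over the interval [J, J + 1) on its way up.\<close>

lemma chain_crosses_left:
  assumes "(\<alpha>', \<beta>', u', v') \<in> set (chain \<alpha> \<beta> u v)" "J * \<alpha>' \<le> \<beta>'" "\<beta> < J * \<alpha>"
  shows "\<exists>(a, b, x, y)\<in>set (chain \<alpha> \<beta> u v). J * a \<le> b \<and> b < (J + 1) * a"
  using assms
proof (induction \<alpha> \<beta> u v rule: chain.induct)
  case (1 \<alpha> \<beta> u v)
  have hd: "(a, b, x, y) \<in> set (chain a b x y)" for a b x y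
    by (subst chain.simps) simp
  consider "u = 0 \<or> v = 0 \<or> u = v" | "0 < v" "v < u" | "0 < u" "u < v" by linarith
  then show ?case
  proof cases
    case 1
    then show ?thesis using "1.prems" by (subst (asm) chain.simps) auto
  next
    case 2
    have c: "chain \<alpha> \<beta> u v = (\<alpha>, \<beta>, u, v) # chain \<alpha> (\<alpha> + \<beta>) (u - v) v"
      using 2 by (subst chain.simps) simp
    then have m: "(\<alpha>', \<beta>', u', v') \<in> set (chain \<alpha> (\<alpha> + \<beta>) (u - v) v)"
      using "1.prems" by auto
    show ?thesis
    proof (cases "\<alpha> + \<beta> < J * \<alpha>")
      case True
      show ?thesis using "1.IH"(1)[OF _ _ m "1.prems"(2) True] 2 c by auto
    next
      case False
      have "(\<alpha>, \<alpha> + \<beta>, u - v, v) \<in> set (chain \<alpha> \<beta> u v)"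
        using hd c by simp
      moreover have "J * \<alpha> \<le> \<alpha> + \<beta> \<and> \<alpha> + \<beta> < (J + 1) * \<alpha>"
        using False "1.prems" by simp
      ultimately show ?thesis by blast
    qed
  next
    case 3
    have c: "chain \<alpha> \<beta> u v = (\<alpha>, \<beta>, u, v) # chain (\<alpha> + \<beta>) \<beta> u (v - u)"
      using 3 by (subst chain.simps) simp
    then have m: "(\<alpha>', \<beta>', u', v') \<in> set (chain (\<alpha> + \<beta>) \<beta> u (v - u))"
      using "1.prems" by auto
    have "\<beta> < J * (\<alpha> + \<beta>)" using "1.prems"(3) by (simp add: add_mult_distrib2)
    then show ?thesis using "1.IH"(2)[OF _ _ m "1.prems"(2)] 3 c by auto
  qed
qed

lemma chain_swap:
  "chain \<beta> \<alpha> v u = map (\<lambda>(a, b, x, y). (b, a, y, x)) (chain \<alpha> \<beta> u v)"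
proof (induction \<alpha> \<beta> u v rule: chain.induct)
  case (1 \<alpha> \<beta> u v)
  consider "u = 0 \<or> v = 0 \<or> u = v" | "0 < v" "v < u" | "0 < u" "u < v" by linarith
  then show ?case
  proof cases
    case 1
    then show ?thesis by (subst (1 2) chain.simps) auto
  next
    case 2
    then show ?thesis using "1.IH"(1) by (subst (1 2) chain.simps) (simp add: add.commute)
  next
    case 3
    then show ?thesis using "1.IH"(2) by (subst (1 2) chain.simps) (simp add: add.commute)
  qed
qed

lemma chain_crosses_right:
  assumes "(\<alpha>', \<beta>', u', v') \<in> set (chain \<alpha> \<beta> u v)" "J * \<beta>' \<le> \<alpha>'" "\<alpha> < J * \<beta>"
  shows "\<exists>(a, b, x, y)\<in>set (chain \<alpha> \<beta> u v). J * b \<le> a \<and> a < (J + 1) * b"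
proof -
  have "(\<beta>', \<alpha>', v', u') \<in> set (chain \<beta> \<alpha> v u)"
    using assms(1) by (force simp: chain_swap[of \<beta> \<alpha>])
  then show ?thesis
    using chain_crosses_left[of \<beta>' \<alpha>' v' u' \<beta> \<alpha> v u J] assms(2,3)
    by (force simp: chain_swap[of \<beta> \<alpha>])
qed

section \<open>Counting the states of the algorithm by their column sums\<close>

definition quads :: "nat \<Rightarrow> (nat \<Rightarrow> nat \<Rightarrow> bool) \<Rightarrow> (nat \<times> nat \<times> nat \<times> nat) set" where
  "quads n R = {(\<alpha>, \<beta>, u, v). 0 < \<alpha> \<and> 0 < \<beta> \<and> 0 < u \<and> 0 < v \<and> \<alpha> * u + \<beta> * v \<le> n \<and> R \<alpha> \<beta>}"

lemma quads_subset:
  "quads n R \<subseteq> (SIGMA \<alpha>:{1..n}. SIGMA \<beta>:{\<beta>\<in>{1..n}. R \<alpha> \<beta>}. {1..n div \<alpha>} \<times> {1..n div \<beta>})"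
proof -
  have *: "x \<le> n div y \<and> x \<le> n \<and> y \<le> n" if "0 < x" "0 < y" "y * x \<le> n" for x y
  proof -
    have "x \<le> n div y" using that by (simp add: less_eq_div_iff_mult_less_eq mult.commute)
    moreover have "x \<le> y * x" "y \<le> y * x" using that by auto
    ultimately show ?thesis using that by linarith
  qed
  show ?thesis
  proof
    fix X assume "X \<in> quads n R"
    then obtain \<alpha> \<beta> u v where X: "X = (\<alpha>, \<beta>, u, v)" "0 < \<alpha>" "0 < \<beta>" "0 < u" "0 < v"
      "\<alpha> * u + \<beta> * v \<le> n" "R \<alpha> \<beta>" by (auto simp: quads_def)
    then have "\<alpha> * u \<le> n" "\<beta> * v \<le> n" by linarith+
    then show "X \<in> (SIGMA \<alpha>:{1..n}. SIGMA \<beta>:{\<beta>\<in>{1..n}. R \<alpha> \<beta>}. {1..n div \<alpha>} \<times> {1..n div \<beta>})"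
      using X *[of u \<alpha>] *[of v \<beta>] by simp
  qed
qed

lemma finite_quads: "finite (quads n R)"
  by (rule finite_subset[OF quads_subset]) (auto intro!: finite_SigmaI)

text \<open>For fixed \<alpha> and \<beta> the triangle of admissible (u, v) is enlarged to the
  rectangle with sides n / \<alpha> and n / \<beta>, which loses only a constant factor.\<close>

lemma card_quads:
  "real (card (quads n R)) \<le>
     (real n)\<^sup>2 * (\<Sum>\<alpha>=1..n. \<Sum>\<beta>\<in>{\<beta>\<in>{1..n}. R \<alpha> \<beta>}. 1 / (real \<alpha> * real \<beta>))"
proof -
  have "card (quads n R) \<le>
    card (SIGMA \<alpha>:{1..n}. SIGMA \<beta>:{\<beta>\<in>{1..n}. R \<alpha> \<beta>}. {1..n div \<alpha>} \<times> {1..n div \<beta>})"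
    by (rule card_mono[OF _ quads_subset]) (auto intro!: finite_SigmaI)
  also have "\<dots> = (\<Sum>\<alpha>=1..n. \<Sum>\<beta>\<in>{\<beta>\<in>{1..n}. R \<alpha> \<beta>}. (n div \<alpha>) * (n div \<beta>))"
    by (simp add: card_cartesian_product)
  finally have "real (card (quads n R)) \<le>
    real (\<Sum>\<alpha>=1..n. \<Sum>\<beta>\<in>{\<beta>\<in>{1..n}. R \<alpha> \<beta>}. (n div \<alpha>) * (n div \<beta>))"
    by linarith
  also have "\<dots> = (\<Sum>\<alpha>=1..n. \<Sum>\<beta>\<in>{\<beta>\<in>{1..n}. R \<alpha> \<beta>}. real (n div \<alpha>) * real (n div \<beta>))"
    by simp
  also have "\<dots> \<le> (\<Sum>\<alpha>=1..n. \<Sum>\<beta>\<in>{\<beta>\<in>{1..n}. R \<alpha> \<beta>}. (real n)\<^sup>2 * (1 / (real \<alpha> * real \<beta>)))"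
  proof (intro sum_mono)
    fix \<alpha> \<beta>
    have "real (n div \<alpha>) * real (n div \<beta>) \<le> (real n / real \<alpha>) * (real n / real \<beta>)"
      by (intro mult_mono) (auto simp: of_nat_div_le_of_nat)
    then show "real (n div \<alpha>) * real (n div \<beta>) \<le> (real n)\<^sup>2 * (1 / (real \<alpha> * real \<beta>))"
      by (simp add: power2_eq_square)
  qed
  finally show ?thesis by (simp add: sum_distrib_left)
qed

lemma card_quads_swap: "card (quads n (\<lambda>\<alpha> \<beta>. R \<beta> \<alpha>)) = card (quads n R)"
  by (rule bij_betw_same_card[of "\<lambda>(a, b, x, y). (b, a, y, x)"],
      rule bij_betw_byWitness[of _ "\<lambda>(a, b, x, y). (b, a, y, x)"])
     (auto simp: quads_def add.commute)

lemma sum_inverse_le: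
  assumes "1 \<le> a" "a \<le> b"
  shows "(\<Sum>k=a..b. 1 / real k) \<le> 1 / real a + ln (real b / real a)"
  using assms(2)
proof (induction b rule: dec_induct)
  case base
  then show ?case using assms by simp
next
  case (step b)
  have b: "1 \<le> b" using assms step by simp
  have "ln (real b / real (Suc b)) \<le> real b / real (Suc b) - 1"
    using b by (intro ln_le_minus_one) auto
  also have "\<dots> = - (1 / real (Suc b))" by (simp add: field_simps)
  finally have "1 / real (Suc b) \<le> ln (real (Suc b)) - ln (real b)"
    using b by (simp add: ln_div)
  then show ?case
    using step b assms by (simp add: ln_div)
qed

text \<open>For each \<alpha> the strip contains at most \<alpha> values of \<beta>, each at least J
  \<alpha>, so the inner sum is at most 1 / (J \<alpha>). The factor 1 / J makes crossings of the
  strip rare.\<close>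

lemma card_quads_strip:
  assumes "1 \<le> n" "1 \<le> J"
  shows "real (card (quads n (\<lambda>\<alpha> \<beta>. J * \<alpha> \<le> \<beta> \<and> \<beta> < (J + 1) * \<alpha>)))
    \<le> (real n)\<^sup>2 * (1 + ln (real n)) / real J"
proof -
  have inner: "(\<Sum>\<beta>\<in>{\<beta>\<in>{1..n}. J * \<alpha> \<le> \<beta> \<and> \<beta> < (J + 1) * \<alpha>}. 1 / (real \<alpha> * real \<beta>))
      \<le> (1 / real \<alpha>) / real J" if "1 \<le> \<alpha>" for \<alpha>
  proof -
    let ?B = "{\<beta>\<in>{1..n}. J * \<alpha> \<le> \<beta> \<and> \<beta> < (J + 1) * \<alpha>}"
    have "card ?B \<le> card {J * \<alpha>..<(J + 1) * \<alpha>}" by (rule card_mono) auto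
    then have c: "real (card ?B) \<le> real \<alpha>" by simp
    have "(\<Sum>\<beta>\<in>?B. 1 / (real \<alpha> * real \<beta>)) \<le> (\<Sum>\<beta>\<in>?B. 1 / (real \<alpha> * (real J * real \<alpha>)))"
    proof (intro sum_mono divide_left_mono mult_left_mono)
      fix \<beta> assume "\<beta> \<in> ?B"
      then have "J * \<alpha> \<le> \<beta>" "1 \<le> \<beta>" by auto
      then show "real J * real \<alpha> \<le> real \<beta>" by (metis of_nat_le_iff of_nat_mult)
      show "0 < real \<alpha> * real \<beta> * (real \<alpha> * (real J * real \<alpha>))"
        using \<open>1 \<le> \<beta>\<close> that assms by simp
    qed auto
    also have "\<dots> = real (card ?B) * (1 / (real \<alpha> * (real J * real \<alpha>)))" by simp
    also have "\<dots> \<le> real \<alpha> * (1 / (real \<alpha> * (real J * real \<alpha>)))"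
      by (intro mult_right_mono c) auto
    also have "\<dots> = (1 / real \<alpha>) / real J" using that by simp
    finally show ?thesis .
  qed
  have "(\<Sum>\<alpha>=1..n. \<Sum>\<beta>\<in>{\<beta>\<in>{1..n}. J * \<alpha> \<le> \<beta> \<and> \<beta> < (J + 1) * \<alpha>}. 1 / (real \<alpha> * real \<beta>))
      \<le> (\<Sum>\<alpha>=1..n. (1 / real \<alpha>) / real J)"
    by (intro sum_mono inner) simp
  also have "\<dots> = (\<Sum>\<alpha>=1..n. 1 / real \<alpha>) / real J" by (simp add: sum_divide_distrib)
  also have "\<dots> \<le> (1 + ln (real n)) / real J"
    using sum_inverse_le[of 1 n] assms by (intro divide_right_mono) auto
  finally show ?thesis
    using card_quads[of n "\<lambda>\<alpha> \<beta>. J * \<alpha> \<le> \<beta> \<and> \<beta> < (J + 1) * \<alpha>"]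
      mult_left_mono[of _ "(1 + ln (real n)) / real J" "(real n)\<^sup>2"] by fastforce
qed

text \<open>The inner sum is harmonic over [\<alpha>, J \<alpha>] only, so it contributes ln J
  instead of a second ln n.\<close>

lemma card_quads_wedge:
  assumes "1 \<le> n" "1 \<le> J"
  shows "real (card (quads n (\<lambda>\<alpha> \<beta>. \<alpha> \<le> \<beta> \<and> \<beta> \<le> J * \<alpha>)))
    \<le> (real n)\<^sup>2 * ((1 + ln (real n)) * (1 + ln (real J)))"
proof -
  have inner: "(\<Sum>\<beta>\<in>{\<beta>\<in>{1..n}. \<alpha> \<le> \<beta> \<and> \<beta> \<le> J * \<alpha>}. 1 / (real \<alpha> * real \<beta>))
      \<le> (1 / real \<alpha>) * (1 + ln (real J))" if "1 \<le> \<alpha>" for \<alpha>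
  proof -
    have "(\<Sum>\<beta>\<in>{\<beta>\<in>{1..n}. \<alpha> \<le> \<beta> \<and> \<beta> \<le> J * \<alpha>}. 1 / (real \<alpha> * real \<beta>))
        \<le> (\<Sum>\<beta>=\<alpha>..J*\<alpha>. 1 / (real \<alpha> * real \<beta>))"
      by (intro sum_mono2) auto
    also have "\<dots> = (1 / real \<alpha>) * (\<Sum>\<beta>=\<alpha>..J*\<alpha>. 1 / real \<beta>)"
      by (simp add: sum_distrib_left)
    also have "\<dots> \<le> (1 / real \<alpha>) * (1 / real \<alpha> + ln (real (J * \<alpha>) / real \<alpha>))"
      using that assms by (intro mult_left_mono sum_inverse_le) auto
    also have "\<dots> \<le> (1 / real \<alpha>) * (1 + ln (real J))"
      using that by (intro mult_left_mono add_mono) auto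
    finally show ?thesis .
  qed
  have "(\<Sum>\<alpha>=1..n. \<Sum>\<beta>\<in>{\<beta>\<in>{1..n}. \<alpha> \<le> \<beta> \<and> \<beta> \<le> J * \<alpha>}. 1 / (real \<alpha> * real \<beta>))
      \<le> (\<Sum>\<alpha>=1..n. (1 / real \<alpha>) * (1 + ln (real J)))"
    by (intro sum_mono inner) simp
  also have "\<dots> = (\<Sum>\<alpha>=1..n. 1 / real \<alpha>) * (1 + ln (real J))" by (simp add: sum_distrib_right)
  also have "\<dots> \<le> (1 + ln (real n)) * (1 + ln (real J))"
    using sum_inverse_le[of 1 n] assms by (intro mult_right_mono) auto
  finally show ?thesis
    using card_quads[of n "\<lambda>\<alpha> \<beta>. \<alpha> \<le> \<beta> \<and> \<beta> \<le> J * \<alpha>"]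
      mult_left_mono[of _ "(1 + ln (real n)) * (1 + ln (real J))" "(real n)\<^sup>2"] by fastforce
qed

text \<open>Since \<open>chain_root\<close> maps a state back to its pair, there are at most as many
  pairs as states to choose from. The argument \<open>2 * N\<close> bounds a + b, the value of the
  invariant in the initial state (1, 1, a, b).\<close>

lemma card_pairs_meeting:
  assumes "P \<subseteq> {1..N} \<times> {1..N}"
    "\<And>a b. (a, b) \<in> P \<Longrightarrow> \<exists>(\<alpha>, \<beta>, x, y)\<in>set (chain 1 1 a b). R \<alpha> \<beta>"
  shows "card P \<le> card (quads (2 * N) R)"
proof -
  have "P \<subseteq> (\<lambda>(\<alpha>, \<beta>, u, v). chain_root \<alpha> \<beta> u v) ` quads (2 * N) R"
  proof
    fix X assume X: "X \<in> P"
    obtain a b where ab: "X = (a, b)" by fastforce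
    with X assms(1) have r: "0 < a" "0 < b" "a \<le> N" "b \<le> N" by auto
    obtain \<alpha> \<beta> x y where c: "(\<alpha>, \<beta>, x, y) \<in> set (chain 1 1 a b)" "R \<alpha> \<beta>"
      using assms(2)[of a b] X ab by blast
    have "(\<alpha>, \<beta>, x, y) \<in> quads (2 * N) R" "chain_root \<alpha> \<beta> x y = (a, b)"
      using chain_invariant[OF c(1)] r c(2) by (auto simp: quads_def chain_root_start[simplified])
    then show "X \<in> (\<lambda>(\<alpha>, \<beta>, u, v). chain_root \<alpha> \<beta> u v) ` quads (2 * N) R"
      using ab by (auto intro!: image_eqI[of _ _ "(\<alpha>, \<beta>, x, y)"])
  qed
  then show ?thesis
    by (meson card_image_le card_mono finite_imageI finite_quads le_trans)
qed

text \<open>The cost of a pair is the number of states in its run. Runs of different pairs are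
  disjoint because a state determines its pair, so the total cost is the size of one set of
  states.\<close>

lemma sum_cost_within:
  assumes "P \<subseteq> {1..N} \<times> {1..N}"
    "\<And>a b \<alpha> \<beta> x y. (a, b) \<in> P \<Longrightarrow> (\<alpha>, \<beta>, x, y) \<in> set (chain 1 1 a b) \<Longrightarrow> R \<alpha> \<beta>"
  shows "(\<Sum>(a, b)\<in>P. sub_cost a b) \<le> card (quads (2 * N) R)"
proof -
  have fin: "finite P" using assms(1) finite_subset by blast
  let ?C = "\<lambda>(a, b). set (chain 1 1 a b)"
  have root: "chain_root \<alpha> \<beta> x y = (a, b)" "(\<alpha>, \<beta>, x, y) \<in> quads (2 * N) R"
    if "(a, b) \<in> P" "(\<alpha>, \<beta>, x, y) \<in> set (chain 1 1 a b)" for a b \<alpha> \<beta> x y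
    using chain_invariant[OF that(2)] assms(1) assms(2)[OF that] that(1)
    by (force simp: chain_root_start[simplified] quads_def)+
  have "(\<Sum>(a, b)\<in>P. sub_cost a b) = (\<Sum>X\<in>P. card (?C X))"
  proof (rule sum.cong)
    fix X assume "X \<in> P"
    then show "(case X of (a, b) \<Rightarrow> sub_cost a b) = card (?C X)"
      using assms(1) distinct_chain[of 1 1 "fst X" "snd X"]
      by (auto simp: distinct_card length_chain)
  qed simp
  also have "\<dots> = card (\<Union>X\<in>P. ?C X)"
  proof (rule card_UN_disjoint[symmetric])
    show "\<forall>X\<in>P. \<forall>Y\<in>P. X \<noteq> Y \<longrightarrow> ?C X \<inter> ?C Y = {}"
    proof (intro ballI impI)
      fix X Y assume "X \<in> P" "Y \<in> P" "X \<noteq> Y"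
      then show "?C X \<inter> ?C Y = {}"
        using root(1) by (cases X; cases Y) (fastforce simp: disjoint_iff)
    qed
  qed (use fin in auto)
  also have "\<dots> \<le> card (quads (2 * N) R)"
    by (rule card_mono[OF finite_quads]) (use root(2) in auto)
  finally show ?thesis .
qed

text \<open>A quotient exceeding \<open>J\<close> forces a state with \<open>J * \<alpha> \<le> \<beta> < (J + 1) * \<alpha>\<close> or its mirror
  image; removing these pairs first replaces one of the two logarithmic factors in the average number
  of steps by \<open>ln J\<close>.\<close>

lemma card_expensive_pairs:
  assumes "1 \<le> N" "2 \<le> J" "1 \<le> S"
  shows "real (card {(a, b)\<in>{1..N} \<times> {1..N}. S < sub_cost a b})
    \<le> 8 * (real N)\<^sup>2 * (1 + ln (real (2 * N))) / real J
      + 8 * (real N)\<^sup>2 * ((1 + ln (real (2 * N))) * (1 + ln (real J))) / real S"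
proof -
  define L where "L = (\<lambda>\<alpha> \<beta>. J * \<alpha> \<le> \<beta> \<and> \<beta> < (J + 1) * \<alpha>)"
  define W where "W = (\<lambda>\<alpha> \<beta>. \<alpha> \<le> \<beta> \<and> \<beta> \<le> J * \<alpha>)"
  define P where "P = {(a, b)\<in>{1..N} \<times> {1..N}. S < sub_cost a b}"
  define P1 where "P1 = {(a, b)\<in>P. \<exists>(\<alpha>, \<beta>, x, y)\<in>set (chain 1 1 a b). L \<alpha> \<beta>}"
  define P2 where "P2 = {(a, b)\<in>P. \<exists>(\<alpha>, \<beta>, x, y)\<in>set (chain 1 1 a b). L \<beta> \<alpha>}"
  define P3 where "P3 = P - P1 - P2"
  have fin: "finite P" unfolding P_def by (rule finite_subset[of _ "{1..N} \<times> {1..N}"]) auto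
  have c1: "card P1 \<le> card (quads (2 * N) L)"
    by (rule card_pairs_meeting) (auto simp: P1_def P_def)
  have c2: "card P2 \<le> card (quads (2 * N) L)"
    unfolding card_quads_swap[of "2 * N" L, symmetric]
    by (rule card_pairs_meeting) (auto simp: P2_def P_def)
  \<comment> \<open>Markov's inequality: each remaining pair costs more than S, while all their
    states lie in the two mirror-image wedges.\<close>
  have c3: "S * card P3 \<le> 2 * card (quads (2 * N) W)"
  proof -
    have "S * card P3 = (\<Sum>(a, b)\<in>P3. S)" by (simp add: case_prod_unfold)
    also have "\<dots> \<le> (\<Sum>(a, b)\<in>P3. sub_cost a b)"
      by (rule sum_mono) (auto simp: P3_def P_def)
    also have "\<dots> \<le> card (quads (2 * N) (\<lambda>\<alpha> \<beta>. W \<alpha> \<beta> \<or> W \<beta> \<alpha>))"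
    proof (rule sum_cost_within)
      fix a b \<alpha> \<beta> x y
      assume ab: "(a, b) \<in> P3" and c: "(\<alpha>, \<beta>, x, y) \<in> set (chain 1 1 a b)"
      have "\<not> J * \<alpha> \<le> \<beta>"
        using chain_crosses_left[OF c, of J] assms(2) ab
        by (auto simp: P3_def P1_def L_def)
      moreover have "\<not> J * \<beta> \<le> \<alpha>"
        using chain_crosses_right[OF c, of J] assms(2) ab
        by (auto simp: P3_def P2_def L_def)
      ultimately show "W \<alpha> \<beta> \<or> W \<beta> \<alpha>" by (auto simp: W_def)
    qed (auto simp: P3_def P_def)
    also have "\<dots> \<le> card (quads (2 * N) W \<union> quads (2 * N) (\<lambda>\<alpha> \<beta>. W \<beta> \<alpha>))"
      by (intro card_mono finite_UnI finite_quads) (auto simp: quads_def)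
    also have "\<dots> \<le> 2 * card (quads (2 * N) W)"
      using card_Un_le[of "quads (2 * N) W" "quads (2 * N) (\<lambda>\<alpha> \<beta>. W \<beta> \<alpha>)"]
      unfolding card_quads_swap[of "2 * N" W] by simp
    finally show ?thesis .
  qed
  have "card P \<le> card P1 + card P2 + card P3"
  proof -
    have "P = P1 \<union> P2 \<union> P3" by (auto simp: P1_def P2_def P3_def)
    then show ?thesis by (metis add_right_mono card_Un_le le_trans)
  qed
  then have "real (card P) \<le> real (card P1) + real (card P2) + real (card P3)" by linarith
  moreover have "real (card (quads (2 * N) L)) \<le> 4 * (real N)\<^sup>2 * (1 + ln (real (2 * N))) / real J"
    using card_quads_strip[of "2 * N" J] assms by (simp add: L_def power2_eq_square)
  moreover have "real (card P3) \<le> 8 * (real N)\<^sup>2 * ((1 + ln (real (2 * N))) * (1 + ln (real J))) / real S"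
  proof -
    have "real S * real (card P3) \<le> 2 * real (card (quads (2 * N) W))"
      using c3 by (metis of_nat_le_iff of_nat_mult of_nat_numeral)
    also have "\<dots> \<le> 2 * (4 * (real N)\<^sup>2 * ((1 + ln (real (2 * N))) * (1 + ln (real J))))"
      using card_quads_wedge[of "2 * N" J] assms by (simp add: W_def power2_eq_square mult_ac)
    finally show ?thesis using assms(3) by (simp add: pos_le_divide_eq mult_ac)
  qed
  moreover have "real (card P1) \<le> real (card (quads (2 * N) L))"
    "real (card P2) \<le> real (card (quads (2 * N) L))" using c1 c2 by simp_all
  moreover have "8 * (real N)\<^sup>2 * (1 + ln (real (2 * N))) / real J
      = 2 * (4 * (real N)\<^sup>2 * (1 + ln (real (2 * N))) / real J)" by simp
  ultimately show ?thesis unfolding P_def by linarith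
qed

section \<open>From cheap pairs to every residue\<close>

text \<open>If no b makes w cheap, then all p - 1 pairs (w b, b) representing w are expensive, and
  pairs for different w are different. With N = p - 1, at most N / 5 residues are thus missing, and
  8 N / 5 > N + 1 already for N = 2.\<close>

lemma cheap_residues:
  assumes "prime p" "2 < p" "1 \<le> S"
    and few: "5 * card {(a, b)\<in>{1..p - 1} \<times> {1..p - 1}. S < sub_cost a b} \<le> (p - 1)\<^sup>2"
  shows "p < 2 * card {w\<in>{1..p - 1}. \<exists>b\<in>{1..p - 1}. sub_cost (w * b mod p) b \<le> S}"
proof -
  define N where "N = p - 1"
  define A where "A = {w\<in>{1..N}. \<exists>b\<in>{1..N}. sub_cost (w * b mod p) b \<le> S}"
  have p: "p = N + 1" "2 \<le> N" using assms(2) by (auto simp: N_def)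
  have AN: "A \<subseteq> {1..N}" by (auto simp: A_def)
  let ?g = "\<lambda>(w, b). (w * b mod p, b)"
  have "card (({1..N} - A) \<times> {1..N}) \<le> card {(a, b)\<in>{1..N} \<times> {1..N}. S < sub_cost a b}"
  proof (rule card_inj_on_le[of ?g])
    show "inj_on ?g (({1..N} - A) \<times> {1..N})"
    proof (rule inj_onI, clarsimp)
      fix w w' b assume *: "w * b mod p = w' * b mod p" and b: "Suc 0 \<le> b" "b \<le> N"
        and w: "w \<le> N" "w' \<le> N"
      have "coprime b p"
        using b p assms(1) by (metis Suc_le_eq coprime_commute dvd_imp_le leD less_add_one
            order_le_less_trans prime_imp_coprime)
      then have "[w = w'] (mod p)" using * by (simp add: cong_def[symmetric] cong_mult_rcancel_nat)
      then show "w = w'" using w p by (simp add: cong_def)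
    qed
    show "?g ` (({1..N} - A) \<times> {1..N}) \<subseteq> {(a, b)\<in>{1..N} \<times> {1..N}. S < sub_cost a b}"
    proof clarsimp
      fix w b assume w: "Suc 0 \<le> w" "w \<le> N" "w \<notin> A" and b: "Suc 0 \<le> b" "b \<le> N"
      have "\<not> p dvd w" "\<not> p dvd b" using w b p by (auto dest: dvd_imp_le)
      then have "\<not> p dvd w * b" using assms(1) prime_dvd_mult_iff by blast
      then have "0 < w * b mod p" by (simp add: dvd_eq_mod_eq_0)
      moreover have "w * b mod p < p" using p by simp
      ultimately show "Suc 0 \<le> w * b mod p \<and> w * b mod p \<le> N \<and> S < sub_cost (w * b mod p) b"
        using w b p unfolding A_def by (simp add: not_le)
    qed
    show "finite {(a, b)\<in>{1..N} \<times> {1..N}. S < sub_cost a b}"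
      by (rule finite_subset[of _ "{1..N} \<times> {1..N}"]) auto
  qed
  moreover have "card ({1..N} - A) = N - card A"
    using card_Diff_subset[OF finite_subset[OF AN] AN] by simp
  ultimately have "(N - card A) * N \<le> card {(a, b)\<in>{1..N} \<times> {1..N}. S < sub_cost a b}"
    by (simp only: card_cartesian_product card_atLeastAtMost diff_Suc_1)
  then have "5 * ((N - card A) * N) \<le> N * N"
    using few unfolding N_def[symmetric] power2_eq_square by linarith
  then have "(5 * (N - card A)) * N \<le> N * N" by (simp only: mult.assoc)
  then have "5 * (N - card A) \<le> N" using p by (simp only: mult_le_cancel2)
  then have "p < 2 * card A" using p by linarith
  then show ?thesis unfolding A_def N_def .
qed

text \<open>Pigeonhole: the sets A and t - A have the same size, more than p / 2, so they meet. The
  map \<open>h\<close> is x \<mapsto> t - x modulo p.\<close>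

lemma sum_of_two_residues:
  fixes A :: "nat set"
  assumes "A \<subseteq> {..<p}" "p < 2 * card A"
  shows "\<exists>x\<in>A. \<exists>y\<in>A. [x + y = t] (mod p)"
proof (rule ccontr)
  assume no: "\<not> ?thesis"
  have p: "0 < p" using assms by (cases p) auto
  define h where "h x = (t + (p - x)) mod p" for x
  have h: "[x + h x = t] (mod p)" if "x \<in> A" for x
  proof -
    have "[x + h x = x + (t + (p - x))] (mod p)"
      by (simp add: h_def cong_def mod_add_right_eq)
    moreover have "x + (t + (p - x)) = t + p" using that assms(1) by auto
    ultimately show ?thesis by (simp add: cong_def)
  qed
  have "inj_on h A"
  proof (rule inj_onI)
    fix x y assume xy: "x \<in> A" "y \<in> A" "h x = h y"
    then have "[x + h x = y + h x] (mod p)" using h by (metis cong_sym cong_trans)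
    then have "[x = y] (mod p)" by (simp add: cong_add_rcancel_nat)
    then show "x = y" using xy(1,2) assms(1) by (auto simp: cong_def subset_iff)
  qed
  moreover have "h ` A \<subseteq> {..<p} - A" using no h p by (auto simp: h_def)
  ultimately have "card A \<le> card ({..<p} - A)" using card_inj_on_le by blast
  also have "\<dots> = p - card A" using assms(1) by (simp add: card_Diff_subset finite_subset)
  finally show False using assms(2) by linarith
qed

text \<open>The congruence is t = a / b + c / d with denominators cleared.\<close>

lemma two_cheap_fractions:
  assumes "prime p" "2 < p" "1 \<le> S"
    and "5 * card {(a, b)\<in>{1..p - 1} \<times> {1..p - 1}. S < sub_cost a b} \<le> (p - 1)\<^sup>2"
  shows "\<exists>a b c d. a \<in> {1..<p} \<and> b \<in> {1..<p} \<and> c \<in> {1..<p} \<and> d \<in> {1..<p} \<and>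
    sub_cost a b \<le> S \<and> sub_cost c d \<le> S \<and> [a * d + c * b = t * (b * d)] (mod p)"
proof -
  define A where "A = {w\<in>{1..p - 1}. \<exists>b\<in>{1..p - 1}. sub_cost (w * b mod p) b \<le> S}"
  have "p < 2 * card A" unfolding A_def by (rule cheap_residues[OF assms])
  moreover have "A \<subseteq> {..<p}" by (auto simp: A_def)
  ultimately obtain x y where xy: "x \<in> A" "y \<in> A" "[x + y = t] (mod p)"
    using sum_of_two_residues by blast
  obtain b where b: "b \<in> {1..p - 1}" "sub_cost (x * b mod p) b \<le> S" using xy(1) by (auto simp: A_def)
  obtain d where d: "d \<in> {1..p - 1}" "sub_cost (y * d mod p) d \<le> S" using xy(2) by (auto simp: A_def)
  have pos: "w * k mod p \<in> {1..<p}" if "w \<in> {1..p - 1}" "k \<in> {1..p - 1}" for w k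
  proof -
    have "\<not> p dvd w" "\<not> p dvd k" using that by (auto dest: dvd_imp_le)
    then have "\<not> p dvd w * k" using assms(1) prime_dvd_mult_iff by blast
    then have "0 < w * k mod p" by (simp add: dvd_eq_mod_eq_0)
    then show ?thesis using assms(2) by (simp add: Suc_le_eq)
  qed
  have "[(x * b mod p) * d + (y * d mod p) * b = x * b * d + y * d * b] (mod p)"
    by (intro cong_add cong_mult) (auto simp: cong_def)
  also have "x * b * d + y * d * b = (x + y) * (b * d)" by (simp add: algebra_simps)
  also have "[(x + y) * (b * d) = t * (b * d)] (mod p)"
    by (intro cong_mult xy(3)) auto
  finally have eq: "[(x * b mod p) * d + (y * d mod p) * b = t * (b * d)] (mod p)" .
  have "x \<in> {1..p - 1}" "y \<in> {1..p - 1}" using xy(1,2) unfolding A_def by blast+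
  then have "x * b mod p \<in> {1..<p}" "y * d mod p \<in> {1..<p}" using pos b(1) d(1) by blast+
  moreover have "b \<in> {1..<p}" "d \<in> {1..<p}" using b(1) d(1) assms(2) by auto
  ultimately show ?thesis using b(2) d(2) eq
    by (intro exI[of _ "x * b mod p"] exI[of _ b] exI[of _ "y * d mod p"] exI[of _ d] conjI) assumption+
qed

section \<open>Choice of the parameters J and S\<close>

definition size_bound :: "nat \<Rightarrow> real" where
  "size_bound p = (log 2 (real p))\<^sup>2 / max 1 (log 2 (log 2 (real p)))"

text \<open>With M the maximum on the left, this converts a bound of the form L M, which the
  counting yields, into L^2 / M: indeed L M = L M^2 / M.\<close>

lemma max_log_square_le:
  fixes L :: real
  assumes "1 \<le> L"
  shows "(max 1 (log 2 L))\<^sup>2 \<le> 16 * L"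
proof -
  have "ln L = 2 * ln (sqrt L)" using assms by (simp add: ln_sqrt)
  also have "\<dots> \<le> 2 * sqrt L" using ln_bound[of "sqrt L"] assms by simp
  finally have "ln L \<le> 2 * sqrt L" .
  moreover have "1 / 2 \<le> ln (2::real)"
    using ln_le_minus_one[of "1 / 2 :: real"] by (simp add: ln_div)
  then have "4 * sqrt L * (1 / 2) \<le> 4 * sqrt L * ln 2"
    using assms by (intro mult_left_mono) auto
  ultimately have "ln L \<le> 4 * sqrt L * ln 2" by linarith
  then have "log 2 L \<le> 4 * sqrt L" by (simp add: log_def divide_le_eq)
  moreover have "1 \<le> sqrt L" using assms by simp
  ultimately have "max 1 (log 2 L) \<le> 4 * sqrt L" by linarith
  then have "(max 1 (log 2 L))\<^sup>2 \<le> (4 * sqrt L)\<^sup>2" by (intro power_mono) auto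
  also have "\<dots> = 16 * L" using assms by (simp add: power_mult_distrib)
  finally show ?thesis .
qed

lemma cost_bound_exists:
  assumes "2 < p"
  shows "\<exists>S\<ge>1. real S \<le> 38880 * size_bound p \<and>
    5 * card {(a, b)\<in>{1..p - 1} \<times> {1..p - 1}. S < sub_cost a b} \<le> (p - 1)\<^sup>2"
proof -
  define N where "N = p - 1"
  define L where "L = log 2 (real p)"
  define M where "M = max 1 (log 2 L)"
  define H where "H = 1 + ln (real (2 * N))"
  \<comment> \<open>The factors 80 in J and S make each of the two terms of
    \<open>card_expensive_pairs\<close> at most N^2 / 10, hence the expensive pairs at most one
    fifth of all pairs.\<close>
  define J where "J = nat \<lceil>80 * H\<rceil>"
  define S where "S = nat \<lceil>80 * (H * (1 + ln (real J)))\<rceil>"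
  have N: "2 \<le> N" "real N \<le> real p" using assms by (auto simp: N_def)
  have L: "1 \<le> L" using assms by (simp add: L_def)
  have H1: "1 \<le> H" using N by (simp add: H_def)
  have ln_le: "ln x \<le> log 2 x" if "1 \<le> x" for x :: real
    using that ln_2_less_1 by (simp add: log_def le_divide_eq mult_left_le)
  have "ln (real (2 * N)) \<le> log 2 (real (2 * N))" using N by (intro ln_le) auto
  also have "\<dots> \<le> log 2 (2 * real p)" using N by simp
  also have "\<dots> = 1 + L" using assms by (simp add: L_def log_mult)
  finally have H: "H \<le> 3 * L" using L by (simp add: H_def)
  have J: "80 * H \<le> real J" "real J \<le> 80 * H + 1" "2 \<le> J"
    using H1 unfolding J_def by linarith+
  then have J2: "real J \<le> 241 * L" using H L by linarith
  have "1 + ln (real J) \<le> 1 + ln (241 * L)" using J2 J(3) by simp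
  also have "\<dots> \<le> 1 + (log 2 241 + ln L)"
    using L ln_le[of 241] by (simp add: ln_mult)
  also have "log 2 (241::real) \<le> log 2 (2 ^ 8)" by (subst log_le_cancel_iff) auto
  also have "log 2 ((2::real) ^ 8) = 8" by (subst log_nat_power) auto
  finally have lnJ: "1 + ln (real J) \<le> 10 * M" using ln_le[OF L] by (simp add: M_def)
  have lnJ0: "1 \<le> 1 + ln (real J)" using J(3) by simp
  have prod1: "1 \<le> H * (1 + ln (real J))" using H1 lnJ0 mult_mono[of 1 H 1 "1 + ln (real J)"] by simp
  have S: "80 * (H * (1 + ln (real J))) \<le> real S" "real S \<le> 80 * (H * (1 + ln (real J))) + 1" "1 \<le> S"
    using prod1 unfolding S_def by linarith+
  \<comment> \<open>The constant 38880 is 81 * 30 * 16: rounding up turns 80 into 81, the estimates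
    \<open>H\<close> and \<open>lnJ\<close> contribute 3 * 10, and \<open>max_log_square_le\<close>
    contributes 16.\<close>
  have "real S \<le> 81 * (H * (1 + ln (real J)))" using S(2) prod1 by linarith
  also have "\<dots> \<le> 81 * ((3 * L) * (10 * M))"
    using H lnJ H1 lnJ0 L by (intro mult_left_mono mult_mono) auto
  finally have "real S * M \<le> 81 * ((3 * L) * (10 * M)) * M"
    by (intro mult_right_mono) (auto simp: M_def)
  also have "\<dots> = 2430 * L * M\<^sup>2" by (simp add: power2_eq_square)
  also have "\<dots> \<le> 2430 * L * (16 * L)"
    using max_log_square_le[OF L] L unfolding M_def by (intro mult_left_mono) auto
  finally have "real S * M \<le> 38880 * L\<^sup>2" by (simp add: power2_eq_square)
  then have bound: "real S \<le> 38880 * L\<^sup>2 / M" by (simp add: M_def pos_le_divide_eq)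
  have "real (card {(a, b)\<in>{1..N} \<times> {1..N}. S < sub_cost a b})
    \<le> 8 * (real N)\<^sup>2 * H / real J + 8 * (real N)\<^sup>2 * (H * (1 + ln (real J))) / real S"
    unfolding H_def by (rule card_expensive_pairs) (use N J S in auto)
  also have "\<dots> \<le> (real N)\<^sup>2 / 10 + (real N)\<^sup>2 / 10"
  proof (rule add_mono)
    have "8 * (real N)\<^sup>2 * H = (real N)\<^sup>2 * (8 * H)" by simp
    also have "\<dots> \<le> (real N)\<^sup>2 * (real J / 10)" using J by (intro mult_left_mono) auto
    finally show "8 * (real N)\<^sup>2 * H / real J \<le> (real N)\<^sup>2 / 10"
      using J(3) by (simp add: divide_le_eq)
    have "8 * (real N)\<^sup>2 * (H * (1 + ln (real J))) = (real N)\<^sup>2 * (8 * (H * (1 + ln (real J))))" by simp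
    also have "\<dots> \<le> (real N)\<^sup>2 * (real S / 10)" using S by (intro mult_left_mono) auto
    finally show "8 * (real N)\<^sup>2 * (H * (1 + ln (real J))) / real S \<le> (real N)\<^sup>2 / 10"
      using S(3) by (simp add: divide_le_eq)
  qed
  finally have "real (5 * card {(a, b)\<in>{1..N} \<times> {1..N}. S < sub_cost a b}) \<le> real (N\<^sup>2)" by simp
  then have "5 * card {(a, b)\<in>{1..N} \<times> {1..N}. S < sub_cost a b} \<le> N\<^sup>2" using of_nat_le_iff by blast
  then show ?thesis
    using S(3) bound unfolding N_def size_bound_def L_def M_def by (intro exI[of _ S]) simp
qed

section \<open>Networks of given conductance\<close>

text \<open>Graphs are lists of arcs that contain both orientations of every edge, and \<open>cur H x v\<close> is
  row \<open>v\<close> of the unit-weight Laplacian applied to \<open>x\<close>.\<close>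

definition cur :: "(nat \<times> nat) list \<Rightarrow> (nat \<Rightarrow> int) \<Rightarrow> nat \<Rightarrow> int" where
  "cur H x v = (\<Sum>(a, b)\<leftarrow>H. if a = v then x a - x b else 0)"

lemma cur_Nil [simp]: "cur [] x v = 0"
  and cur_Cons [simp]: "cur ((a, b) # H) x v = (if a = v then x a - x b else 0) + cur H x v"
  and cur_append [simp]: "cur (H @ K) x v = cur H x v + cur K x v"
  by (simp_all add: cur_def)

lemma cur_eq_0: "v \<notin> fst ` set H \<Longrightarrow> cur H x v = 0"
  by (induction H) auto

lemma cur_cong:
  assumes "\<And>a b. (a, b) \<in> set H \<Longrightarrow> x a = y a \<and> x b = y b"
  shows "cur H x v = cur H y v"
  using assms
proof (induction H)
  case (Cons e H)
  obtain a b where e: "e = (a, b)" by fastforce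
  have "cur H x v = cur H y v" by (rule Cons.IH) (rule Cons.prems, simp)
  then show ?case using Cons.prems[of a b] e by auto
qed simp

definition gadget_graph :: "nat \<Rightarrow> nat \<Rightarrow> nat set \<Rightarrow> (nat \<times> nat) list \<Rightarrow> bool" where
  "gadget_graph a b I H \<longleftrightarrow> a \<noteq> b \<and> a \<notin> I \<and> b \<notin> I \<and> distinct H \<and>
     (\<forall>(x, y)\<in>set H. (y, x) \<in> set H \<and> x \<noteq> y \<and> x \<in> I \<union> {a, b} \<and> y \<in> I \<union> {a, b} \<and> (x \<in> I \<or> y \<in> I))"

text \<open>A two-terminal network between \<open>a\<close> and \<open>b\<close> with effective conductance \<open>w\<close>.
  Every edge meets an internal vertex, so gadgets sharing terminals never produce a double edge.\<close>

definition gadget :: "nat \<Rightarrow> int \<Rightarrow> nat \<Rightarrow> nat \<Rightarrow> nat set \<Rightarrow> (nat \<times> nat) list \<Rightarrow> bool" where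
  "gadget p w a b I H \<longleftrightarrow> gadget_graph a b I H \<and>
     (\<forall>x. \<exists>x'. (\<forall>v. v \<notin> I \<longrightarrow> x' v = x v) \<and> (\<forall>v\<in>I. [cur H x' v = 0] (mod int p))) \<and>
     (\<forall>x. (\<forall>v\<in>I. [cur H x v = 0] (mod int p)) \<longrightarrow>
        [cur H x a = w * (x a - x b)] (mod int p) \<and> [cur H x b = w * (x b - x a)] (mod int p))"

lemma gadget_graph_verts:
  assumes "gadget_graph a b I H" "(x, y) \<in> set H"
  shows "(y, x) \<in> set H" "x \<noteq> y" "x \<in> I \<union> {a, b}" "y \<in> I \<union> {a, b}" "x \<in> I \<or> y \<in> I"
  using assms by (fastforce simp: gadget_graph_def)+

lemma gadget_graph_cur_eq_0:
  assumes "gadget_graph a b I H" "v \<notin> I" "v \<noteq> a" "v \<noteq> b"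
  shows "cur H x v = 0"
  by (rule cur_eq_0) (use assms in \<open>fastforce simp: gadget_graph_def\<close>)

lemma gadget_graph_cur_cong:
  assumes "gadget_graph a b I H" "\<And>v. v \<in> I \<union> {a, b} \<Longrightarrow> x v = y v"
  shows "cur H x v = cur H y v"
  using gadget_graph_verts(3,4)[OF assms(1)] assms(2) by (intro cur_cong) blast

lemma gadget_imp_graph: "gadget p w a b I H \<Longrightarrow> gadget_graph a b I H"
  by (simp add: gadget_def)

text \<open>This half of the definition carries a solution of the original system over to the new
  one; \<open>gadget_current\<close> serves the way back.\<close>

lemma gadget_extend:
  "gadget p w a b I H \<Longrightarrow>
    \<exists>x'. (\<forall>v. v \<notin> I \<longrightarrow> x' v = x v) \<and> (\<forall>v\<in>I. [cur H x' v = 0] (mod int p))"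
  by (simp add: gadget_def)

lemma gadget_current:
  assumes "gadget p w a b I H" "\<And>v. v \<in> I \<Longrightarrow> [cur H x v = 0] (mod int p)"
  shows "[cur H x a = w * (x a - x b)] (mod int p)" "[cur H x b = w * (x b - x a)] (mod int p)"
  using assms unfolding gadget_def by blast+

lemma gadget_cong:
  assumes "gadget p w a b I H" "[w = w'] (mod int p)"
  shows "gadget p w' a b I H"
proof -
  have "[c = w * d] (mod int p) \<longleftrightarrow> [c = w' * d] (mod int p)" for c d
    using cong_mult[OF assms(2) cong_refl[of d]] by (simp add: cong_def)
  then show ?thesis using assms(1) unfolding gadget_def by simp
qed

section \<open>Parallel and series composition over the prime field\<close>

text \<open>The interiors are disjoint and neither network carries current at interior vertices of
  the other, so the interior equations decouple and the terminal currents add up.\<close>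

lemma gadget_par:
  assumes g1: "gadget p w1 a b I1 H1" and g2: "gadget p w2 a b I2 H2" and disj: "I1 \<inter> I2 = {}"
  shows "gadget p (w1 + w2) a b (I1 \<union> I2) (H1 @ H2)"
proof -
  have gr: "gadget_graph a b I1 H1" "gadget_graph a b I2 H2" using g1 g2 by (simp_all add: gadget_imp_graph)
  have ab: "a \<notin> I1 \<union> I2" "b \<notin> I1 \<union> I2" "a \<noteq> b" using gr by (auto simp: gadget_graph_def)
  have z1: "cur H1 x v = 0" if "v \<in> I2" for x v
    using gadget_graph_cur_eq_0[OF gr(1)] that ab disj by blast
  have z2: "cur H2 x v = 0" if "v \<in> I1" for x v
    using gadget_graph_cur_eq_0[OF gr(2)] that ab disj by blast
  have "set H1 \<inter> set H2 = {}"
    using gadget_graph_verts(5)[OF gr(1)] gadget_graph_verts(3,4)[OF gr(2)] ab disj by fast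
  then have "gadget_graph a b (I1 \<union> I2) (H1 @ H2)"
    using gr unfolding gadget_graph_def by fastforce
  moreover have "\<exists>x'. (\<forall>v. v \<notin> I1 \<union> I2 \<longrightarrow> x' v = x v) \<and>
      (\<forall>v\<in>I1 \<union> I2. [cur (H1 @ H2) x' v = 0] (mod int p))" for x
  proof -
    obtain x1 where x1: "\<And>v. v \<notin> I1 \<Longrightarrow> x1 v = x v" "\<And>v. v \<in> I1 \<Longrightarrow> [cur H1 x1 v = 0] (mod int p)"
      using gadget_extend[OF g1, of x] by blast
    obtain x2 where x2: "\<And>v. v \<notin> I2 \<Longrightarrow> x2 v = x1 v" "\<And>v. v \<in> I2 \<Longrightarrow> [cur H2 x2 v = 0] (mod int p)"
      using gadget_extend[OF g2, of x1] by blast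
    have "cur H1 x2 v = cur H1 x1 v" for v
      by (rule gadget_graph_cur_cong[OF gr(1)]) (use x2 ab disj in blast)
    then show ?thesis
      by (intro exI[of _ x2]) (auto simp: x1 x2 z1 z2)
  qed
  moreover have "[cur (H1 @ H2) x a = (w1 + w2) * (x a - x b)] (mod int p) \<and>
      [cur (H1 @ H2) x b = (w1 + w2) * (x b - x a)] (mod int p)"
    if *: "\<forall>v\<in>I1 \<union> I2. [cur (H1 @ H2) x v = 0] (mod int p)" for x
  proof -
    have "[cur H1 x v = 0] (mod int p)" if "v \<in> I1" for v using *[rule_format, of v] z2[OF that, of x] that by simp
    note c1 = gadget_current[OF g1 this]
    have "[cur H2 x v = 0] (mod int p)" if "v \<in> I2" for v using *[rule_format, of v] z1[OF that, of x] that by simp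
    note c2 = gadget_current[OF g2 this]
    show ?thesis
      using cong_add[OF c1(1) c2(1)] cong_add[OF c1(2) c2(2)] by (simp add: distrib_right)
  qed
  ultimately show ?thesis unfolding gadget_def by blast
qed

text \<open>The congruence for r states r = w1 w2 / (w1 + w2) without division. Invertibility of w1
  + w2 enters twice: it gives a potential balancing the currents at m, and it allows cancellation
  when the terminal currents are computed.\<close>

lemma gadget_ser:
  assumes g1: "gadget p w1 a m I1 H1" and g2: "gadget p w2 m b I2 H2"
    and disj: "I1 \<inter> I2 = {}" "a \<notin> I2" "b \<notin> I1" "a \<noteq> b"
    and cop: "coprime (w1 + w2) (int p)" and r: "[r * (w1 + w2) = w1 * w2] (mod int p)"
  shows "gadget p r a b (I1 \<union> I2 \<union> {m}) (H1 @ H2)"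
proof -
  have gr: "gadget_graph a m I1 H1" "gadget_graph m b I2 H2" using g1 g2 by (simp_all add: gadget_imp_graph)
  have abm: "a \<notin> I1" "m \<notin> I1" "m \<notin> I2" "b \<notin> I2" "a \<noteq> m" "b \<noteq> m"
    using gr by (auto simp: gadget_graph_def)
  have z1: "cur H1 x v = 0" if "v \<in> I2 \<union> {b}" for x v
    using gadget_graph_cur_eq_0[OF gr(1)] that abm disj by blast
  have z2: "cur H2 x v = 0" if "v \<in> I1 \<union> {a}" for x v
    using gadget_graph_cur_eq_0[OF gr(2)] that abm disj by blast
  have "set H1 \<inter> set H2 = {}"
  proof -
    have False if "(x, y) \<in> set H1" "(x, y) \<in> set H2" for x y
      using gadget_graph_verts(5)[OF gr(1) that(1)] gadget_graph_verts(3,4)[OF gr(2) that(2)] abm disj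
      by blast
    then show ?thesis by auto
  qed
  moreover have "(y, x) \<in> set (H1 @ H2) \<and> x \<noteq> y \<and> x \<in> (I1 \<union> I2 \<union> {m}) \<union> {a, b} \<and>
      y \<in> (I1 \<union> I2 \<union> {m}) \<union> {a, b} \<and> (x \<in> I1 \<union> I2 \<union> {m} \<or> y \<in> I1 \<union> I2 \<union> {m})"
    if "(x, y) \<in> set (H1 @ H2)" for x y
    using that gadget_graph_verts[OF gr(1), of x y] gadget_graph_verts[OF gr(2), of x y] by auto
  ultimately have "gadget_graph a b (I1 \<union> I2 \<union> {m}) (H1 @ H2)"
    using gr disj abm unfolding gadget_graph_def by auto
  moreover have "\<exists>x'. (\<forall>v. v \<notin> I1 \<union> I2 \<union> {m} \<longrightarrow> x' v = x v) \<and>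
      (\<forall>v\<in>I1 \<union> I2 \<union> {m}. [cur (H1 @ H2) x' v = 0] (mod int p))" for x
  proof -
    \<comment> \<open>The potential of m must be the weighted mean (w1 x a + w2 x b) / (w1 + w2); i
      is the inverse of the denominator.\<close>
    obtain i where i: "[(w1 + w2) * i = 1] (mod int p)"
      using cop cong_solve_coprime_int by blast
    define s where "s = i * (w1 * x a + w2 * x b)"
    have s: "[w1 * (s - x a) + w2 * (s - x b) = 0] (mod int p)"
    proof -
      have "[(w1 + w2) * i * (w1 * x a + w2 * x b) = 1 * (w1 * x a + w2 * x b)] (mod int p)"
        by (intro cong_mult i) auto
      then show ?thesis by (simp add: s_def cong_iff_dvd_diff algebra_simps)
    qed
    obtain x1 where x1: "\<And>v. v \<notin> I1 \<Longrightarrow> x1 v = (x(m := s)) v"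
      "\<And>v. v \<in> I1 \<Longrightarrow> [cur H1 x1 v = 0] (mod int p)"
      using gadget_extend[OF g1, of "x(m := s)"] by blast
    obtain x2 where x2: "\<And>v. v \<notin> I2 \<Longrightarrow> x2 v = x1 v" "\<And>v. v \<in> I2 \<Longrightarrow> [cur H2 x2 v = 0] (mod int p)"
      using gadget_extend[OF g2, of x1] by blast
    have c: "cur H1 x2 v = cur H1 x1 v" for v
      by (rule gadget_graph_cur_cong[OF gr(1)]) (use x2 abm disj in blast)
    then have x3: "[cur H1 x2 v = 0] (mod int p)" if "v \<in> I1" for v using x1 that by simp
    have vals: "x2 a = x a" "x2 b = x b" "x2 m = s" using x1 x2 abm disj by auto
    have "[cur H1 x2 m + cur H2 x2 m = w1 * (s - x a) + w2 * (s - x b)] (mod int p)"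
      using gadget_current(2)[OF g1 x3] gadget_current(1)[OF g2 x2(2)] vals by (auto intro: cong_add)
    then have m: "[cur H1 x2 m + cur H2 x2 m = 0] (mod int p)" using s cong_trans by blast
    have out: "x2 v = x v" if "v \<notin> I1 \<union> I2 \<union> {m}" for v using that x1 x2 by simp
    have "[cur (H1 @ H2) x2 v = 0] (mod int p)" if "v \<in> I1 \<union> I2 \<union> {m}" for v
      using that x2(2)[of v] x3[of v] m z1[of v] z2[of v] by auto
    with out show ?thesis by blast
  qed
  moreover have "[cur (H1 @ H2) x a = r * (x a - x b)] (mod int p) \<and>
      [cur (H1 @ H2) x b = r * (x b - x a)] (mod int p)"
    if *: "\<forall>v\<in>I1 \<union> I2 \<union> {m}. [cur (H1 @ H2) x v = 0] (mod int p)" for x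
  proof -
    have "[cur H1 x v = 0] (mod int p)" if "v \<in> I1" for v
      using *[rule_format, of v] z2[of v] that by simp
    note c1 = gadget_current[OF g1 this]
    have "[cur H2 x v = 0] (mod int p)" if "v \<in> I2" for v
      using *[rule_format, of v] z1[of v] that by simp
    note c2 = gadget_current[OF g2 this]
    have "[cur H1 x m + cur H2 x m = w1 * (x m - x a) + w2 * (x m - x b)] (mod int p)"
      by (rule cong_add[OF c1(2) c2(1)])
    moreover have "[cur H1 x m + cur H2 x m = 0] (mod int p)" using * by simp
    ultimately have m: "[w1 * (x m - x a) + w2 * (x m - x b) = 0] (mod int p)"
      using cong_sym cong_trans by blast
    have rr: "int p dvd r * (w1 + w2) - w1 * w2" using r by (simp add: cong_iff_dvd_diff)
    have mm: "int p dvd w1 * (x m - x a) + w2 * (x m - x b)" using m by (simp add: cong_0_iff)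
    \<comment> \<open>Multiplied by w1 + w2, the desired difference is a combination of the current
      balance at m and the congruence defining r.\<close>
    have "int p dvd (w1 + w2) * (w1 * (x a - x m) - r * (x a - x b))"
    proof -
      have "(w1 + w2) * (w1 * (x a - x m) - r * (x a - x b))
        = (w1 * (x m - x a) + w2 * (x m - x b)) * (- w1) - (r * (w1 + w2) - w1 * w2) * (x a - x b)"
        by (simp add: algebra_simps)
      then show ?thesis using rr mm by (metis dvd_diff dvd_mult2)
    qed
    then have A: "[w1 * (x a - x m) = r * (x a - x b)] (mod int p)"
      using cop by (simp add: cong_iff_dvd_diff coprime_commute coprime_dvd_mult_right_iff)
    have "int p dvd (w1 + w2) * (w2 * (x b - x m) - r * (x b - x a))"
    proof -
      have "(w1 + w2) * (w2 * (x b - x m) - r * (x b - x a))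
        = (w1 * (x m - x a) + w2 * (x m - x b)) * (- w2) - (r * (w1 + w2) - w1 * w2) * (x b - x a)"
        by (simp add: algebra_simps)
      then show ?thesis using rr mm by (metis dvd_diff dvd_mult2)
    qed
    then have B: "[w2 * (x b - x m) = r * (x b - x a)] (mod int p)"
      using cop by (simp add: cong_iff_dvd_diff coprime_commute coprime_dvd_mult_right_iff)
    show ?thesis
      using cong_trans[OF c1(1) A] cong_trans[OF c2(2) B] z1[of b] z2[of a] by simp
  qed
  ultimately show ?thesis unfolding gadget_def by blast
qed

text \<open>Two unit edges in series. This is proved directly rather than by
  \<open>gadget_ser\<close>, because a single edge has no interior vertex and so is not a
  gadget.\<close>

lemma gadget_path2:
  assumes "[2 * h = 1] (mod int p)" "a \<noteq> b" "a \<noteq> m" "b \<noteq> m"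
  shows "gadget p h a b {m} [(a, m), (m, a), (m, b), (b, m)]"
proof -
  have h: "[h * (2 * y) = y] (mod int p)" for y
    using cong_mult[OF assms(1) cong_refl[of y]] by (simp add: ac_simps)
  have "\<exists>s. [2 * s = y] (mod int p)" for y
    using h[of y] by (intro exI[of _ "h * y"]) (simp add: ac_simps)
  then obtain s where s: "[2 * s y = y] (mod int p)" for y by metis
  have "\<exists>x'. (\<forall>v. v \<noteq> m \<longrightarrow> x' v = x v) \<and> [(x' m - x' a) + (x' m - x' b) = 0] (mod int p)" for x
    using s[of "x a + x b"] assms
    by (intro exI[of _ "x(m := s (x a + x b))"]) (auto simp: cong_iff_dvd_diff algebra_simps)
  moreover have "[x a - x m = h * (x a - x b)] (mod int p)"
    if "[(x m - x a) + (x m - x b) = 0] (mod int p)" for x a b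
  proof -
    have "[x a - x m = h * (2 * (x a - x m))] (mod int p)" using h cong_sym by blast
    also have "[h * (2 * (x a - x m)) = h * (x a - x b)] (mod int p)"
      by (intro cong_mult cong_refl)
         (use that in \<open>simp add: cong_iff_dvd_diff dvd_diff_commute algebra_simps\<close>)
    finally show ?thesis .
  qed
  note this[of _ a b] this[of _ b a]
  ultimately show ?thesis
    using assms by (simp add: gadget_def gadget_graph_def add_ac)
qed

lemma gadget_path3:
  assumes "distinct [a, b, m, k]"
  shows "gadget 2 1 a b {m, k} [(a, m), (m, a), (m, k), (k, m), (k, b), (b, k)]"
proof -
  have "\<exists>x'. (\<forall>v. v \<noteq> m \<and> v \<noteq> k \<longrightarrow> x' v = x v) \<and> [(x' m - x' a) + (x' m - x' k) = 0] (mod 2) \<and>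
      [(x' k - x' m) + (x' k - x' b) = 0] (mod 2)" for x :: "nat \<Rightarrow> int"
    using assms
    \<comment> \<open>Modulo 2 an interior vertex of degree 2 forces its neighbours to have equal
      potentials, so the potentials alternate along the path.\<close>
    by (intro exI[of _ "x(m := x b, k := x a)"]) (auto simp: cong_iff_dvd_diff algebra_simps)
  then show ?thesis
    using assms by (auto simp: gadget_def gadget_graph_def cong_iff_dvd_diff)
qed

text \<open>The lower bound on the number of arcs is kept by series composition, which creates a new
  vertex without new edges.\<close>

definition gadget_size :: "nat \<Rightarrow> int \<Rightarrow> nat \<Rightarrow> nat \<Rightarrow> bool" where
  "gadget_size p w q e \<longleftrightarrow> (\<forall>a b n. a \<noteq> b \<and> a < n \<and> b < n \<longrightarrow>
     (\<exists>H. gadget p w a b {n..<n + q} H \<and> 2 * q + 2 \<le> length H \<and> length H \<le> e))"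

lemma gadget_size_par:
  assumes "gadget_size p w1 q1 e1" "gadget_size p w2 q2 e2"
  shows "gadget_size p (w1 + w2) (q1 + q2) (e1 + e2)"
  unfolding gadget_size_def
proof (intro allI impI, elim conjE)
  fix a b n :: nat assume ab: "a \<noteq> b" "a < n" "b < n"
  obtain H1 where H1: "gadget p w1 a b {n..<n + q1} H1" "2 * q1 + 2 \<le> length H1" "length H1 \<le> e1"
    using assms(1) ab unfolding gadget_size_def by blast
  obtain H2 where H2: "gadget p w2 a b {n + q1..<n + q1 + q2} H2" "2 * q2 + 2 \<le> length H2" "length H2 \<le> e2"
    using assms(2) ab unfolding gadget_size_def by (metis trans_less_add1)
  have "{n..<n + q1} \<union> {n + q1..<n + q1 + q2} = {n..<n + (q1 + q2)}" by auto
  then show "\<exists>H. gadget p (w1 + w2) a b {n..<n + (q1 + q2)} H \<and>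
      2 * (q1 + q2) + 2 \<le> length H \<and> length H \<le> e1 + e2"
    using gadget_par[OF H1(1) H2(1)] H1(2,3) H2(2,3) by (intro exI[of _ "H1 @ H2"]) auto
qed

text \<open>The vertex n becomes the middle vertex and both interiors are laid out after it. The
  count of arcs is exact: (2 q1 + 2) + (2 q2 + 2) = 2 (q1 + q2 + 1) + 2.\<close>

lemma gadget_size_ser:
  assumes "gadget_size p w1 q1 e1" "gadget_size p w2 q2 e2"
    "coprime (w1 + w2) (int p)" "[r * (w1 + w2) = w1 * w2] (mod int p)"
  shows "gadget_size p r (Suc (q1 + q2)) (e1 + e2)"
  unfolding gadget_size_def
proof (intro allI impI, elim conjE)
  fix a b n :: nat assume ab: "a \<noteq> b" "a < n" "b < n"
  obtain H1 where H1: "gadget p w1 a n {Suc n..<Suc n + q1} H1" "2 * q1 + 2 \<le> length H1" "length H1 \<le> e1"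
    using assms(1) ab unfolding gadget_size_def by (metis less_SucI lessI nat_neq_iff)
  have "n \<noteq> b" "n < Suc n + q1" "b < Suc n + q1" using ab by auto
  then obtain H2 where H2: "gadget p w2 n b {Suc n + q1..<Suc n + q1 + q2} H2" "2 * q2 + 2 \<le> length H2" "length H2 \<le> e2"
    using assms(2) unfolding gadget_size_def by blast
  have "{Suc n..<Suc n + q1} \<union> {Suc n + q1..<Suc n + q1 + q2} \<union> {n} = {n..<n + Suc (q1 + q2)}" by auto
  moreover have "gadget p r a b ({Suc n..<Suc n + q1} \<union> {Suc n + q1..<Suc n + q1 + q2} \<union> {n}) (H1 @ H2)"
    by (rule gadget_ser[OF H1(1) H2(1)]) (use ab assms in auto)
  ultimately show "\<exists>H. gadget p r a b {n..<n + Suc (q1 + q2)} H \<and>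
      2 * Suc (q1 + q2) + 2 \<le> length H \<and> length H \<le> e1 + e2"
    using H1(2,3) H2(2,3) by (intro exI[of _ "H1 @ H2"]) auto
qed

lemma gadget_size_path2: "[2 * h = 1] (mod int p) \<Longrightarrow> gadget_size p h 1 4"
  unfolding gadget_size_def
  by (intro allI impI exI[of _ "[(a, n), (n, a), (n, b), (b, n)]" for a b n])
     (auto intro!: gadget_path2)

lemma gadget_size_path3: "gadget_size 2 1 2 6"
  unfolding gadget_size_def
proof (intro allI impI, elim conjE)
  fix a b n :: nat assume ab: "a \<noteq> b" "a < n" "b < n"
  have "{n..<n + 2} = {n, Suc n}" by auto
  then show "\<exists>H. gadget 2 1 a b {n..<n + 2} H \<and> 2 * 2 + 2 \<le> length H \<and> length H \<le> 6"
    using gadget_path3[of a b n "Suc n"] ab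
    by (intro exI[of _ "[(a, n), (n, a), (n, Suc n), (Suc n, n), (Suc n, b), (b, Suc n)]"]) simp
qed

lemma gadget_size_cong:
  assumes "gadget_size p w q e" "[w = w'] (mod int p)"
  shows "gadget_size p w' q e"
  unfolding gadget_size_def
proof (intro allI impI)
  fix a b n :: nat assume "a \<noteq> b \<and> a < n \<and> b < n"
  then obtain H where "gadget p w a b {n..<n + q} H" "2 * q + 2 \<le> length H" "length H \<le> e"
    using assms(1) unfolding gadget_size_def by blast
  then show "\<exists>H. gadget p w' a b {n..<n + q} H \<and> 2 * q + 2 \<le> length H \<and> length H \<le> e"
    using gadget_cong[OF _ assms(2)] by (intro exI[of _ H]) simp
qed

lemma gadget_size_mono:
  assumes "gadget_size p w q e" "e \<le> e'"
  shows "gadget_size p w q e'"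
  unfolding gadget_size_def
proof (intro allI impI)
  fix a b n :: nat assume "a \<noteq> b \<and> a < n \<and> b < n"
  then obtain H where "gadget p w a b {n..<n + q} H" "2 * q + 2 \<le> length H" "length H \<le> e"
    using assms(1) unfolding gadget_size_def by blast
  then show "\<exists>H. gadget p w a b {n..<n + q} H \<and> 2 * q + 2 \<le> length H \<and> length H \<le> e'"
    using assms(2) by (intro exI[of _ H]) simp
qed

text \<open>Allows a gadget to be constructed once per weight as a template and then relabelled for
  each edge. Potentials on the copy are transported along \<phi> and its inverse on the vertices of
  the template.\<close>

lemma gadget_map:
  assumes g: "gadget p w a b I H" and inj: "inj_on \<phi> (I \<union> {a, b})"
  shows "gadget p w (\<phi> a) (\<phi> b) (\<phi> ` I) (map (map_prod \<phi> \<phi>) H)"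
proof -
  let ?V = "I \<union> {a, b}"
  let ?K = "map (map_prod \<phi> \<phi>) H"
  have gr: "gadget_graph a b I H" using g by (rule gadget_imp_graph)
  have ab: "a \<noteq> b" "a \<notin> I" "b \<notin> I" "distinct H" using gr by (auto simp: gadget_graph_def)
  have HV: "set H \<subseteq> ?V \<times> ?V" using gadget_graph_verts(3,4)[OF gr] by auto
  have cur: "cur ?K x (\<phi> v) = cur H (x \<circ> \<phi>) v" if v: "v \<in> ?V" for x v
    using HV
  proof (induction H)
    case (Cons e H)
    obtain c d where e: "e = (c, d)" by fastforce
    then have "c \<in> ?V" using Cons.prems by auto
    then have "\<phi> c = \<phi> v \<longleftrightarrow> c = v" using inj v by (simp only: inj_on_eq_iff)
    then show ?case using Cons e by simp
  qed simp
  have inj2: "inj_on (map_prod \<phi> \<phi>) (set H)"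
    using map_prod_inj_on[OF inj inj] HV by (rule inj_on_subset)
  have mem: "\<phi> x \<in> \<phi> ` I \<longleftrightarrow> x \<in> I" if "x \<in> ?V" for x
    using inj that by (auto simp: inj_on_eq_iff)
  have "gadget_graph (\<phi> a) (\<phi> b) (\<phi> ` I) ?K"
    unfolding gadget_graph_def
  proof (intro conjI)
    show "\<phi> a \<noteq> \<phi> b" using inj ab by (simp add: inj_on_eq_iff)
    show "\<phi> a \<notin> \<phi> ` I" "\<phi> b \<notin> \<phi> ` I" using mem ab by auto
    show "distinct ?K" using ab inj2 by (simp add: distinct_map)
    have "(\<phi> y, \<phi> x) \<in> set ?K \<and> \<phi> x \<noteq> \<phi> y \<and> \<phi> x \<in> \<phi> ` I \<union> {\<phi> a, \<phi> b} \<and>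
      \<phi> y \<in> \<phi> ` I \<union> {\<phi> a, \<phi> b} \<and> (\<phi> x \<in> \<phi> ` I \<or> \<phi> y \<in> \<phi> ` I)"
      if xy: "(x, y) \<in> set H" for x y
    proof -
      note v = gadget_graph_verts[OF gr xy]
      have "\<phi> x \<noteq> \<phi> y" using v(2-4) inj_onD[OF inj, of x y] by blast
      moreover have "(\<phi> y, \<phi> x) \<in> set ?K" using v(1) by force
      ultimately show ?thesis using v by auto
    qed
    note K = this
    show "\<forall>(x, y)\<in>set ?K. (y, x) \<in> set ?K \<and> x \<noteq> y \<and> x \<in> \<phi> ` I \<union> {\<phi> a, \<phi> b} \<and>
      y \<in> \<phi> ` I \<union> {\<phi> a, \<phi> b} \<and> (x \<in> \<phi> ` I \<or> y \<in> \<phi> ` I)"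
    proof
      fix e assume "e \<in> set ?K"
      then obtain x y where e: "e = (\<phi> x, \<phi> y)" "(x, y) \<in> set H" by auto
      show "case e of (x, y) \<Rightarrow> (y, x) \<in> set ?K \<and> x \<noteq> y \<and> x \<in> \<phi> ` I \<union> {\<phi> a, \<phi> b} \<and>
        y \<in> \<phi> ` I \<union> {\<phi> a, \<phi> b} \<and> (x \<in> \<phi> ` I \<or> y \<in> \<phi> ` I)"
        unfolding e(1) prod.case by (rule K[OF e(2)])
    qed
  qed
  moreover have "\<exists>x'. (\<forall>v. v \<notin> \<phi> ` I \<longrightarrow> x' v = x v) \<and> (\<forall>v\<in>\<phi> ` I. [cur ?K x' v = 0] (mod int p))" for x
  proof -
    obtain y where y: "\<And>v. v \<notin> I \<Longrightarrow> y v = (x \<circ> \<phi>) v" "\<And>v. v \<in> I \<Longrightarrow> [cur H y v = 0] (mod int p)"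
      using gadget_extend[OF g, of "x \<circ> \<phi>"] by blast
    define x' where "x' v = (if v \<in> \<phi> ` I then y (inv_into ?V \<phi> v) else x v)" for v
    have "(x' \<circ> \<phi>) v = y v" if "v \<in> ?V" for v
      using that inj mem[OF that] y(1)[of v] by (auto simp: x'_def)
    then have "cur H (x' \<circ> \<phi>) v = cur H y v" for v
      by (rule gadget_graph_cur_cong[OF gr])
    then show ?thesis using y(2) by (intro exI[of _ x']) (auto simp: cur x'_def)
  qed
  moreover have "[cur ?K x (\<phi> a) = w * (x (\<phi> a) - x (\<phi> b))] (mod int p) \<and>
      [cur ?K x (\<phi> b) = w * (x (\<phi> b) - x (\<phi> a))] (mod int p)"
    if "\<forall>v\<in>\<phi> ` I. [cur ?K x v = 0] (mod int p)" for x
    using gadget_current[OF g, of "x \<circ> \<phi>"] that by (auto simp: cur)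
  ultimately show ?thesis unfolding gadget_def by blast
qed

section \<open>Ladders of prescribed conductance\<close>

lemma coprime_int_below_prime:
  assumes "prime p" "k \<in> {1..<p}"
  shows "coprime (int k) (int p)"
proof -
  have "\<not> p dvd k" using assms(2) by (auto dest: dvd_imp_le)
  then have "coprime p k" by (rule prime_imp_coprime[OF assms(1)])
  then show ?thesis by (simp add: coprime_commute)
qed

text \<open>The conductance is half of u / v because the building block is a two-edge path of
  conductance 1 / 2. In units of that block, u / v = (u - v) / v + 1 is a parallel connection, and u
  / v is the series connection of u / (v - u) with 1. Each step of the algorithm costs one block,
  that is 4 arcs.\<close>

lemma ladder_gadget:
  assumes "prime p" "2 < p" "u \<in> {1..<p}" "v \<in> {1..<p}"
  shows "\<exists>w q. [2 * w * int v = int u] (mod int p) \<and>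
    gadget_size p w q (4 * sub_cost u v)"
  using assms(3,4)
proof (induction u v rule: sub_cost.induct)
  case (1 u v)
  have cop: "coprime (int k) (int p)" if "k \<in> {1..<p}" for k
    by (rule coprime_int_below_prime[OF assms(1) that])
  have "coprime 2 (int p)" using cop[of 2] assms(2) by simp
  then obtain h where h: "[2 * h = 1] (mod int p)" using cong_solve_coprime_int by blast
  note base = gadget_size_path2[OF h]
  have h2: "[2 * h * y = y] (mod int p)" for y
    using cong_mult[OF h cong_refl[of y]] by simp
  consider "u = v" | "v < u" | "u < v" by linarith
  then show ?case
  proof cases
    case 1
    then show ?thesis
      using h2 base by (intro exI[of _ h] exI[of _ 1]) (simp add: sub_cost.simps)
  next
    case 2
    have c: "sub_cost u v = Suc (sub_cost (u - v) v)" using 2 "1.prems" by (subst sub_cost.simps) auto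
    obtain w q where w: "[2 * w * int v = int (u - v)] (mod int p)" "gadget_size p w q (4 * sub_cost (u - v) v)"
    proof -
      have "u - v \<in> {1..<p}" using 2 "1.prems" by auto
      then show thesis using "1.IH"(1)[OF _ _ _ "1.prems"(2)] 2 "1.prems" that by auto
    qed
    have "[2 * w * int v + 2 * h * int v = int (u - v) + int v] (mod int p)"
      by (intro cong_add w(1) h2)
    then have "[2 * (w + h) * int v = int u] (mod int p)" using 2 by (simp add: algebra_simps)
    then show ?thesis
      using gadget_size_par[OF w(2) base] c
      by (intro exI[of _ "w + h"] exI[of _ "q + 1"]) (simp add: add.commute)
  next
    case 3
    have c: "sub_cost u v = Suc (sub_cost u (v - u))" using 3 "1.prems" by (subst sub_cost.simps) auto
    obtain w q where w: "[2 * w * int (v - u) = int u] (mod int p)" "gadget_size p w q (4 * sub_cost u (v - u))"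
    proof -
      have "v - u \<in> {1..<p}" using 3 "1.prems" by auto
      then show thesis using "1.IH"(2)[OF _ _ "1.prems"(1)] 3 "1.prems" that by auto
    qed
    have "[2 * w * int (v - u) + 2 * h * int (v - u) = int u + int (v - u)] (mod int p)"
      by (intro cong_add w(1) h2)
    \<comment> \<open>Here w + h is v / (2 (v - u)); it is invertible because 0 < v < p. This is
      where the bound on v keeps the series connection from degenerating.\<close>
    then have s: "[(2 * int (v - u)) * (w + h) = int v] (mod int p)" using 3 by (simp add: algebra_simps)
    have "coprime (2 * int (v - u) * (w + h)) (int p)"
      using cop[OF "1.prems"(2)] s cong_imp_coprime cong_sym by blast
    then have cwh: "coprime (w + h) (int p)" by simp
    then obtain i where i: "[(w + h) * i = 1] (mod int p)" using cong_solve_coprime_int by blast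
    define r where "r = w * h * i"
    have r: "[r * (w + h) = w * h] (mod int p)"
      using cong_mult[OF cong_refl[of "w * h"] i] by (simp add: r_def ac_simps)
    have "[2 * r * int v = 2 * r * ((2 * int (v - u)) * (w + h))] (mod int p)"
      by (intro cong_mult cong_refl cong_sym[OF s])
    also have "2 * r * ((2 * int (v - u)) * (w + h)) = 4 * int (v - u) * (r * (w + h))"
      by simp
    also have "[4 * int (v - u) * (r * (w + h)) = 4 * int (v - u) * (w * h)] (mod int p)"
      by (intro cong_mult cong_refl r)
    also have "4 * int (v - u) * (w * h) = 2 * h * (2 * w * int (v - u))" by simp
    also have "[2 * h * (2 * w * int (v - u)) = 1 * int u] (mod int p)"
      by (intro cong_mult h w(1))
    finally have "[2 * r * int v = int u] (mod int p)" by simp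
    then show ?thesis
      using gadget_size_ser[OF w(2) base cwh r] c
      by (intro exI[of _ r] exI[of _ "Suc (q + 1)"]) (simp add: add.commute)
  qed
qed

lemma gadget_exists:
  assumes "prime p" "2 < p" "1 \<le> S"
    "5 * card {(a, b)\<in>{1..p - 1} \<times> {1..p - 1}. S < sub_cost a b} \<le> (p - 1)\<^sup>2"
  shows "\<exists>q. gadget_size p w q (8 * S)"
proof -
  \<comment> \<open>Ladders realise halves of fractions, so the two fractions have to add up to 2
    w.\<close>
  define t where "t = nat ((2 * w) mod int p)"
  have p0: "0 < int p" using assms by simp
  have t: "[int t = 2 * w] (mod int p)" using p0 by (simp add: t_def cong_def)
  obtain a b c d where abcd: "a \<in> {1..<p}" "b \<in> {1..<p}" "c \<in> {1..<p}" "d \<in> {1..<p}"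
    "sub_cost a b \<le> S" "sub_cost c d \<le> S" "[a * d + c * b = t * (b * d)] (mod p)"
    using two_cheap_fractions[OF assms] by blast
  obtain w1 q1 where w1: "[2 * w1 * int b = int a] (mod int p)" "gadget_size p w1 q1 (4 * sub_cost a b)"
    using ladder_gadget[OF assms(1,2) abcd(1,2)] by blast
  obtain w2 q2 where w2: "[2 * w2 * int d = int c] (mod int p)" "gadget_size p w2 q2 (4 * sub_cost c d)"
    using ladder_gadget[OF assms(1,2) abcd(3,4)] by blast
  have cop: "coprime (int k) (int p)" if "k \<in> {1..<p}" for k
    by (rule coprime_int_below_prime[OF assms(1) that])
  have "[2 * w1 * int b * int d + 2 * w2 * int d * int b = int a * int d + int c * int b] (mod int p)"
    by (intro cong_add cong_mult cong_refl w1(1) w2(1))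
  also have "[int a * int d + int c * int b = int t * (int b * int d)] (mod int p)"
    using abcd(7) by (metis cong_int_iff of_nat_add of_nat_mult)
  also have "[int t * (int b * int d) = 2 * w * (int b * int d)] (mod int p)"
    by (intro cong_mult cong_refl t)
  finally have "[(w1 + w2) * (2 * int b * int d) = w * (2 * int b * int d)] (mod int p)"
    by (simp add: algebra_simps)
  moreover have "coprime (2 * int b * int d) (int p)"
    using cop[of 2] cop[of b] cop[of d] abcd assms(2) by simp
  ultimately have "[w1 + w2 = w] (mod int p)" using cong_mult_rcancel by blast
  then have "gadget_size p w (q1 + q2) (4 * sub_cost a b + 4 * sub_cost c d)"
    using gadget_size_cong gadget_size_par[OF w1(2) w2(2)] by blast
  then have "gadget_size p w (q1 + q2) (8 * S)" by (rule gadget_size_mono) (use abcd in simp)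
  then show ?thesis ..
qed

section \<open>Replacing the edges of a Laplacian by networks\<close>

text \<open>Row v of the weighted Laplacian of L applied to x. Unlike for \<open>cur\<close>, every
  edge is listed once, so both of its ends contribute.\<close>

definition flow :: "(nat \<times> nat \<times> int) list \<Rightarrow> (nat \<Rightarrow> int) \<Rightarrow> nat \<Rightarrow> int" where
  "flow L x v = (\<Sum>(a, b, w)\<leftarrow>L. (if a = v then w * (x a - x b) else 0) +
     (if b = v then w * (x b - x a) else 0))"

lemma flow_Nil [simp]: "flow [] x v = 0"
  and flow_append [simp]: "flow (L @ K) x v = flow L x v + flow K x v"
  and flow_single [simp]: "flow [(a, b, w)] x v =
    (if a = v then w * (x a - x b) else 0) + (if b = v then w * (x b - x a) else 0)"
  by (simp_all add: flow_def)

text \<open>A gadget with n terminals instead of two, whose response is that of a weighted graph on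
  the terminals. It is the invariant under which the edges are replaced one after another.\<close>

definition network ::
  "nat \<Rightarrow> nat \<Rightarrow> nat \<Rightarrow> (nat \<times> nat \<times> int) list \<Rightarrow> (nat \<times> nat) list \<Rightarrow> bool" where
  "network p n m L H \<longleftrightarrow> n \<le> m \<and> distinct H \<and>
     (\<forall>(x, y)\<in>set H. (y, x) \<in> set H \<and> x \<noteq> y \<and> x < m \<and> y < m \<and> (n \<le> x \<or> n \<le> y)) \<and>
     (\<forall>x. \<exists>x'. (\<forall>v. v \<notin> {n..<m} \<longrightarrow> x' v = x v) \<and> (\<forall>v\<in>{n..<m}. [cur H x' v = 0] (mod int p))) \<and>
     (\<forall>x. (\<forall>v\<in>{n..<m}. [cur H x v = 0] (mod int p)) \<longrightarrow>
        (\<forall>v<n. [cur H x v = flow L x v] (mod int p)))"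

lemma network_verts:
  assumes "network p n m L H" "(x, y) \<in> set H"
  shows "(y, x) \<in> set H" "x \<noteq> y" "x < m" "y < m" "n \<le> x \<or> n \<le> y"
  using assms by (auto simp: network_def)

lemma network_extend:
  "network p n m L H \<Longrightarrow>
    \<exists>x'. (\<forall>v. v \<notin> {n..<m} \<longrightarrow> x' v = x v) \<and> (\<forall>v\<in>{n..<m}. [cur H x' v = 0] (mod int p))"
  by (simp add: network_def)

lemma network_current:
  assumes "network p n m L H" "\<forall>v\<in>{n..<m}. [cur H x v = 0] (mod int p)" "v < n"
  shows "[cur H x v = flow L x v] (mod int p)"
  using assms by (simp add: network_def)

lemma network_Nil: "network p n n [] []"
  by (auto simp: network_def)

text \<open>The new interior lies beyond all vertices of H. Potentials can therefore be extended
  into the old interior first and into the new one afterwards without disturbing the currents of H,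
  and only the currents at a and b gain a term.\<close>

lemma network_snoc:
  assumes N: "network p n m L H" and g: "gadget p w a b {m..<m + q} K" and ab: "a < n" "b < n"
  shows "network p n (m + q) (L @ [(a, b, w)]) (H @ K)"
proof -
  have gr: "gadget_graph a b {m..<m + q} K" using g by (rule gadget_imp_graph)
  have nm: "n \<le> m" "distinct H" using N by (auto simp: network_def)
  have K: "distinct K" "a \<noteq> b" using gr by (auto simp: gadget_graph_def)
  have zH: "cur H x v = 0" if "m \<le> v" for x v
    by (rule cur_eq_0) (use network_verts(3)[OF N] that in force)
  have zK: "cur K x v = 0" if "v < m" "v \<noteq> a" "v \<noteq> b" for x v
    using gadget_graph_cur_eq_0[OF gr] that by simp
  have "set H \<inter> set K = {}"
  proof -
    have False if "(x, y) \<in> set H" "(x, y) \<in> set K" for x y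
      using network_verts(3,4)[OF N that(1)] gadget_graph_verts(5)[OF gr that(2)] by auto
    then show ?thesis by auto
  qed
  then have "distinct (H @ K)" using nm K by simp
  moreover have "(y, x) \<in> set (H @ K) \<and> x \<noteq> y \<and> x < m + q \<and> y < m + q \<and> (n \<le> x \<or> n \<le> y)"
    if xy: "(x, y) \<in> set (H @ K)" for x y
  proof (cases "(x, y) \<in> set H")
    case True
    then show ?thesis using network_verts[OF N True] by auto
  next
    case False
    then have "(x, y) \<in> set K" using xy by simp
    from gadget_graph_verts[OF gr this] show ?thesis using ab nm by auto
  qed
  moreover have "\<exists>x'. (\<forall>v. v \<notin> {n..<m + q} \<longrightarrow> x' v = x v) \<and>
      (\<forall>v\<in>{n..<m + q}. [cur (H @ K) x' v = 0] (mod int p))" for x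
  proof -
    obtain x1 where x1: "\<forall>v. v \<notin> {n..<m} \<longrightarrow> x1 v = x v" "\<forall>v\<in>{n..<m}. [cur H x1 v = 0] (mod int p)"
      using network_extend[OF N, of x] by blast
    obtain x2 where x2: "\<forall>v. v \<notin> {m..<m + q} \<longrightarrow> x2 v = x1 v"
      "\<forall>v\<in>{m..<m + q}. [cur K x2 v = 0] (mod int p)"
      using gadget_extend[OF g, of x1] by blast
    have c: "cur H x2 v = cur H x1 v" for v
      by (rule cur_cong) (use network_verts(3,4)[OF N] x2(1) in \<open>simp add: not_le[symmetric]\<close>)
    have "[cur (H @ K) x2 v = 0] (mod int p)" if v: "v \<in> {n..<m + q}" for v
    proof (cases "v < m")
      case True
      then show ?thesis using v c x1(2) zK[of v] ab by simp
    next
      case False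
      then show ?thesis using v x2(2) zH[of v] by simp
    qed
    moreover have "x2 v = x v" if "v \<notin> {n..<m + q}" for v
      using that x1(1) x2(1) nm by (cases "v < n") auto
    ultimately show ?thesis by blast
  qed
  moreover have "[cur (H @ K) x v = flow (L @ [(a, b, w)]) x v] (mod int p)"
    if *: "\<forall>v\<in>{n..<m + q}. [cur (H @ K) x v = 0] (mod int p)" and v: "v < n" for x v
  proof -
    have "[cur H x v = 0] (mod int p)" if "v \<in> {n..<m}" for v
      using *[rule_format, of v] zK[of v] that ab by simp
    then have 1: "[cur H x v = flow L x v] (mod int p)" using network_current[OF N _ v] by blast
    have "[cur K x v = 0] (mod int p)" if "v \<in> {m..<m + q}" for v
      using *[rule_format, of v] zH[of v] that nm by simp
    note c = gadget_current[OF g this]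
    have "[cur K x v = flow [(a, b, w)] x v] (mod int p)"
      using c zK[of v x] v nm K(2) by (cases "v = a"; cases "v = b") auto
    then show ?thesis using cong_add[OF 1] by simp
  qed
  ultimately show ?thesis using nm unfolding network_def by auto
qed

text \<open>Templates have terminals 0 and 1 and interior vertices 2, 3, and so on; m is the first
  vertex not yet in use.\<close>

definition place :: "nat \<Rightarrow> nat \<Rightarrow> nat \<Rightarrow> nat \<Rightarrow> nat" where
  "place a b m i = (if i = 0 then a else if i = 1 then b else m + (i - 2))"

lemma gadget_place:
  assumes "gadget p w 0 1 {2..<2 + q} K" "a \<noteq> b" "a < m" "b < m"
  shows "gadget p w a b {m..<m + q} (map (map_prod (place a b m) (place a b m)) K)"
proof -
  have "inj_on (place a b m) ({2..<2 + q} \<union> {0, 1})"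
    using assms(2-4) by (auto simp: inj_on_def place_def)
  moreover have "place a b m ` {2..<2 + q} = {m..<m + q}"
  proof
    show "{m..<m + q} \<subseteq> place a b m ` {2..<2 + q}"
    proof
      fix v assume "v \<in> {m..<m + q}"
      then have "v = place a b m (v - m + 2)" "v - m + 2 \<in> {2..<2 + q}" by (auto simp: place_def)
      then show "v \<in> place a b m ` {2..<2 + q}" by blast
    qed
  qed (auto simp: place_def)
  ultimately show ?thesis
    using gadget_map[OF assms(1), of "place a b m"] by (simp add: place_def)
qed

section \<open>Laplacians as symmetric matrices with vanishing row sums\<close>

definition is_laplacian :: "nat \<Rightarrow> nat \<Rightarrow> int mat \<Rightarrow> bool" where
  "is_laplacian p n M \<longleftrightarrow> M \<in> carrier_mat n n \<and>
     (\<forall>i<n. \<forall>j<n. M $$ (i, j) = M $$ (j, i) \<and> 0 \<le> M $$ (i, j) \<and> M $$ (i, j) < int p) \<and>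
     (\<forall>i<n. [(\<Sum>j<n. M $$ (i, j)) = 0] (mod int p))"

lemma laplacian_of_is_laplacian:
  assumes "simple_edges n E" "0 < p"
  shows "is_laplacian p n (laplacian_of p n E w)"
proof -
  let ?M = "laplacian_of p n E w"
  have "[(\<Sum>j<n. ?M $$ (i, j)) = 0] (mod int p)" if i: "i < n" for i
  proof -
    let ?S = "{u. {i, u} \<in> E}"
    have S: "?S \<subseteq> {..<n} - {i}" using assms(1) by (fastforce simp: simple_edges_def)
    have "(\<Sum>j<n. ?M $$ (i, j)) = ?M $$ (i, i) + (\<Sum>j\<in>{..<n} - {i}. ?M $$ (i, j))"
      using i by (simp add: sum.remove)
    also have "(\<Sum>j\<in>{..<n} - {i}. ?M $$ (i, j))
        = (\<Sum>j\<in>{..<n} - {i}. if j \<in> ?S then (- w {i, j}) mod int p else 0)"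
      using i by (intro sum.cong) (auto simp: laplacian_of_def)
    also have "\<dots> = (\<Sum>j\<in>?S. (- w {i, j}) mod int p)"
      by (rule sum.mono_neutral_cong_right[OF _ S]) auto
    also have "?M $$ (i, i) = (\<Sum>j\<in>?S. w {i, j}) mod int p"
      using i by (simp add: laplacian_of_def)
    finally have "(\<Sum>j<n. ?M $$ (i, j))
      = (\<Sum>j\<in>?S. w {i, j}) mod int p + (\<Sum>j\<in>?S. (- w {i, j}) mod int p)" .
    moreover have "[(\<Sum>j\<in>?S. w {i, j}) mod int p + (\<Sum>j\<in>?S. (- w {i, j}) mod int p)
      = (\<Sum>j\<in>?S. w {i, j}) + (\<Sum>j\<in>?S. - w {i, j})] (mod int p)"
      by (intro cong_add cong_sum) (simp_all add: cong_def)
    ultimately show ?thesis by (simp add: sum_negf)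
  qed
  then show ?thesis
    using assms(2) by (auto simp: is_laplacian_def laplacian_of_def insert_commute)
qed

lemma LS_is_laplacian: "M \<in> LS p \<Longrightarrow> 0 < p \<Longrightarrow> is_laplacian p (dim_row M) M"
  unfolding LS_def using laplacian_of_is_laplacian by (force simp: laplacian_of_def)

text \<open>By the vanishing row sum the product depends on the off-diagonal entries alone, the
  diagonal one being multiplied by x i - x i. The program can therefore drop the diagonal of its
  input.\<close>

lemma laplacian_mult:
  assumes "is_laplacian p n M" "i < n" "dim_vec x = n"
  shows "[(M *\<^sub>v x) $ i = (\<Sum>j<n. - M $$ (i, j) * (x $ i - x $ j))] (mod int p)"
proof -
  have M: "M \<in> carrier_mat n n" "[(\<Sum>j<n. M $$ (i, j)) = 0] (mod int p)"
    using assms by (auto simp: is_laplacian_def)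
  have "(\<Sum>j<n. - M $$ (i, j) * (x $ i - x $ j))
      = (\<Sum>j<n. M $$ (i, j) * x $ j - M $$ (i, j) * x $ i)"
    by (intro sum.cong) (simp_all add: algebra_simps)
  then have "(\<Sum>j<n. - M $$ (i, j) * (x $ i - x $ j))
      = (\<Sum>j<n. M $$ (i, j) * x $ j) - (\<Sum>j<n. M $$ (i, j)) * x $ i"
    by (simp only: sum_distrib_right sum_subtractf)
  moreover have "(M *\<^sub>v x) $ i = (\<Sum>j<n. M $$ (i, j) * x $ j)"
    using M(1) assms by (simp add: scalar_prod_def lessThan_atLeast0)
  ultimately show ?thesis
    using M(2) by (simp add: cong_iff_dvd_diff)
qed

definition nonzero_entries :: "int mat \<Rightarrow> (nat \<times> nat \<times> int) set" where
  "nonzero_entries M = {(i, j, v). i < dim_row M \<and> j < dim_col M \<and> v = M $$ (i, j) \<and> v \<noteq> 0}"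

text \<open>By symmetry the entries above the diagonal list each edge exactly once; an entry is
  minus the weight of its edge.\<close>

definition branches :: "(nat \<times> nat \<times> int) list \<Rightarrow> (nat \<times> nat \<times> int) list" where
  "branches es = map (\<lambda>(a, b, v). (a, b, - v)) (filter (\<lambda>(a, b, v). a < b) es)"

lemma flow_branches:
  assumes "is_laplacian p n M" "i < n" "distinct es" "set es = nonzero_entries M"
  shows "flow (branches es) x i = (\<Sum>j<n. - M $$ (i, j) * (x i - x j))"
proof -
  have M: "dim_row M = n" "dim_col M = n" using assms(1) by (auto simp: is_laplacian_def)
  have sym: "M $$ (j, k) = M $$ (k, j)" if "j < n" "k < n" for j k
    using assms(1) that by (auto simp: is_laplacian_def)
  define g where "g = (\<lambda>(a, b, v). (if a = i then - v * (x a - x b) else 0) +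
     (if b = i then - v * (x b - x a) else 0))"
  let ?D = "{(a, b)\<in>{..<n} \<times> {..<n}. a < b}"
  have fin: "finite ?D" by (rule finite_subset[of _ "{..<n} \<times> {..<n}"]) auto
  have "flow (branches es) x i = (\<Sum>e\<leftarrow>filter (\<lambda>(a, b, v). a < b) es. g e)"
    unfolding flow_def branches_def g_def map_map
    by (intro arg_cong[of _ _ sum_list] map_cong) auto
  also have "\<dots> = (\<Sum>e\<in>{(a, b, v)\<in>nonzero_entries M. a < b}. g e)"
    using assms(3,4) by (subst sum_list_distinct_conv_sum_set) (auto intro!: sum.cong)
  also have "\<dots> = (\<Sum>(a, b)\<in>{(a, b)\<in>?D. M $$ (a, b) \<noteq> 0}. g (a, b, M $$ (a, b)))"
    by (rule sum.reindex_bij_witness[of _ "\<lambda>(a, b). (a, b, M $$ (a, b))" "\<lambda>(a, b, v). (a, b)"])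
       (auto simp: nonzero_entries_def M)
  also have "\<dots> = (\<Sum>(a, b)\<in>?D. g (a, b, M $$ (a, b)))"
    by (rule sum.mono_neutral_left[OF fin]) (auto simp: g_def split: if_splits)
  also have "\<dots> = (\<Sum>(a, b)\<in>{..<n} \<times> {..<n}. if a < b then g (a, b, M $$ (a, b)) else 0)"
    by (rule sum.mono_neutral_cong_left) (auto split: if_splits)
  also have "\<dots> = (\<Sum>a<n. \<Sum>b<n. if a < b then g (a, b, M $$ (a, b)) else 0)"
    by (simp add: sum.cartesian_product)
  also have "\<dots> = (\<Sum>a<n. \<Sum>b<n. (if a = i then if i < b then - M $$ (i, b) * (x i - x b) else 0 else 0))
      + (\<Sum>a<n. \<Sum>b<n. (if b = i then if a < i then - M $$ (a, i) * (x i - x a) else 0 else 0))"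
    unfolding sum.distrib[symmetric] by (intro sum.cong) (auto simp: g_def)
  also have "(\<Sum>a<n. \<Sum>b<n. (if a = i then if i < b then - M $$ (i, b) * (x i - x b) else 0 else 0))
      = (\<Sum>b<n. if i < b then - M $$ (i, b) * (x i - x b) else 0)"
    using assms(2) by (subst sum.swap) simp
  also have "(\<Sum>a<n. \<Sum>b<n. (if b = i then if a < i then - M $$ (a, i) * (x i - x a) else 0 else 0))
      = (\<Sum>a<n. if a < i then - M $$ (a, i) * (x i - x a) else 0)"
    using assms(2) by simp
  also have "(\<Sum>b<n. if i < b then - M $$ (i, b) * (x i - x b) else 0)
      + (\<Sum>a<n. if a < i then - M $$ (a, i) * (x i - x a) else 0)
      = (\<Sum>j<n. - M $$ (i, j) * (x i - x j))"
    unfolding sum.distrib[symmetric]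
    by (intro sum.cong) (use sym assms(2) in \<open>auto simp: not_less_iff_gr_or_eq\<close>)
  finally show ?thesis .
qed

definition unit_laplacian :: "nat \<Rightarrow> nat \<Rightarrow> (nat \<times> nat) list \<Rightarrow> int mat" where
  "unit_laplacian p m H = laplacian_of p m {{a, b} | a b. (a, b) \<in> set H} (\<lambda>_. 1)"

definition simple_arcs :: "nat \<Rightarrow> (nat \<times> nat) list \<Rightarrow> bool" where
  "simple_arcs m H \<longleftrightarrow> distinct H \<and>
     (\<forall>(a, b)\<in>set H. (b, a) \<in> set H \<and> a \<noteq> b \<and> a < m \<and> b < m)"

lemma simple_arcs_edges:
  assumes "simple_arcs m H"
  shows "simple_edges m {{a, b} | a b. (a, b) \<in> set H}"
    and "{i, j} \<in> {{a, b} | a b. (a, b) \<in> set H} \<longleftrightarrow> (i, j) \<in> set H"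
  using assms by (fastforce simp: simple_edges_def simple_arcs_def doubleton_eq_iff)+

lemma unit_laplacian_UWLS:
  assumes "simple_arcs m H" "2 \<le> p"
  shows "unit_laplacian p m H \<in> UWLS p"
proof -
  have "unit_laplacian p m H \<in> LS p"
    unfolding LS_def unit_laplacian_def
    by (intro CollectI exI conjI, rule simple_arcs_edges(1)[OF assms(1)])
       (use assms(2) in \<open>auto simp: zp_def\<close>)
  then show ?thesis
    by (auto simp: UWLS_def unit_laplacian_def laplacian_of_def split: if_splits)
qed

lemma dim_unit_laplacian [simp]: "dim_row (unit_laplacian p m H) = m" "dim_col (unit_laplacian p m H) = m"
  by (simp_all add: unit_laplacian_def laplacian_of_def)

text \<open>The diagonal entry is a degree modulo p and may vanish even though the vertex has edges,
  so the sparse storage must treat the diagonal separately.\<close>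

lemma unit_laplacian_entry:
  assumes "simple_arcs m H" "2 \<le> p" "i < m" "j < m"
  shows "unit_laplacian p m H $$ (i, j) =
    (if i = j then int (length (filter (\<lambda>e. fst e = i) H)) mod int p
     else if (i, j) \<in> set H then int p - 1 else 0)"
proof -
  have d: "distinct H" using assms(1) by (simp add: simple_arcs_def)
  have "{u. (i, u) \<in> set H} = snd ` set (filter (\<lambda>e. fst e = i) H)" by force
  moreover have "inj_on snd (set (filter (\<lambda>e. fst e = i) H))" by (auto simp: inj_on_def)
  ultimately have card: "card {u. (i, u) \<in> set H} = length (filter (\<lambda>e. fst e = i) H)"
    using d by (simp add: card_image distinct_card distinct_filter del: set_filter)
  have "(- 1) mod int p = int p - 1" using assms(2) by (simp add: zmod_minus1)
  then show ?thesis
    using assms(3,4) card unfolding unit_laplacian_def laplacian_of_def simple_arcs_edges(2)[OF assms(1)]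
    by (cases "i = j") simp_all
qed

lemma unit_laplacian_mult:
  assumes "simple_arcs m H" "2 \<le> p" "i < m" "dim_vec x = m"
  shows "[(unit_laplacian p m H *\<^sub>v x) $ i = cur H (\<lambda>j. x $ j) i] (mod int p)"
proof -
  let ?M = "unit_laplacian p m H"
  have "is_laplacian p m ?M"
    unfolding unit_laplacian_def
    by (rule laplacian_of_is_laplacian) (use simple_arcs_edges(1)[OF assms(1)] assms(2) in auto)
  then have "[(?M *\<^sub>v x) $ i = (\<Sum>j<m. - ?M $$ (i, j) * (x $ i - x $ j))] (mod int p)"
    by (rule laplacian_mult) (use assms in auto)
  also have "[(\<Sum>j<m. - ?M $$ (i, j) * (x $ i - x $ j))
      = (\<Sum>j<m. if (i, j) \<in> set H then x $ i - x $ j else 0)] (mod int p)"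
  proof (rule cong_sum)
    fix j assume "j \<in> {..<m}"
    then show "[- ?M $$ (i, j) * (x $ i - x $ j) = (if (i, j) \<in> set H then x $ i - x $ j else 0)] (mod int p)"
      using assms by (auto simp: unit_laplacian_entry cong_iff_dvd_diff algebra_simps)
  qed
  also have "(\<Sum>j<m. if (i, j) \<in> set H then x $ i - x $ j else 0) = cur H (\<lambda>j. x $ j) i"
  proof -
    have "cur H (\<lambda>j. x $ j) i = (\<Sum>e\<in>set H. if fst e = i then x $ i - x $ snd e else 0)"
      using assms(1) unfolding cur_def simple_arcs_def
      by (subst sum_list_distinct_conv_sum_set) (auto intro!: sum.cong)
    also have "\<dots> = (\<Sum>e\<in>{e \<in> set H. fst e = i}. x $ i - x $ snd e)"
      by (rule sum.inter_filter[symmetric]) simp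
    also have "\<dots> = (\<Sum>j\<in>{j\<in>{..<m}. (i, j) \<in> set H}. x $ i - x $ j)"
      by (rule sum.reindex_bij_witness[of _ "\<lambda>j. (i, j)" snd])
         (use assms(1) in \<open>auto simp: simple_arcs_def\<close>)
    also have "\<dots> = (\<Sum>j<m. if (i, j) \<in> set H then x $ i - x $ j else 0)"
      by (rule sum.inter_filter) simp
    finally show ?thesis ..
  qed
  finally show ?thesis .
qed

section \<open>Transfer of solutions; the k - m additional vertices are isolated\<close>

context
  fixes p n m k :: nat and M :: "int mat" and c :: "int vec" and es H
  assumes p: "2 \<le> p" and M: "M \<in> LS p" "zp_system p M c" and n: "n = dim_row M"
    and es: "distinct es" "set es = nonzero_entries M"
    and N: "network p n m (branches es) H" and k: "m \<le> k"
begin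

private lemma lap: "is_laplacian p n M"
  using LS_is_laplacian[OF M(1)] p n by simp

lemma network_simple_arcs: "simple_arcs k H"
  using N k by (force simp: network_def simple_arcs_def)

private lemma dims: "dim_col M = n" "n \<le> m" "dim_vec c = n"
  using lap N M(2) n by (auto simp: is_laplacian_def network_def zp_system_def)

private lemma beyond: "m \<le> v \<Longrightarrow> cur H x v = 0"
  by (rule cur_eq_0) (use network_verts(3)[OF N] in force)

private lemma flow_mult:
  assumes "i < n" "dim_vec x = n" "\<And>j. j < n \<Longrightarrow> y j = x $ j"
  shows "[flow (branches es) y i = (M *\<^sub>v x) $ i] (mod int p)"
proof -
  have "flow (branches es) y i = (\<Sum>j<n. - M $$ (i, j) * (x $ i - x $ j))"
    using flow_branches[OF lap assms(1) es] assms by simp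
  then show ?thesis using laplacian_mult[OF lap assms(1,2)] by (simp add: cong_sym)
qed

text \<open>Zero right-hand sides on the new vertices say that no current leaves the interiors, so
  the currents at the original vertices are those of the original weighted graph.\<close>

lemma network_solution_back:
  assumes "solves p (unit_laplacian p k H) (vec k (\<lambda>i. if i < n then c $ i else 0)) x"
  shows "solves p M c (vec n (\<lambda>i. x $ i))"
proof -
  let ?y = "\<lambda>i. x $ i"
  have x: "dim_vec x = k" "set\<^sub>v x \<subseteq> zp p" using assms by (auto simp: solves_def zp_vector_def)
  have cu: "[cur H ?y i = (if i < n then c $ i else 0)] (mod int p)" if "i < k" for i
    using assms that cong_trans[OF cong_sym[OF unit_laplacian_mult[OF network_simple_arcs p that x(1)]]]
    by (auto simp: solves_def)
  have "[(M *\<^sub>v vec n ?y) $ i = c $ i] (mod int p)" if i: "i < n" for i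
  proof -
    have "[cur H ?y i = flow (branches es) ?y i] (mod int p)"
    proof (rule network_current[OF N _ i], rule ballI)
      fix v assume "v \<in> {n..<m}"
      then show "[cur H ?y v = 0] (mod int p)" using cu[of v] k by simp
    qed
    moreover have "[flow (branches es) ?y i = (M *\<^sub>v vec n ?y) $ i] (mod int p)"
      by (rule flow_mult[OF i]) auto
    moreover have "[cur H ?y i = c $ i] (mod int p)" using cu[of i] i k dims by simp
    ultimately show ?thesis using cong_sym cong_trans by metis
  qed
  moreover have "set\<^sub>v (vec n ?y) \<subseteq> zp p"
    using x k dims by (auto simp: vec_set_def)
  ultimately show ?thesis
    using n dims by (simp add: solves_def zp_vector_def)
qed

lemma network_solution_forth:
  assumes "solves p M c x"
  shows "\<exists>y. solves p (unit_laplacian p k H) (vec k (\<lambda>i. if i < n then c $ i else 0)) y"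
proof -
  have x: "dim_vec x = n" using assms dims by (simp add: solves_def zp_vector_def)
  obtain x' where x': "\<forall>v. v \<notin> {n..<m} \<longrightarrow> x' v = x $ v" "\<forall>v\<in>{n..<m}. [cur H x' v = 0] (mod int p)"
    using network_extend[OF N, of "\<lambda>v. x $ v"] by blast
  \<comment> \<open>The potentials supplied by \<open>network_extend\<close> are arbitrary integers
    and have to be reduced to residues; \<open>y_cur\<close> checks that this preserves all
    currents.\<close>
  define y where "y = vec k (\<lambda>i. x' i mod int p)"
  have "[cur H (\<lambda>j. y $ j) i = cur H x' i] (mod int p)" for i
  proof -
    have "[cur H' (\<lambda>j. y $ j) i = cur H' x' i] (mod int p)" if "set H' \<subseteq> set H" for H'
      using that
    proof (induction H')
      case (Cons e H')
      obtain a b where e: "e = (a, b)" by fastforce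
      then have "a < k" "b < k" using Cons.prems network_verts(3,4)[OF N, of a b] k by auto
      then have "[(y $ a - y $ b) + cur H' (\<lambda>j. y $ j) i = (x' a - x' b) + cur H' x' i] (mod int p)"
        using Cons by (intro cong_add cong_diff) (auto simp: y_def cong_def)
      then show ?case using e Cons by auto
    qed simp
    then show ?thesis by simp
  qed
  note y_cur = this
  have fin: "[cur H x' i = (if i < n then c $ i else 0)] (mod int p)" for i
  proof (cases "i < n")
    case True
    have "[cur H x' i = flow (branches es) x' i] (mod int p)"
      by (rule network_current[OF N x'(2) True])
    moreover have "[flow (branches es) x' i = (M *\<^sub>v x) $ i] (mod int p)"
      by (rule flow_mult[OF True x]) (use x'(1) in auto)
    moreover have "[(M *\<^sub>v x) $ i = c $ i] (mod int p)" using assms True n by (simp add: solves_def)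
    ultimately show ?thesis using True cong_trans by (metis (full_types))
  next
    case False
    then show ?thesis using x'(2) beyond[of i x'] by (cases "i < m") auto
  qed
  have "[(unit_laplacian p k H *\<^sub>v y) $ i = (if i < n then c $ i else 0)] (mod int p)" if "i < k" for i
  proof -
    have "[(unit_laplacian p k H *\<^sub>v y) $ i = cur H (\<lambda>j. y $ j) i] (mod int p)"
      by (rule unit_laplacian_mult[OF network_simple_arcs p that]) (simp add: y_def)
    from cong_trans[OF cong_trans[OF this y_cur] fin] show ?thesis .
  qed
  moreover have "set\<^sub>v y \<subseteq> zp p" using p by (auto simp: y_def vec_set_def zp_def)
  ultimately have "solves p (unit_laplacian p k H) (vec k (\<lambda>i. if i < n then c $ i else 0)) y"
    by (simp add: solves_def zp_vector_def y_def)
  then show ?thesis ..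
qed

end

section \<open>Programs\<close>

definition runs :: "nat \<Rightarrow> com \<Rightarrow> (state \<Rightarrow> bool) \<Rightarrow> nat \<Rightarrow> (state \<Rightarrow> bool) \<Rightarrow> bool" where
  "runs p C P T Q \<longleftrightarrow> (\<forall>s. P s \<longrightarrow> (\<exists>t s'. exec p C s t s' \<and> t \<le> T \<and> Q s'))"

lemma runs_conseq:
  assumes "runs p C P T Q" "\<And>s. P' s \<Longrightarrow> P s" "T \<le> T'" "\<And>s. Q s \<Longrightarrow> Q' s"
  shows "runs p C P' T' Q'"
  using assms unfolding runs_def by (meson le_trans)

lemma runs_Skip: "(\<And>s. P s \<Longrightarrow> Q s) \<Longrightarrow> 1 \<le> T \<Longrightarrow> runs p Skip P T Q"
  unfolding runs_def using exec.Skip by blast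

lemma runs_Seq:
  assumes "runs p C P T1 R" "runs p D R T2 Q" "T1 + T2 \<le> T"
  shows "runs p (Seq C D) P T Q"
  unfolding runs_def
proof (intro allI impI)
  fix s assume "P s"
  then obtain t s' where 1: "exec p C s t s'" "t \<le> T1" "R s'" using assms(1) unfolding runs_def by blast
  then obtain t' s'' where 2: "exec p D s' t' s''" "t' \<le> T2" "Q s''"
    using assms(2) unfolding runs_def by blast
  then show "\<exists>t s'. exec p (Seq C D) s t s' \<and> t \<le> T \<and> Q s'"
    using exec.Seq[OF 1(1) 2(1)] 1(2) assms(3) by (intro exI[of _ "t + t'"] exI[of _ s'']) simp
qed

lemma runs_If:
  assumes "runs p C (\<lambda>s. P s \<and> eval_test p s b) T Q" "runs p D (\<lambda>s. P s \<and> \<not> eval_test p s b) T Q"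
    "cost_test b + T \<le> T'"
  shows "runs p (If b C D) P T' Q"
  unfolding runs_def
proof (intro allI impI)
  fix s assume P: "P s"
  show "\<exists>t s'. exec p (If b C D) s t s' \<and> t \<le> T' \<and> Q s'"
  proof (cases "eval_test p s b")
    case True
    then obtain t s' where 1: "exec p C s t s'" "t \<le> T" "Q s'"
      using P assms(1) unfolding runs_def by blast
    show ?thesis
      using exec.IfTrue[OF True 1(1)] 1 assms(3) by (intro exI[of _ "cost_test b + t"] exI[of _ s']) simp
  next
    case False
    then obtain t s' where 1: "exec p D s t s'" "t \<le> T" "Q s'"
      using P assms(2) unfolding runs_def by blast
    show ?thesis
      using exec.IfFalse[OF False 1(1)] 1 assms(3) by (intro exI[of _ "cost_test b + t"] exI[of _ s']) simp
  qed
qed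

abbreviation cell :: "string \<Rightarrow> exp" where
  "cell x \<equiv> Read x (Lit 0)"

text \<open>Both constants 5 in the time bound are the cost of the loop test, once per iteration and
  once on exit.\<close>

lemma runs_for:
  assumes counter: "\<And>i s. I i s \<Longrightarrow> s k 0 = i \<and> s b 0 = N"
    and body: "\<And>i. i < N \<Longrightarrow> runs p C (I i) T (I (Suc i))"
    and T: "N * (T + 5) + 5 \<le> T'"
  shows "runs p (While (Less (cell k) (cell b)) C) (I 0) T' (I N)"
proof -
  let ?b = "Less (cell k) (cell b)"
  have "runs p (While ?b C) (I i) ((N - i) * (T + 5) + 5) (I N)" if "i \<le> N" for i
    using that
  proof (induction "N - i" arbitrary: i)
    case 0
    then have [simp]: "i = N" by simp
    show ?case
      unfolding runs_def
    proof (intro allI impI)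
      fix s assume "I i s"
      then have "\<not> eval_test p s ?b" using counter[of i s] by simp
      from exec.WhileFalse[OF this, of C] show "\<exists>t s'. exec p (While ?b C) s t s' \<and> t \<le> (N - i) * (T + 5) + 5 \<and> I N s'"
        using \<open>I i s\<close> by (intro exI[of _ "cost_test ?b"] exI[of _ s]) simp
    qed
  next
    case (Suc d)
    then have i: "i < N" by simp
    have IH: "runs p (While ?b C) (I (Suc i)) ((N - Suc i) * (T + 5) + 5) (I N)"
      using Suc by (intro Suc.hyps(1)) auto
    show ?case
      unfolding runs_def
    proof (intro allI impI)
      fix s assume s: "I i s"
      have b: "eval_test p s ?b" using counter[OF s] i by simp
      obtain t s' where 1: "exec p C s t s'" "t \<le> T" "I (Suc i) s'"
        using body[OF i] s unfolding runs_def by blast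
      obtain t' s'' where 2: "exec p (While ?b C) s' t' s''" "t' \<le> (N - Suc i) * (T + 5) + 5" "I N s''"
        using IH 1(3) unfolding runs_def by blast
      have "(N - i) * (T + 5) = (N - Suc i) * (T + 5) + (T + 5)" using i by (simp add: Suc_diff_Suc[symmetric])
      then show "\<exists>t s'. exec p (While ?b C) s t s' \<and> t \<le> (N - i) * (T + 5) + 5 \<and> I N s'"
        using exec.WhileTrue[OF b 1(1) 2(1)] 1(2) 2(2,3)
        by (intro exI[of _ "cost_test ?b + t + t'"] exI[of _ s'']) simp
    qed
  qed
  from this[of 0] show ?thesis using T runs_conseq by fastforce
qed

lemma runs_ex:
  assumes "\<And>x. runs p C (P x) T Q"
  shows "runs p C (\<lambda>s. \<exists>x. P x s) T Q"
  using assms unfolding runs_def by blast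

fun assigns :: "(string \<times> exp \<times> exp) list \<Rightarrow> com" where
  "assigns [] = Skip"
| "assigns ((a, e, d) # xs) = Seq (Write a e d) (assigns xs)"

fun after :: "nat \<Rightarrow> state \<Rightarrow> (string \<times> exp \<times> exp) list \<Rightarrow> state" where
  "after p s [] = s"
| "after p s ((a, e, d) # xs) = after p (s(a := (s a)(eval_exp p s e := eval_exp p s d))) xs"

fun cost_assigns :: "(string \<times> exp \<times> exp) list \<Rightarrow> nat" where
  "cost_assigns [] = 1"
| "cost_assigns ((a, e, d) # xs) = cost_exp e + cost_exp d + 1 + cost_assigns xs"

lemma exec_assigns: "exec p (assigns xs) s (cost_assigns xs) (after p s xs)"
proof (induction xs arbitrary: s rule: assigns.induct)
  case 1
  then show ?case using exec.Skip by simp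
next
  case (2 a e d xs)
  then show ?case using exec.Seq[OF exec.Write] by simp
qed

lemma runs_assigns:
  assumes "\<And>s. P s \<Longrightarrow> Q (after p s xs)" "cost_assigns xs \<le> T"
  shows "runs p (assigns xs) P T Q"
  unfolding runs_def using exec_assigns assms by blast

text \<open>The gadget of a given weight is found by binary search in a program that depends on \<open>p\<close>.\<close>

fun tree :: "nat \<Rightarrow> nat \<Rightarrow> (nat \<Rightarrow> com) \<Rightarrow> com" where
  "tree 0 l L = L l"
| "tree (Suc d) l L = If (Less (cell ''v'') (Lit (l + 2 ^ d))) (tree d l L) (tree d (l + 2 ^ d) L)"

text \<open>A leaf only has to be correct when the searched value is its own label. The factor 4 is
  the cost of the comparison on each level.\<close>

lemma runs_tree:
  assumes "\<And>v. runs p (L v) (\<lambda>s. P s \<and> s ''v'' 0 = v) T Q"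
    "\<And>s. P s \<Longrightarrow> l \<le> s ''v'' 0 \<and> s ''v'' 0 < l + 2 ^ d"
  shows "runs p (tree d l L) P (4 * d + T) Q"
  using assms
proof (induction d arbitrary: l P)
  case 0
  have "runs p (L l) P T Q"
  proof (rule runs_conseq[OF "0.prems"(1)[of l]])
    fix s assume "P s"
    then show "P s \<and> s ''v'' 0 = l" using "0.prems"(2)[of s] by simp
  qed auto
  then show ?case by simp
next
  case (Suc d)
  have "runs p (tree d l L) (\<lambda>s. P s \<and> s ''v'' 0 < l + 2 ^ d) (4 * d + T) Q"
  proof (rule Suc.IH)
    fix v show "runs p (L v) (\<lambda>s. (P s \<and> s ''v'' 0 < l + 2 ^ d) \<and> s ''v'' 0 = v) T Q"
      by (rule runs_conseq[OF Suc.prems(1)[of v]]) auto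
  qed (use Suc.prems(2) in auto)
  moreover have "runs p (tree d (l + 2 ^ d) L) (\<lambda>s. P s \<and> \<not> s ''v'' 0 < l + 2 ^ d) (4 * d + T) Q"
  proof (rule Suc.IH)
    fix v show "runs p (L v) (\<lambda>s. (P s \<and> \<not> s ''v'' 0 < l + 2 ^ d) \<and> s ''v'' 0 = v) T Q"
      by (rule runs_conseq[OF Suc.prems(1)[of v]]) auto
  next
    fix s assume "P s \<and> \<not> s ''v'' 0 < l + 2 ^ d"
    then show "l + 2 ^ d \<le> s ''v'' 0 \<and> s ''v'' 0 < l + 2 ^ d + 2 ^ d"
      using Suc.prems(2)[of s] by simp
  qed
  ultimately show ?case by (simp, intro runs_If[where T = "4 * d + T"]) simp_all
qed

section \<open>The encoding and decoding programs\<close>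

text \<open>The machine cannot add addresses, so the offset of an interior vertex is spelled out by
  successors. Hence an arc costs time linear in its labels and a gadget costs time quadratic in its
  size.\<close>

definition vexp :: "nat \<Rightarrow> exp" where
  "vexp i = (if i = 0 then cell ''a'' else if i = 1 then cell ''b'' else (Succ ^^ (i - 2)) (cell ''nf''))"

lemma eval_Succ_pow: "eval_exp p s ((Succ ^^ i) e) = eval_exp p s e + i"
  by (induction i) auto

lemma cost_Succ_pow: "cost_exp ((Succ ^^ i) e) = cost_exp e + i"
  by (induction i) auto

lemma eval_vexp [simp]: "eval_exp p s (vexp i) = place (s ''a'' 0) (s ''b'' 0) (s ''nf'' 0) i"
  by (auto simp: vexp_def place_def eval_Succ_pow)

lemma cost_vexp: "cost_exp (vexp i) \<le> i + 2"
  by (auto simp: vexp_def cost_Succ_pow)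

abbreviation outdeg :: "(nat \<times> nat) list \<Rightarrow> nat \<Rightarrow> nat" where
  "outdeg H x \<equiv> length (filter (\<lambda>e. fst e = x) H)"

definition arcs_stored :: "nat \<Rightarrow> state \<Rightarrow> (nat \<times> nat) list \<Rightarrow> bool" where
  "arcs_stored p s H \<longleftrightarrow>
     (\<forall>k<length H. s ''row'' k = fst (H ! k) \<and> s ''col'' k = snd (H ! k) \<and> s ''val'' k = p - 1)"

definition emit :: "nat \<Rightarrow> nat \<Rightarrow> nat \<Rightarrow> com" where
  "emit p x y = assigns
    [(''row'', cell ''nnz'', vexp x), (''col'', cell ''nnz'', vexp y), (''val'', cell ''nnz'', Lit (p - 1)),
     (''deg'', vexp x, FAdd (Read ''deg'' (vexp x)) (Lit 1)), (''nnz'', Lit 0, Succ (cell ''nnz''))]"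

fun emits :: "nat \<Rightarrow> (nat \<times> nat) list \<Rightarrow> com" where
  "emits p [] = Skip"
| "emits p ((x, y) # K) = Seq (emit p x y) (emits p K)"

definition leaf :: "nat \<Rightarrow> (nat \<times> nat) list \<Rightarrow> nat \<Rightarrow> com" where
  "leaf p K q = Seq (emits p K) (assigns [(''nf'', Lit 0, (Succ ^^ q) (cell ''nf''))])"

definition next_k :: com where
  "next_k = assigns [(''k'', Lit 0, Succ (cell ''k''))]"

definition loop :: "string \<Rightarrow> com \<Rightarrow> com" where
  "loop b C = While (Less (cell ''k'') (cell b)) (Seq C next_k)"

text \<open>The arcs of the output are written over the arrays of the input, so the input entries
  are saved beforehand.\<close>

definition copy_entry :: com where
  "copy_entry = assigns
    [(''orow'', cell ''k'', Read ''row'' (cell ''k'')), (''ocol'', cell ''k'', Read ''col'' (cell ''k'')),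
     (''oval'', cell ''k'', Read ''val'' (cell ''k''))]"

definition replace_entry :: "nat \<Rightarrow> nat \<Rightarrow> (nat \<Rightarrow> (nat \<times> nat) list) \<Rightarrow> (nat \<Rightarrow> nat) \<Rightarrow> com" where
  "replace_entry p d gl q = Seq (assigns
    [(''a'', Lit 0, Read ''orow'' (cell ''k'')), (''b'', Lit 0, Read ''ocol'' (cell ''k'')),
     (''v'', Lit 0, Read ''oval'' (cell ''k''))])
    (If (Less (cell ''a'') (cell ''b'')) (tree d 0 (\<lambda>v. leaf p (gl v) (q v))) Skip)"

text \<open>Runs over arcs rather than vertices, since isolated vertices may be far more numerous
  than non-zero entries. Clearing \<open>deg\<close> marks a vertex as done, and a degree divisible
  by p is skipped by the same test.\<close>

definition diagonal_entry :: com where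
  "diagonal_entry = If (Equal (Read ''deg'' (Read ''row'' (cell ''k''))) (Lit 0)) Skip (assigns
    [(''row'', cell ''nnz'', Read ''row'' (cell ''k'')), (''col'', cell ''nnz'', Read ''row'' (cell ''k'')),
     (''val'', cell ''nnz'', Read ''deg'' (Read ''row'' (cell ''k''))),
     (''deg'', Read ''row'' (cell ''k''), Lit 0), (''nnz'', Lit 0, Succ (cell ''nnz''))])"

text \<open>The last loop pads the system with isolated vertices until the number of added vertices equals
  the number of non-zero entries; \<open>decode\<close> then recovers the original dimension by counting.\<close>

definition encode :: "nat \<Rightarrow> nat \<Rightarrow> (nat \<Rightarrow> (nat \<times> nat) list) \<Rightarrow> (nat \<Rightarrow> nat) \<Rightarrow> com" where
  "encode p d gl q =
    Seq (assigns [(''m'', Lit 0, cell ''nnz''), (''nf'', Lit 0, cell ''ncols''), (''k'', Lit 0, Lit 0)])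
    (Seq (loop ''m'' copy_entry)
    (Seq (assigns [(''nnz'', Lit 0, Lit 0), (''k'', Lit 0, Lit 0)])
    (Seq (loop ''m'' (replace_entry p d gl q))
    (Seq (assigns [(''e'', Lit 0, cell ''nnz''), (''k'', Lit 0, Lit 0)])
    (Seq (loop ''e'' diagonal_entry)
    (Seq (assigns [(''k'', Lit 0, Lit 0)])
    (Seq (loop ''nnz'' (assigns [(''ncols'', Lit 0, Succ (cell ''ncols''))]))
    (assigns [(''nrows'', Lit 0, cell ''ncols'')]))))))))"

definition decode :: com where
  "decode = loop ''nnz'' (assigns [(''ncols'', Lit 0, Pred (cell ''ncols''))])"

section \<open>Correctness and running time of the programs\<close>

text \<open>The 11 is the loop test, 5, plus the increment of the counter, 6.\<close>

lemma runs_loop: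
  assumes counter: "\<And>i s. I i s \<Longrightarrow> s ''k'' 0 = i \<and> s b 0 = N"
    and body: "\<And>i. i < N \<Longrightarrow> runs p C (I i) T (\<lambda>s. I (Suc i) (s(''k'' := (s ''k'')(0 := Suc (s ''k'' 0)))))"
    and T: "N * (T + 11) + 5 \<le> T'"
  shows "runs p (loop b C) (I 0) T' (I N)"
  unfolding loop_def
proof (rule runs_for[where I = I and N = N and T = "T + 6"])
  fix i s assume "I i s"
  then show "s ''k'' 0 = i \<and> s b 0 = N" by (rule counter)
next
  fix i assume i: "i < N"
  show "runs p (Seq C next_k) (I i) (T + 6) (I (Suc i))"
    unfolding next_k_def by (rule runs_Seq[OF body[OF i] runs_assigns[where T = 6]]) auto
qed (use T in \<open>simp add: algebra_simps\<close>)

text \<open>The predicate F stands for whatever the surrounding loop needs to preserve; it may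
  depend on any array except the five written here. The term 4 B pays for evaluating four vertex
  expressions.\<close>

lemma runs_emits:
  assumes "\<And>x y. (x, y) \<in> set K \<Longrightarrow> x < B \<and> y < B"
    and frame: "\<And>s s'. F s \<Longrightarrow> (\<And>c. c \<notin> {''row'', ''col'', ''val'', ''deg'', ''nnz''} \<Longrightarrow> s' c = s c) \<Longrightarrow> F s'"
    and F: "\<And>s. F s \<Longrightarrow> s ''a'' 0 = a \<and> s ''b'' 0 = b \<and> s ''nf'' 0 = f"
  shows "runs p (emits p K)
    (\<lambda>s. F s \<and> arcs_stored p s H \<and> s ''nnz'' 0 = length H \<and> (\<forall>x. s ''deg'' x = outdeg H x mod p))
    (length K * (4 * B + 30) + 1)
    (\<lambda>s. F s \<and> arcs_stored p s (H @ map (map_prod (place a b f) (place a b f)) K) \<and>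
       s ''nnz'' 0 = length H + length K \<and>
       (\<forall>x. s ''deg'' x = outdeg (H @ map (map_prod (place a b f) (place a b f)) K) x mod p))"
  using assms(1)
proof (induction K arbitrary: H)
  case Nil
  then show ?case by (auto intro: runs_Skip)
next
  case (Cons e K)
  obtain x y where e: "e = (x, y)" by fastforce
  let ?g = "place a b f"
  let ?H = "H @ [(?g x, ?g y)]"
  have 1: "runs p (emit p x y)
    (\<lambda>s. F s \<and> arcs_stored p s H \<and> s ''nnz'' 0 = length H \<and> (\<forall>x. s ''deg'' x = outdeg H x mod p))
    (4 * B + 30)
    (\<lambda>s. F s \<and> arcs_stored p s ?H \<and> s ''nnz'' 0 = length ?H \<and> (\<forall>x. s ''deg'' x = outdeg ?H x mod p))"
    unfolding emit_def
  proof (rule runs_assigns, goal_cases)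
    case (1 s)
    then have s: "F s" "arcs_stored p s H" "s ''nnz'' 0 = length H" "\<And>x. s ''deg'' x = outdeg H x mod p"
      by simp_all
    have v: "s ''a'' 0 = a" "s ''b'' 0 = b" "s ''nf'' 0 = f" using F[OF s(1)] by simp_all
    show ?case
    proof (intro conjI frame[OF s(1)])
      show "arcs_stored p (after p s [(''row'', cell ''nnz'', vexp x), (''col'', cell ''nnz'', vexp y),
        (''val'', cell ''nnz'', Lit (p - 1)), (''deg'', vexp x, FAdd (Read ''deg'' (vexp x)) (Lit 1)),
        (''nnz'', Lit 0, Succ (cell ''nnz''))]) ?H"
        using s(2) by (simp add: arcs_stored_def v s(3) nth_append less_Suc_eq)
    qed (simp_all add: v s(3,4) mod_Suc_eq)
  next
    case 2
    have "x < B" "y < B" using Cons.prems[of x y] e by auto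
    then show ?case using cost_vexp[of x] cost_vexp[of y] by simp
  qed
  have "runs p (emits p K)
    (\<lambda>s. F s \<and> arcs_stored p s ?H \<and> s ''nnz'' 0 = length ?H \<and> (\<forall>x. s ''deg'' x = outdeg ?H x mod p))
    (length K * (4 * B + 30) + 1)
    (\<lambda>s. F s \<and> arcs_stored p s (?H @ map (map_prod ?g ?g) K) \<and>
       s ''nnz'' 0 = length ?H + length K \<and>
       (\<forall>x. s ''deg'' x = outdeg (?H @ map (map_prod ?g ?g) K) x mod p))"
    by (rule Cons.IH) (use Cons.prems in auto)
  then show ?case
    unfolding e emits.simps using runs_Seq[OF 1] by fastforce
qed

text \<open>Functional counterpart of one pass of the replacement loop: the arcs emitted so far and
  the first free vertex.\<close>

definition grow ::
  "(nat \<Rightarrow> (nat \<times> nat) list) \<Rightarrow> (nat \<Rightarrow> nat) \<Rightarrow> (nat \<times> nat) list \<times> nat \<Rightarrow> nat \<times> nat \<times> int \<Rightarrow>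
    (nat \<times> nat) list \<times> nat" where
  "grow gl q = (\<lambda>(H, f) (a, b, v). if a < b
     then (H @ map (map_prod (place a b f) (place a b f)) (gl (nat v)), f + q (nat v)) else (H, f))"

definition fixed_cells :: "nat \<Rightarrow> (nat \<times> nat \<times> int) list \<Rightarrow> (nat \<Rightarrow> nat) \<Rightarrow> state \<Rightarrow> bool" where
  "fixed_cells n es r s \<longleftrightarrow> s ''m'' 0 = length es \<and> s ''ncols'' 0 = n \<and> s ''rhs'' = r \<and>
     (\<forall>i<length es. es ! i = (s ''orow'' i, s ''ocol'' i, int (s ''oval'' i)))"

definition growing ::
  "nat \<Rightarrow> nat \<Rightarrow> (nat \<times> nat \<times> int) list \<Rightarrow> (nat \<Rightarrow> nat) \<Rightarrow> (nat \<times> nat) list \<times> nat \<Rightarrow> nat \<Rightarrow> state \<Rightarrow> bool" where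
  "growing p n es r X i s \<longleftrightarrow> (s ''k'' 0 = i \<and> fixed_cells n es r s \<and> s ''nf'' 0 = snd X) \<and>
     arcs_stored p s (fst X) \<and> s ''nnz'' 0 = length (fst X) \<and>
     (\<forall>x. s ''deg'' x = outdeg (fst X) x mod p)"

lemma runs_replace_entry:
  assumes gl: "\<And>v x y. (x, y) \<in> set (gl v) \<Longrightarrow> x < B \<and> y < B" "\<And>v. length (gl v) \<le> e" "\<And>v. q v \<le> B"
    and es: "i < length es" "\<And>a b v. (a, b, v) \<in> set es \<Longrightarrow> v < 2 ^ d"
  shows "runs p (replace_entry p d gl q) (growing p n es r X i) (4 * d + e * (4 * B + 30) + B + 30)
    (\<lambda>s. growing p n es r (grow gl q X (es ! i)) (Suc i) (s(''k'' := (s ''k'')(0 := Suc (s ''k'' 0)))))"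
proof -
  obtain a b w where abw: "es ! i = (a, b, w)" by (cases "es ! i")
  obtain H f where X: "X = (H, f)" by fastforce
  let ?L = "e * (4 * B + 30) + B + 6"
  let ?Q = "\<lambda>s. growing p n es r (grow gl q X (es ! i)) (Suc i) (s(''k'' := (s ''k'')(0 := Suc (s ''k'' 0))))"
  define R where "R s \<longleftrightarrow> growing p n es r X i s \<and> s ''a'' 0 = a \<and> s ''b'' 0 = b \<and> int (s ''v'' 0) = w" for s
  have 1: "runs p (assigns [(''a'', Lit 0, Read ''orow'' (cell ''k'')), (''b'', Lit 0, Read ''ocol'' (cell ''k'')),
     (''v'', Lit 0, Read ''oval'' (cell ''k''))]) (growing p n es r X i) 16 R"
  proof (rule runs_assigns, goal_cases)
    case (1 s)
    then have "es ! i = (s ''orow'' i, s ''ocol'' i, int (s ''oval'' i))" "s ''k'' 0 = i"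
      using es(1) by (auto simp: growing_def fixed_cells_def)
    then show ?case using 1 abw
      by (auto simp: R_def growing_def fixed_cells_def arcs_stored_def)
  qed simp
  have leaf: "runs p (leaf p (gl v) (q v)) (\<lambda>s. (R s \<and> a < b) \<and> s ''v'' 0 = v) ?L ?Q" for v
  proof (cases "a < b \<and> int v = w")
    case True
    let ?F = "\<lambda>s. s ''k'' 0 = i \<and> fixed_cells n es r s \<and> s ''a'' 0 = a \<and> s ''b'' 0 = b \<and> s ''nf'' 0 = f"
    let ?H = "H @ map (map_prod (place a b f) (place a b f)) (gl v)"
    have "runs p (emits p (gl v))
      (\<lambda>s. ?F s \<and> arcs_stored p s H \<and> s ''nnz'' 0 = length H \<and> (\<forall>x. s ''deg'' x = outdeg H x mod p))
      (length (gl v) * (4 * B + 30) + 1)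
      (\<lambda>s. ?F s \<and> arcs_stored p s ?H \<and> s ''nnz'' 0 = length H + length (gl v) \<and>
        (\<forall>x. s ''deg'' x = outdeg ?H x mod p))"
      by (rule runs_emits[OF gl(1)]) (auto simp: fixed_cells_def)
    moreover have "runs p (assigns [(''nf'', Lit 0, (Succ ^^ q v) (cell ''nf''))])
      (\<lambda>s. ?F s \<and> arcs_stored p s ?H \<and> s ''nnz'' 0 = length H + length (gl v) \<and>
        (\<forall>x. s ''deg'' x = outdeg ?H x mod p)) (B + 5) ?Q"
    proof (rule runs_assigns, goal_cases)
      case (1 s)
      have "grow gl q X (es ! i) = (?H, f + q v)" using True by (auto simp: grow_def X abw)
      then show ?case using 1
        by (simp add: growing_def fixed_cells_def arcs_stored_def eval_Succ_pow)
    qed (use gl(3) in \<open>simp add: cost_Succ_pow\<close>)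
    ultimately have "runs p (leaf p (gl v) (q v))
      (\<lambda>s. ?F s \<and> arcs_stored p s H \<and> s ''nnz'' 0 = length H \<and> (\<forall>x. s ''deg'' x = outdeg H x mod p)) ?L ?Q"
      unfolding leaf_def
      by (rule runs_Seq) (use mult_le_mono1[OF gl(2)[of v], of "4 * B + 30"] in simp)
    then show ?thesis
      by (rule runs_conseq) (auto simp: R_def growing_def X)
  next
    case False
    \<comment> \<open>The precondition is contradictory here: it fixes both the order of a and b and
      the value by which this leaf was selected.\<close>
    then show ?thesis by (auto simp: runs_def R_def)
  qed
  have "runs p (tree d 0 (\<lambda>v. leaf p (gl v) (q v))) (\<lambda>s. R s \<and> a < b) (4 * d + ?L) ?Q"
  proof (rule runs_tree[OF leaf])
    fix s assume "R s \<and> a < b"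
    then have "int (s ''v'' 0) < 2 ^ d" using es(2)[of a b w] nth_mem[OF es(1)] abw by (simp add: R_def)
    then show "0 \<le> s ''v'' 0 \<and> s ''v'' 0 < 0 + 2 ^ d"
      by (metis add_0 le0 of_nat_less_iff of_nat_numeral of_nat_power)
  qed
  then have 2: "runs p (tree d 0 (\<lambda>v. leaf p (gl v) (q v)))
      (\<lambda>s. R s \<and> eval_test p s (Less (cell ''a'') (cell ''b''))) (4 * d + ?L + 1) ?Q"
    by (rule runs_conseq) (auto simp: R_def)
  have 3: "runs p Skip (\<lambda>s. R s \<and> \<not> eval_test p s (Less (cell ''a'') (cell ''b''))) (4 * d + ?L + 1) ?Q"
  proof (rule runs_Skip)
    fix s assume s: "R s \<and> \<not> eval_test p s (Less (cell ''a'') (cell ''b''))"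
    then have "grow gl q X (es ! i) = X" by (auto simp: grow_def X abw R_def)
    then show "?Q s" using s by (auto simp: R_def growing_def fixed_cells_def arcs_stored_def)
  qed simp
  show ?thesis
    unfolding replace_entry_def
    by (rule runs_Seq[OF 1 runs_If[OF 2 3 order_refl]]) simp
qed

text \<open>D lists the vertices that receive a diagonal entry. Its order is left open, as it
  depends on the order of the arcs.\<close>

definition full_degrees :: "nat \<Rightarrow> (nat \<times> nat) list \<Rightarrow> nat list \<Rightarrow> nat set \<Rightarrow> bool" where
  "full_degrees p H D V \<longleftrightarrow> distinct D \<and> set D = {x \<in> V. outdeg H x mod p \<noteq> 0}"

lemma full_degrees_length:
  assumes "full_degrees p H D (fst ` set H)"
  shows "length D \<le> length H"
proof -
  have "length D = card (set D)" using assms by (metis distinct_card full_degrees_def)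
  also have "\<dots> \<le> card (fst ` set H)"
    using assms by (intro card_mono) (auto simp: full_degrees_def)
  also have "\<dots> \<le> length H" by (meson card_image_le card_length finite_set le_trans)
  finally show ?thesis .
qed

definition completing ::
  "nat \<Rightarrow> nat \<Rightarrow> (nat \<Rightarrow> nat) \<Rightarrow> (nat \<times> nat) list \<Rightarrow> nat list \<Rightarrow> state \<Rightarrow> bool" where
  "completing p n r H D s \<longleftrightarrow> s ''ncols'' 0 = n \<and> s ''rhs'' = r \<and> s ''nnz'' 0 = length H + length D \<and>
     arcs_stored p s H \<and> (\<forall>j<length D. s ''row'' (length H + j) = D ! j \<and>
       s ''col'' (length H + j) = D ! j \<and> s ''val'' (length H + j) = outdeg H (D ! j) mod p)"

definition completing_step ::
  "nat \<Rightarrow> nat \<Rightarrow> (nat \<Rightarrow> nat) \<Rightarrow> (nat \<times> nat) list \<Rightarrow> nat \<Rightarrow> nat list \<Rightarrow> state \<Rightarrow> bool" where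
  "completing_step p n r H i D s \<longleftrightarrow> completing p n r H D s \<and> full_degrees p H D (fst ` set (take i H)) \<and>
     s ''k'' 0 = i \<and> s ''e'' 0 = length H \<and>
     (\<forall>x. s ''deg'' x = (if x \<in> fst ` set (take i H) then 0 else outdeg H x mod p))"

lemma runs_diagonal_entry:
  assumes i: "i < length H"
  shows "runs p diagonal_entry (\<lambda>s. \<exists>D. completing_step p n r H i D s) 36
    (\<lambda>s. \<exists>D. completing_step p n r H (Suc i) D (s(''k'' := (s ''k'')(0 := Suc (s ''k'' 0)))))"
proof (rule runs_ex)
  fix D
  let ?Q = "\<lambda>s. \<exists>D. completing_step p n r H (Suc i) D (s(''k'' := (s ''k'')(0 := Suc (s ''k'' 0))))"
  let ?V = "fst ` set (take i H)"
  let ?x = "fst (H ! i)"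
  let ?b = "Equal (Read ''deg'' (Read ''row'' (cell ''k''))) (Lit 0)"
  have V: "fst ` set (take (Suc i) H) = insert ?x ?V" using i by (simp add: take_Suc_conv_app_nth)
  have x: "s ''row'' i = ?x" "s ''k'' 0 = i" if "completing_step p n r H i D s" for s
    using that i by (auto simp: completing_step_def completing_def arcs_stored_def)
  have 1: "runs p Skip (\<lambda>s. completing_step p n r H i D s \<and> eval_test p s ?b) 30 ?Q"
  proof (rule runs_Skip)
    fix s assume s: "completing_step p n r H i D s \<and> eval_test p s ?b"
    then have "s ''deg'' ?x = 0" using x[of s] by simp
    then have "?x \<in> ?V \<or> outdeg H ?x mod p = 0" using s by (auto simp: completing_step_def split: if_splits)
    then have "completing_step p n r H (Suc i) D (s(''k'' := (s ''k'')(0 := Suc (s ''k'' 0))))"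
      using s unfolding completing_step_def V
      by (auto simp: completing_def arcs_stored_def full_degrees_def)
    then show "?Q s" by (rule exI[of _ D])
  qed simp
  have 2: "runs p (assigns
    [(''row'', cell ''nnz'', Read ''row'' (cell ''k'')), (''col'', cell ''nnz'', Read ''row'' (cell ''k'')),
     (''val'', cell ''nnz'', Read ''deg'' (Read ''row'' (cell ''k''))),
     (''deg'', Read ''row'' (cell ''k''), Lit 0), (''nnz'', Lit 0, Succ (cell ''nnz''))])
    (\<lambda>s. completing_step p n r H i D s \<and> \<not> eval_test p s ?b) 30 ?Q"
  proof (rule runs_assigns, goal_cases)
    case (1 s)
    then have s: "completing_step p n r H i D s" and ne: "s ''deg'' ?x \<noteq> 0" using x[of s] by auto
    have new: "?x \<notin> ?V" "outdeg H ?x mod p \<noteq> 0" "s ''deg'' ?x = outdeg H ?x mod p"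
      using s ne by (auto simp: completing_step_def split: if_splits)
    have nnz: "s ''nnz'' 0 = length H + length D" using s by (simp add: completing_step_def completing_def)
    have "?x \<notin> set D" using s new(1) by (auto simp: completing_step_def full_degrees_def)
    then have fd: "full_degrees p H (D @ [?x]) (insert ?x ?V)"
      using s new by (auto simp: completing_step_def full_degrees_def)
    show ?case
      by (rule exI[of _ "D @ [?x]"])
         (use s fd i in \<open>simp add: completing_step_def V completing_def arcs_stored_def nnz x[OF s] new(3) new(1)
            nth_append less_Suc_eq\<close>)
  qed simp
  show "runs p diagonal_entry (completing_step p n r H i D) 36 ?Q"
    unfolding diagonal_entry_def by (rule runs_If[OF 1 2]) simp
qed

lemma runs_encode:
  assumes gl: "\<And>v x y. (x, y) \<in> set (gl v) \<Longrightarrow> x < B \<and> y < B" "\<And>v. length (gl v) \<le> e" "\<And>v. q v \<le> B"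
    and es: "\<And>a b v. (a, b, v) \<in> set es \<Longrightarrow> v < 2 ^ d"
    and H: "H = fst (foldl (grow gl q) ([], n) es)"
  shows "runs p (encode p d gl q)
    (\<lambda>s. s ''nnz'' 0 = length es \<and> s ''ncols'' 0 = n \<and> s ''rhs'' = r \<and> (\<forall>x. s ''deg'' x = 0) \<and>
       (\<forall>i<length es. es ! i = (s ''row'' i, s ''col'' i, int (s ''val'' i))))
    (length es * (4 * d + e * (4 * B + 30) + B + 80) + length H * 100 + 100)
    (\<lambda>s. \<exists>D. full_degrees p H D (fst ` set H) \<and> completing p (n + (length H + length D)) r H D s \<and>
       s ''nrows'' 0 = n + (length H + length D))"
proof -
  let ?m = "length es"
  let ?X = "\<lambda>i. foldl (grow gl q) ([], n) (take i es)"
  let ?body = "4 * d + e * (4 * B + 30) + B + 30"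
  \<comment> \<open>P0 describes the input; C, G, F and R are the invariants of the loops that copy,
    replace, complete the diagonal and pad. In R the list D is a parameter because it no longer
    changes.\<close>
  define P0 where "P0 s \<longleftrightarrow> s ''ncols'' 0 = n \<and> s ''rhs'' = r \<and> (\<forall>x. s ''deg'' x = 0) \<and>
    (\<forall>i<?m. es ! i = (s ''row'' i, s ''col'' i, int (s ''val'' i)))" for s
  define C where "C i s \<longleftrightarrow> P0 s \<and> s ''k'' 0 = i \<and> s ''m'' 0 = ?m \<and> s ''nf'' 0 = n \<and>
    (\<forall>j<i. es ! j = (s ''orow'' j, s ''ocol'' j, int (s ''oval'' j)))" for i s
  define G where "G i s \<longleftrightarrow> growing p n es r (?X i) i s" for i s
  define F where "F i s \<longleftrightarrow> (\<exists>D. completing_step p n r H i D s)" for i s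
  define R where "R D i s \<longleftrightarrow> full_degrees p H D (fst ` set H) \<and> completing p (n + i) r H D s \<and> s ''k'' 0 = i"
    for D i s
  let ?Q = "\<lambda>s. \<exists>D. full_degrees p H D (fst ` set H) \<and> completing p (n + (length H + length D)) r H D s \<and>
       s ''nrows'' 0 = n + (length H + length D)"
  have 1: "runs p (assigns [(''m'', Lit 0, cell ''nnz''), (''nf'', Lit 0, cell ''ncols''), (''k'', Lit 0, Lit 0)])
    (\<lambda>s. s ''nnz'' 0 = ?m \<and> P0 s) 20 (C 0)"
    by (rule runs_assigns) (auto simp: C_def P0_def)
  have 2: "runs p (loop ''m'' copy_entry) (C 0) (?m * 30 + 5) (C ?m)"
  proof (rule runs_loop[where I = C and N = ?m and T = 19])
    fix i assume i: "i < ?m"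
    show "runs p copy_entry (C i) 19 (\<lambda>s. C (Suc i) (s(''k'' := (s ''k'')(0 := Suc (s ''k'' 0)))))"
      unfolding copy_entry_def
      by (rule runs_assigns) (use i in \<open>auto simp: C_def P0_def less_Suc_eq\<close>)
  qed (auto simp: C_def)
  have 3: "runs p (assigns [(''nnz'', Lit 0, Lit 0), (''k'', Lit 0, Lit 0)]) (C ?m) 10 (G 0)"
    by (rule runs_assigns) (auto simp: C_def P0_def G_def growing_def fixed_cells_def arcs_stored_def)
  have 4: "runs p (loop ''m'' (replace_entry p d gl q)) (G 0) (?m * (?body + 11) + 5) (G ?m)"
  proof (rule runs_loop[where I = G and N = ?m and T = ?body])
    fix i assume i: "i < ?m"
    have "?X (Suc i) = grow gl q (?X i) (es ! i)" using i by (simp add: take_Suc_conv_app_nth)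
    then show "runs p (replace_entry p d gl q) (G i) ?body
        (\<lambda>s. G (Suc i) (s(''k'' := (s ''k'')(0 := Suc (s ''k'' 0)))))"
      using runs_replace_entry[OF gl i es, where p = p and n = n and r = r and X = "?X i"]
      unfolding G_def by simp
  qed (auto simp: G_def growing_def fixed_cells_def)
  have 5: "runs p (assigns [(''e'', Lit 0, cell ''nnz''), (''k'', Lit 0, Lit 0)]) (G ?m) 12 (F 0)"
  proof (rule runs_assigns, goal_cases)
    case (1 s)
    then show ?case
      unfolding F_def
      by (intro exI[of _ "[]"])
         (simp add: G_def growing_def fixed_cells_def completing_step_def completing_def full_degrees_def
           arcs_stored_def H)
  qed simp
  have 6: "runs p (loop ''e'' diagonal_entry) (F 0) (length H * 47 + 5) (F (length H))"
  proof (rule runs_loop[where I = F and N = "length H" and T = 36])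
    fix i assume i: "i < length H"
    then show "runs p diagonal_entry (F i) 36 (\<lambda>s. F (Suc i) (s(''k'' := (s ''k'')(0 := Suc (s ''k'' 0)))))"
      unfolding F_def by (rule runs_diagonal_entry)
  qed (auto simp: F_def completing_step_def)
  have 7: "runs p (assigns [(''k'', Lit 0, Lit 0)]) (F (length H)) 5 (\<lambda>s. \<exists>D. R D 0 s)"
  proof (rule runs_assigns, goal_cases)
    case (1 s)
    then obtain D where "completing_step p n r H (length H) D s" by (auto simp: F_def)
    then show ?case
      by (intro exI[of _ D]) (simp add: R_def completing_step_def completing_def arcs_stored_def)
  qed simp
  have 8: "runs p (Seq (loop ''nnz'' (assigns [(''ncols'', Lit 0, Succ (cell ''ncols''))]))
      (assigns [(''nrows'', Lit 0, cell ''ncols'')])) (\<lambda>s. \<exists>D. R D 0 s) (length H * 40 + 12) ?Q"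
  proof (rule runs_ex)
    fix D
    show "runs p (Seq (loop ''nnz'' (assigns [(''ncols'', Lit 0, Succ (cell ''ncols''))]))
      (assigns [(''nrows'', Lit 0, cell ''ncols'')])) (R D 0) (length H * 40 + 12) ?Q"
    proof (cases "full_degrees p H D (fst ` set H)")
      case True
      let ?N = "length H + length D"
      note D = full_degrees_length[OF True]
      have "runs p (loop ''nnz'' (assigns [(''ncols'', Lit 0, Succ (cell ''ncols''))])) (R D 0)
        (?N * 17 + 5) (R D ?N)"
      proof (rule runs_loop[where I = "R D" and N = ?N and T = 6])
        fix i assume i: "i < ?N"
        show "runs p (assigns [(''ncols'', Lit 0, Succ (cell ''ncols''))]) (R D i) 6
          (\<lambda>s. R D (Suc i) (s(''k'' := (s ''k'')(0 := Suc (s ''k'' 0)))))"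
          by (rule runs_assigns) (auto simp: R_def completing_def arcs_stored_def)
      qed (auto simp: R_def completing_def)
      moreover have "runs p (assigns [(''nrows'', Lit 0, cell ''ncols'')]) (R D ?N) 6 ?Q"
      proof (rule runs_assigns, goal_cases)
        case (1 s)
        then show ?case
          by (intro exI[of _ D]) (simp add: R_def completing_def arcs_stored_def)
      qed simp
      ultimately show ?thesis by (rule runs_Seq) (use D in simp)
    next
      case False
      then show ?thesis by (auto simp: runs_def R_def)
    qed
  qed
  have "runs p (encode p d gl q) (\<lambda>s. s ''nnz'' 0 = ?m \<and> P0 s)
    (20 + (?m * 30 + 5 + (10 + (?m * (?body + 11) + 5 + (12 + (length H * 47 + 5 + (5 + (length H * 40 + 12))))))))
    ?Q"
    unfolding encode_def
    by (intro runs_Seq[OF 1 _ order_refl] runs_Seq[OF 2 _ order_refl] runs_Seq[OF 3 _ order_refl]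
        runs_Seq[OF 4 _ order_refl] runs_Seq[OF 5 _ order_refl] runs_Seq[OF 6 _ order_refl]
        runs_Seq[OF 7 8 order_refl])
  then show ?thesis
    by (rule runs_conseq) (auto simp: P0_def algebra_simps)
qed

lemma runs_decode:
  assumes "E \<le> N"
  shows "runs p decode (\<lambda>s. s ''k'' 0 = 0 \<and> s ''nnz'' 0 = E \<and> s ''ncols'' 0 = N \<and> s ''sol'' = x)
    (E * 17 + 5) (\<lambda>s. s ''ncols'' 0 = N - E \<and> s ''sol'' = x)"
proof -
  define I where "I i s \<longleftrightarrow> s ''k'' 0 = i \<and> s ''nnz'' 0 = E \<and> s ''ncols'' 0 = N - i \<and> s ''sol'' = x" for i s
  have "runs p decode (I 0) (E * 17 + 5) (I E)"
    unfolding decode_def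
  proof (rule runs_loop[where I = I and N = E and T = 6])
    fix i assume i: "i < E"
    show "runs p (assigns [(''ncols'', Lit 0, Pred (cell ''ncols''))]) (I i) 6
      (\<lambda>s. I (Suc i) (s(''k'' := (s ''k'')(0 := Suc (s ''k'' 0)))))"
      by (rule runs_assigns) (auto simp: I_def)
  qed (auto simp: I_def)
  then show ?thesis by (rule runs_conseq) (auto simp: I_def)
qed

lemma nnz_eq_length:
  assumes "distinct es" "set es = nonzero_entries M"
  shows "nnz M = length es"
proof -
  have "nnz M = card (nonzero_entries M)"
    unfolding nnz_def nonzero_entries_def
    by (rule bij_betw_same_card[of "\<lambda>(i, j). (i, j, M $$ (i, j))"],
        rule bij_betw_byWitness[of _ "\<lambda>(i, j, v). (i, j)"]) auto
  also have "\<dots> = length es" using assms by (metis distinct_card)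
  finally show ?thesis .
qed

text \<open>Arcs supply the off-diagonal entries -1 and D supplies the diagonal ones. Together they
  are exactly the non-zero entries, because p - 1 is not 0 and D omits the degrees divisible by
  p.\<close>

lemma completing_stores_system:
  assumes H: "simple_arcs k H" and p: "2 \<le> p" and D: "full_degrees p H D (fst ` set H)"
    and s: "completing p k r H D s" "s ''nrows'' 0 = k"
    and c: "dim_vec c = k" "\<And>i. i < k \<Longrightarrow> int (r i) = c $ i"
  shows "stores_system s (unit_laplacian p k H) c" "nnz (unit_laplacian p k H) = length H + length D"
proof -
  let ?M = "unit_laplacian p k H"
  define es where "es = map (\<lambda>(x, y). (x, y, int p - 1)) H @ map (\<lambda>x. (x, x, int (outdeg H x) mod int p)) D"
  have Hk: "x < k \<and> y < k \<and> x \<noteq> y" if "(x, y) \<in> set H" for x y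
    using H that by (auto simp: simple_arcs_def)
  have outdeg0: "outdeg H x = 0" if "x \<notin> fst ` set H" for x
    using that by (auto simp: filter_empty_conv)
  have dist: "distinct es"
    using H D Hk by (auto simp: es_def distinct_map simple_arcs_def full_degrees_def inj_on_def)
  have set: "set es = nonzero_entries ?M"
  proof (intro equalityI subsetI)
    fix e assume e: "e \<in> set es"
    obtain i j v where ijv: "e = (i, j, v)" by (metis prod_cases3)
    from e ijv consider "(i, j) \<in> set H" "v = int p - 1"
      | "i = j" "i \<in> set D" "v = int (outdeg H i) mod int p" by (auto simp: es_def)
    then show "e \<in> nonzero_entries ?M"
    proof cases
      case 1
      then show ?thesis
        using Hk[OF 1(1)] p ijv by (simp add: nonzero_entries_def unit_laplacian_entry[OF H p])
    next
      case 2
      have "outdeg H i mod p \<noteq> 0" "i \<in> fst ` set H" using 2(2) D by (auto simp: full_degrees_def)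
      moreover from this(1) have "int (outdeg H i) mod int p \<noteq> 0" by (simp flip: of_nat_mod)
      ultimately show ?thesis
        using 2 Hk ijv by (auto simp: nonzero_entries_def unit_laplacian_entry[OF H p])
    qed
  next
    fix e assume e: "e \<in> nonzero_entries ?M"
    obtain i j v where ijv: "e = (i, j, v)" by (metis prod_cases3)
    then have v: "i < k" "j < k" "v = ?M $$ (i, j)" "v \<noteq> 0" using e by (auto simp: nonzero_entries_def)
    show "e \<in> set es"
    proof (cases "i = j")
      case True
      then have vd: "v = int (outdeg H i) mod int p" using v by (simp add: unit_laplacian_entry[OF H p])
      then have ne: "outdeg H i mod p \<noteq> 0" using v(4) by (simp flip: of_nat_mod)
      then have "i \<in> fst ` set H" using outdeg0[of i] by (metis mod_0)
      then have "i \<in> set D" using D ne by (simp add: full_degrees_def)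
      then show ?thesis using True vd ijv by (auto simp: es_def)
    next
      case False
      then have "(i, j) \<in> set H" "v = int p - 1"
        using v by (auto simp: unit_laplacian_entry[OF H p] split: if_splits)
      then show ?thesis using ijv by (force simp: es_def)
    qed
  qed
  have len: "length es = length H + length D" by (simp add: es_def)
  have nth: "es ! j = (s ''row'' j, s ''col'' j, int (s ''val'' j))" if "j < length es" for j
  proof (cases "j < length H")
    case True
    then show ?thesis
      using s(1) p by (simp add: es_def nth_append completing_def arcs_stored_def case_prod_unfold of_nat_diff)
  next
    case False
    define l where "l = j - length H"
    have l: "j = length H + l" "l < length D" using False that len by (simp_all add: l_def)
    then show ?thesis
      using s(1) by (simp add: es_def nth_append completing_def of_nat_mod)
  qed
  show "stores_system s ?M c"
    unfolding stores_system_def nonzero_entries_def[symmetric]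
  proof (intro conjI exI[of _ es])
    show "s ''nnz'' 0 = length es" using s(1) len by (simp add: completing_def)
    show "\<forall>i<dim_row ?M. int (s ''rhs'' i) = c $ i" using s(1) c(2) by (simp add: completing_def)
    show "\<forall>k<length es. es ! k = (s ''row'' k, s ''col'' k, int (s ''val'' k))" using nth by blast
  qed (use s c dist set in \<open>simp_all add: completing_def\<close>)
  show "nnz ?M = length H + length D" using nnz_eq_length[OF dist set] len by simp
qed

section \<open>The reduction\<close>

text \<open>For p = 2 the only non-zero weight is 1 and the three-edge path serves it; its 6 arcs
  fit into the bound 8 with S = 1.\<close>

lemma small_gadgets:
  assumes "prime p"
  shows "\<exists>S\<ge>1. real S \<le> 38880 * size_bound p \<and>
    (\<forall>w. \<not> [w = 0] (mod int p) \<longrightarrow> (\<exists>q. gadget_size p w q (8 * S)))"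
proof (cases "p = 2")
  case True
  have "size_bound p = 1" using True by (simp add: size_bound_def)
  moreover have "gadget_size p w 2 8" if "\<not> [w = 0] (mod int p)" for w
  proof -
    have "[1 = w] (mod int p)" using that True by (simp add: cong_def)
    then show ?thesis
      using gadget_size_cong gadget_size_mono[OF gadget_size_path3, of 8] True by simp
  qed
  ultimately show ?thesis by (intro exI[of _ 1]) auto
next
  case False
  then have p: "2 < p" using prime_ge_2_nat[OF assms] by simp
  obtain S where S: "1 \<le> S" "real S \<le> 38880 * size_bound p"
    "5 * card {(a, b)\<in>{1..p - 1} \<times> {1..p - 1}. S < sub_cost a b} \<le> (p - 1)\<^sup>2"
    using cost_bound_exists[OF p] by blast
  then show ?thesis using gadget_exists[OF assms p S(1,3)] by blast
qed

text \<open>The bound on f ensures that the padded dimension, which exceeds n by the number of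
  non-zero entries, has room for all interior vertices.\<close>

lemma network_grow:
  assumes gl: "\<And>v. 0 < v \<Longrightarrow> v < p \<Longrightarrow> gadget p (- int v) 0 1 {2..<2 + q v} (gl v)"
      "\<And>v. length (gl v) \<le> e" "\<And>v. q v \<le> length (gl v)"
    and "\<forall>(a, b, v)\<in>set es. a < n \<and> b < n \<and> 0 < v \<and> v < int p"
    and "foldl (grow gl q) ([], n) es = (H, f)"
  shows "network p n f (branches es) H \<and> length H \<le> e * length es \<and> f \<le> n + length H"
  using assms(4,5)
proof (induction es arbitrary: H f rule: rev_induct)
  case Nil
  then show ?case by (simp add: network_Nil branches_def)
next
  case (snoc x es)
  obtain a b v where x: "x = (a, b, v)" by (metis prod_cases3)
  obtain H' f' where H': "foldl (grow gl q) ([], n) es = (H', f')" by fastforce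
  have IH: "network p n f' (branches es) H'" "length H' \<le> e * length es" "f' \<le> n + length H'"
    using snoc.IH[OF _ H'] snoc.prems(1) by auto
  have abv: "a < n" "b < n" "0 < v" "v < int p" using snoc.prems(1) x by auto
  show ?case
  proof (cases "a < b")
    case True
    let ?K = "map (map_prod (place a b f') (place a b f')) (gl (nat v))"
    have H: "H = H' @ ?K" "f = f' + q (nat v)"
      using snoc.prems(2) H' True by (auto simp: grow_def x)
    have nf: "n \<le> f'" using IH(1) by (simp add: network_def)
    have "gadget p (- v) 0 1 {2..<2 + q (nat v)} (gl (nat v))" using gl(1)[of "nat v"] abv by simp
    then have "gadget p (- v) a b {f'..<f' + q (nat v)} ?K"
      by (rule gadget_place) (use True abv nf in auto)
    from network_snoc[OF IH(1) this abv(1,2)]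
    have "network p n f (branches (es @ [x])) H" using True by (simp add: H branches_def x)
    then show ?thesis
      using IH(2,3) gl(2)[of "nat v"] gl(3)[of "nat v"] by (simp add: H)
  next
    case False
    then have "H = H'" "f = f'" "branches (es @ [x]) = branches es"
      using snoc.prems(2) H' by (auto simp: grow_def x branches_def)
    then show ?thesis using IH by simp
  qed
qed

lemma UWLS_zp_system:
  assumes "simple_arcs k H" "2 \<le> p" "dim_vec c = k" "set\<^sub>v c \<subseteq> zp p"
  shows "zp_system p (unit_laplacian p k H) c"
proof -
  have "is_laplacian p k (unit_laplacian p k H)"
    unfolding unit_laplacian_def
    by (rule laplacian_of_is_laplacian) (use simple_arcs_edges(1)[OF assms(1)] assms(2) in auto)
  then have "elements_mat (unit_laplacian p k H) \<subseteq> zp p"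
    by (auto simp: is_laplacian_def zp_def elements_mat_def)
  then show ?thesis using assms by (simp add: zp_system_def)
qed

lemma stores_system_entries:
  assumes "stores_system s M c"
  obtains es where "distinct es" "set es = nonzero_entries M" "s ''nnz'' 0 = length es"
    "\<And>i. i < length es \<Longrightarrow> es ! i = (s ''row'' i, s ''col'' i, int (s ''val'' i))" "nnz M = length es"
proof -
  obtain es where es: "distinct es" "set es = nonzero_entries M" "s ''nnz'' 0 = length es"
    "\<forall>i<length es. es ! i = (s ''row'' i, s ''col'' i, int (s ''val'' i))"
    using assms unfolding stores_system_def nonzero_entries_def[symmetric] by blast
  then show thesis using that nnz_eq_length[OF es(1,2)] by blast
qed

text \<open>A stored entry v belongs to an edge of weight -v. The guard on v allows an empty
  template at the remaining leaves of the search tree, which can have more than p leaves.\<close>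

definition gadget_code :: "nat \<Rightarrow> nat \<Rightarrow> nat \<Rightarrow> nat \<Rightarrow> (nat \<times> nat) list \<Rightarrow> bool" where
  "gadget_code p e v q K \<longleftrightarrow> (0 < v \<and> v < p \<longrightarrow> gadget p (- int v) 0 1 {2..<2 + q} K) \<and>
     (\<forall>(x, y)\<in>set K. x < e \<and> y < e) \<and> length K \<le> e \<and> q \<le> length K"

lemma encode_correct:
  assumes p: "2 \<le> p" "p \<le> 2 ^ d"
    and code: "\<And>v. gadget_code p e v (q v) (gl v)"
    and M: "M \<in> LS p" "zp_system p M c" and s: "input_system s M c"
  shows "\<exists>t s' H k c'. exec p (encode p d gl q) s t s' \<and>
    t \<le> nnz M * (4 * d + e * (4 * e + 30) + e + 80) + e * nnz M * 100 + 100 \<and>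
    simple_arcs k H \<and> stores_system s' (unit_laplacian p k H) c' \<and>
    zp_system p (unit_laplacian p k H) c' \<and>
    nnz (unit_laplacian p k H) \<le> 2 * (e * nnz M) \<and>
    k = dim_row M + nnz (unit_laplacian p k H) \<and>
    (\<forall>x. solves p M c x \<longrightarrow> (\<exists>y. solves p (unit_laplacian p k H) c' y)) \<and>
    (\<forall>y. solves p (unit_laplacian p k H) c' y \<longrightarrow> solves p M c (vec (dim_row M) (\<lambda>i. y $ i)))"
proof -
  have gl: "\<And>v. 0 < v \<Longrightarrow> v < p \<Longrightarrow> gadget p (- int v) 0 1 {2..<2 + q v} (gl v)"
    "\<And>v x y. (x, y) \<in> set (gl v) \<Longrightarrow> x < e \<and> y < e" "\<And>v. length (gl v) \<le> e"
    "\<And>v. q v \<le> length (gl v)"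
    using code unfolding gadget_code_def by blast+
  define n where "n = dim_row M"
  define r where "r = s ''rhs''"
  have st: "stores_system s M c" using s by (simp add: input_system_def)
  have zero: "s a i = 0" if "(a, i) \<notin> system_cells M" for a i
    using s that by (simp add: input_system_def)
  have lap: "is_laplacian p n M" using LS_is_laplacian[OF M(1)] p by (simp add: n_def)
  then have dims: "dim_row M = n" "dim_col M = n" by (auto simp: is_laplacian_def)
  obtain es where es: "distinct es" "set es = nonzero_entries M" "s ''nnz'' 0 = length es"
    "\<And>i. i < length es \<Longrightarrow> es ! i = (s ''row'' i, s ''col'' i, int (s ''val'' i))" "nnz M = length es"
    using stores_system_entries[OF st] by blast
  have range: "\<forall>(a, b, v)\<in>set es. a < n \<and> b < n \<and> 0 < v \<and> v < int p"
    using lap unfolding es(2) nonzero_entries_def dims is_laplacian_def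
    by (auto simp: order_less_le)
  obtain H f where Hf: "foldl (grow gl q) ([], n) es = (H, f)" by fastforce
  have N: "network p n f (branches es) H" "length H \<le> e * length es" "f \<le> n + length H"
    using network_grow[OF gl(1,3,4) range Hf] by blast+
  have "runs p (encode p d gl q)
    (\<lambda>s. s ''nnz'' 0 = length es \<and> s ''ncols'' 0 = n \<and> s ''rhs'' = r \<and> (\<forall>x. s ''deg'' x = 0) \<and>
       (\<forall>i<length es. es ! i = (s ''row'' i, s ''col'' i, int (s ''val'' i))))
    (length es * (4 * d + e * (4 * e + 30) + e + 80) + length H * 100 + 100)
    (\<lambda>s. \<exists>D. full_degrees p H D (fst ` set H) \<and> completing p (n + (length H + length D)) r H D s \<and>
       s ''nrows'' 0 = n + (length H + length D))"
  proof (rule runs_encode[OF gl(2,3)])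
    show "q v \<le> e" for v using gl(3)[of v] gl(4)[of v] by simp
    show "v < 2 ^ d" if "(a, b, v) \<in> set es" for a b v
    proof -
      have "v < int p" using that range by auto
      also have "int p \<le> 2 ^ d" using p(2) by (metis of_nat_le_iff of_nat_numeral of_nat_power)
      finally show ?thesis .
    qed
    show "H = fst (foldl (grow gl q) ([], n) es)" by (simp add: Hf)
  qed
  moreover have "s ''nnz'' 0 = length es \<and> s ''ncols'' 0 = n \<and> s ''rhs'' = r \<and> (\<forall>x. s ''deg'' x = 0) \<and>
       (\<forall>i<length es. es ! i = (s ''row'' i, s ''col'' i, int (s ''val'' i)))"
    using es(3,4) st zero by (auto simp: r_def stores_system_def dims system_cells_def)
  ultimately obtain t s' D where run: "exec p (encode p d gl q) s t s'"
    "t \<le> length es * (4 * d + e * (4 * e + 30) + e + 80) + length H * 100 + 100"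
    and D: "full_degrees p H D (fst ` set H)" "completing p (n + (length H + length D)) r H D s'"
      "s' ''nrows'' 0 = n + (length H + length D)"
    unfolding runs_def by blast
  define k where "k = n + (length H + length D)"
  define c' where "c' = vec k (\<lambda>i. if i < n then c $ i else 0)"
  have fk: "f \<le> k" using N(3) by (simp add: k_def)
  note corr = p(1) M n_def es(1,2) N(1) fk
  have arcs: "simple_arcs k H" by (rule network_simple_arcs[OF corr])
  have c: "dim_vec c = n" "set\<^sub>v c \<subseteq> zp p" using M(2) by (auto simp: zp_system_def n_def)
  \<comment> \<open>The right-hand side is never touched: its cells beyond n are zero in the initial
    memory, which is just what the new vertices require.\<close>
  have "int (r i) = c' $ i" if "i < k" for i
  proof (cases "i < n")
    case True
    then show ?thesis using st that by (simp add: c'_def r_def stores_system_def dims)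
  next
    case False
    then show ?thesis using zero[of "''rhs''" i] that by (simp add: c'_def r_def system_cells_def dims)
  qed
  note rc = this
  have out: "stores_system s' (unit_laplacian p k H) c'" "nnz (unit_laplacian p k H) = length H + length D"
    using completing_stores_system[OF arcs p(1) D(1) D(2,3)[folded k_def] _ rc]
    by (simp_all add: c'_def)
  have "set\<^sub>v c' \<subseteq> zp p" using c p by (auto simp: c'_def vec_set_def zp_def)
  then have zp: "zp_system p (unit_laplacian p k H) c'"
    using UWLS_zp_system[OF arcs p(1)] by (simp add: c'_def)
  have "length H * 100 \<le> e * nnz M * 100" using N(2) es(5) by simp
  then have time: "t \<le> nnz M * (4 * d + e * (4 * e + 30) + e + 80) + e * nnz M * 100 + 100"
    using run(2) es(5) by simp
  have "nnz (unit_laplacian p k H) \<le> 2 * (e * nnz M)"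
    using out(2) full_degrees_length[OF D(1)] N(2) es(5) by simp
  moreover have "k = dim_row M + nnz (unit_laplacian p k H)" by (simp add: out(2) dims) (simp add: k_def)
  moreover have "\<forall>x. solves p M c x \<longrightarrow> (\<exists>y. solves p (unit_laplacian p k H) c' y)"
    unfolding c'_def using network_solution_forth[OF corr] by blast
  moreover have "\<forall>y. solves p (unit_laplacian p k H) c' y \<longrightarrow> solves p M c (vec (dim_row M) (\<lambda>i. y $ i))"
    unfolding c'_def dims using network_solution_back[OF corr] by blast
  ultimately show ?thesis using run(1) time arcs out(1) zp by blast
qed

text \<open>The first n entries of y already are the solution and stay where they are; only the
  stored dimension has to shrink to n.\<close>

lemma decode_correct:
  assumes u: "input_system_solution u M c y" and n: "dim_col M = n + nnz M" and y: "dim_vec y = dim_col M"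
  shows "\<exists>t u'. exec p decode u t u' \<and> t \<le> nnz M * 17 + 5 \<and> stores_solution u' (vec n (\<lambda>i. y $ i))"
proof -
  have st: "stores_system u M c" using u by (simp add: input_system_solution_def)
  have nnz: "u ''nnz'' 0 = nnz M"
    by (rule stores_system_entries[OF st]) simp
  have "u ''k'' 0 = 0" using u by (simp add: input_system_solution_def system_cells_def)
  moreover have "u ''ncols'' 0 = n + nnz M" using st n by (simp add: stores_system_def)
  ultimately obtain t u' where "exec p decode u t u'" "t \<le> nnz M * 17 + 5"
    "u' ''ncols'' 0 = n" "u' ''sol'' = u ''sol''"
    using runs_decode[of "nnz M" "n + nnz M" p "u ''sol''", unfolded runs_def, rule_format, of u] nnz by auto
  moreover have "\<forall>i<dim_vec y. int (u ''sol'' i) = y $ i"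
    using u by (simp add: input_system_solution_def stores_solution_def)
  ultimately show ?thesis
    using n y by (intro exI[of _ t] exI[of _ u']) (simp add: stores_solution_def)
qed

section \<open>Assembling the time and size bounds\<close>

lemma soft_linear_ge:
  assumes "2 \<le> p" "T \<le> real (m + 1) * (C * (log 2 (real p)) ^ k)" "0 \<le> C"
  shows "T \<le> soft_linear C k p m"
proof -
  have "real p \<le> real (p * (m + 2))" using mult_le_mono2[of 1 "m + 2" p] of_nat_mono by fastforce
  then have "log 2 (real p) \<le> log 2 (real (p * (m + 2)))"
    using assms(1) by (subst log_le_cancel_iff) (auto simp del: of_nat_mult of_nat_add)
  then have "(log 2 (real p)) ^ k \<le> (log 2 (real (p * (m + 2)))) ^ k"
    using assms(1) by (intro power_mono) auto
  then have "real (m + 1) * (C * (log 2 (real p)) ^ k) \<le> real (m + 1) * (C * (log 2 (real (p * (m + 2)))) ^ k)"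
    using assms(3) by (intro mult_left_mono) auto
  then show ?thesis using assms(2) by (simp add: soft_linear_def mult_ac)
qed

text \<open>The quadratic dependence on S together with S \<le> K L^2 accounts for the exponent 4.
  The constant 2000 covers 8 + 256 + 1048 + 80 and also the additive 100.\<close>

lemma encode_time:
  fixes L K :: real and S d t m :: nat
  assumes "1 \<le> L" "1 \<le> K" "1 \<le> S" "real S \<le> K * L\<^sup>2" "real d \<le> 2 * L"
    and t: "t \<le> m * (4 * d + 8 * S * (4 * (8 * S) + 30) + 8 * S + 80) + 8 * S * m * 100 + 100"
  shows "real t \<le> real (m + 1) * (2000 * K\<^sup>2 * L ^ 4)"
proof -
  have S2: "real S * real S \<le> K\<^sup>2 * L ^ 4"
    using mult_mono[OF assms(4,4)] assms by (simp add: power2_eq_square power4_eq_xxxx mult_ac)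
  have S1: "1 \<le> real S * real S" "real S \<le> real S * real S"
    using mult_mono[of 1 "real S" 1 "real S"] assms(3) by (auto simp: mult_le_cancel_left1)
  have "L \<le> L ^ 4" using assms(1) power_increasing[of 1 4 L] by simp
  also have "\<dots> \<le> K\<^sup>2 * L ^ 4" using assms(1,2) by (simp add: mult_le_cancel_right1 one_le_power)
  finally have L: "L \<le> K\<^sup>2 * L ^ 4" .
  have "real t \<le> real (m * (4 * d + 8 * S * (4 * (8 * S) + 30) + 8 * S + 80) + 8 * S * m * 100 + 100)"
    using t of_nat_le_iff by blast
  also have "\<dots> = real m * (4 * real d + 256 * (real S * real S) + 1048 * real S + 80) + 100"
    by (simp add: algebra_simps)
  also have "\<dots> \<le> real m * (2000 * K\<^sup>2 * L ^ 4) + 2000 * K\<^sup>2 * L ^ 4"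
    using S1 S2 L assms(5) by (intro add_mono mult_left_mono) linarith+
  finally show ?thesis by (simp add: algebra_simps)
qed

theorem theorem4p4:
  shows "\<exists>(K::real) (C::real) (k::nat). \<forall>p::nat. prime p \<longrightarrow>
    (\<exists>f :: nat \<Rightarrow> real.
       (\<forall>m. f m \<le> K * (real m * (log 2 (real p))\<^sup>2 / max 1 (log 2 (log 2 (real p))))) \<and>
       efficiently_reducible C k p f (LS p) (UWLS p))"
proof (rule exI[of _ "16 * 38880"], rule exI[of _ "2000 * 38880\<^sup>2"], rule exI[of _ 4], intro allI impI)
  fix p :: nat assume pr: "prime p"
  let ?K = "38880 :: real"
  have p: "2 \<le> p" using pr by (rule prime_ge_2_nat)
  define L where "L = log 2 (real p)"
  have L: "1 \<le> L" using p by (simp add: L_def)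
  define d where "d = nat \<lceil>L\<rceil>"
  have d: "real d \<le> 2 * L" using L unfolding d_def by linarith
  have "real p = 2 powr L" using p by (simp add: L_def)
  also have "\<dots> \<le> 2 powr real d" unfolding d_def using L by (intro powr_mono) linarith+
  also have "\<dots> = real (2 ^ d)" by (simp add: powr_realpow)
  finally have pd: "p \<le> 2 ^ d" using of_nat_le_iff by blast
  obtain S where S: "1 \<le> S" "real S \<le> ?K * size_bound p"
    "\<And>w. \<not> [w = 0] (mod int p) \<Longrightarrow> \<exists>q. gadget_size p w q (8 * S)"
    using small_gadgets[OF pr] by blast
  have "size_bound p \<le> L\<^sup>2 / 1"
    unfolding size_bound_def L_def by (intro divide_left_mono) auto
  then have SL: "real S \<le> ?K * L\<^sup>2" using S(2) by simp
  have "\<exists>q K. gadget_code p (8 * S) v q K" for v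
  proof (cases "0 < v \<and> v < p")
    case True
    then have "\<not> int p dvd - int v" by (auto dest: zdvd_imp_le)
    then obtain q where "gadget_size p (- int v) q (8 * S)" using S(3) cong_0_iff by blast
    then obtain gl where gl: "gadget p (- int v) 0 1 {2..<2 + q} gl" "2 * q + 2 \<le> length gl" "length gl \<le> 8 * S"
      unfolding gadget_size_def by (metis one_less_numeral_iff semiring_norm(76) zero_less_numeral zero_neq_one)
    \<comment> \<open>The labels are below 2 + q, so the lower bound 2 q + 2 on the number of arcs
      makes \<open>8 * S\<close> a bound for the labels as well.\<close>
    have "x < 8 * S \<and> y < 8 * S" if "(x, y) \<in> set gl" for x y
      using gadget_graph_verts(3,4)[OF gadget_imp_graph[OF gl(1)] that] gl(2,3) S(1) by auto
    then have "gadget_code p (8 * S) v q gl" using gl by (auto simp: gadget_code_def)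
    then show ?thesis by blast
  next
    case False
    then have "gadget_code p (8 * S) v 0 []" by (auto simp: gadget_code_def)
    then show ?thesis by blast
  qed
  then obtain q gl where gl: "\<And>v. gadget_code p (8 * S) v (q v) (gl v)" by metis
  \<comment> \<open>The 16 is twice 8: every input entry gives rise to at most \<open>8 * S\<close>
    arcs, and there are no more diagonal entries than arcs.\<close>
  define f where "f m = 16 * ?K * (real m * size_bound p)" for m
  have size_pos: "0 \<le> size_bound p" by (simp add: size_bound_def)
  have "efficiently_reducible (2000 * ?K\<^sup>2) 4 p f (LS p) (UWLS p)"
    unfolding efficiently_reducible_def
  proof (rule conjI, goal_cases)
    case 1
    show ?case using size_pos by (auto simp: f_def mono_def intro!: mult_left_mono mult_right_mono)
  next
    case 2
    show ?case
    proof (rule exI[of _ "encode p d gl q"], rule exI[of _ decode], intro allI impI, goal_cases)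
      case (1 M c s)
      then have M: "M \<in> LS p" "zp_system p M c" by auto
      let ?m = "nnz M"
      obtain t s' H k c' where run: "exec p (encode p d gl q) s t s'"
        "t \<le> ?m * (4 * d + 8 * S * (4 * (8 * S) + 30) + 8 * S + 80) + 8 * S * ?m * 100 + 100"
        and arcs: "simple_arcs k H" and out: "stores_system s' (unit_laplacian p k H) c'"
        "zp_system p (unit_laplacian p k H) c'" "nnz (unit_laplacian p k H) \<le> 2 * (8 * S * ?m)"
        and k: "k = dim_row M + nnz (unit_laplacian p k H)"
        and sol: "\<forall>x. solves p M c x \<longrightarrow> (\<exists>y. solves p (unit_laplacian p k H) c' y)"
          "\<forall>y. solves p (unit_laplacian p k H) c' y \<longrightarrow> solves p M c (vec (dim_row M) (\<lambda>i. y $ i))"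
        using encode_correct[OF p pd gl M 1(2)] by blast
      let ?M = "unit_laplacian p k H"
      have nnz: "real (nnz ?M) \<le> 16 * real S * real ?m"
      proof -
        have "real (nnz ?M) \<le> real (2 * (8 * S * ?m))" using out(3) of_nat_le_iff by blast
        then show ?thesis by simp
      qed
      have t: "real t \<le> soft_linear (2000 * ?K\<^sup>2) 4 p ?m"
        by (rule soft_linear_ge[OF p]) (use encode_time[OF L _ S(1) SL d run(2)] L_def in auto)
      have "real (nnz ?M) \<le> f ?m"
      proof -
        have "16 * real S * real ?m \<le> 16 * (?K * size_bound p) * real ?m"
          using S(2) by (intro mult_right_mono) auto
        then show ?thesis using nnz by (simp add: f_def mult_ac)
      qed
      moreover have "\<exists>t' u'. exec p decode u t' u' \<and> real t' \<le> soft_linear (2000 * ?K\<^sup>2) 4 p ?m \<and>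
          (solves p ?M c' y \<longrightarrow> (\<exists>x. stores_solution u' x \<and> solves p M c x))"
        if y: "zp_vector p (dim_col ?M) y \<and> input_system_solution u ?M c' y" for y u
      proof -
        have "dim_vec y = dim_col ?M" using y by (simp add: zp_vector_def)
        moreover have "dim_col ?M = dim_row M + nnz ?M" using k by simp
        ultimately obtain t' u' where d: "exec p decode u t' u'" "t' \<le> nnz ?M * 17 + 5"
          "stores_solution u' (vec (dim_row M) (\<lambda>i. y $ i))"
          using decode_correct y by blast
        have "real t' \<le> real (nnz ?M * 17 + 5)" using d(2) of_nat_le_iff by blast
        also have "\<dots> \<le> 16 * real S * real ?m * 17 + 5" using nnz by simp
        \<comment> \<open>Here 272 = 16 * 17, with 17 the cost of one iteration of the decoding
          loop; adding the constant 5 gives 277.\<close>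
        also have "\<dots> \<le> real (?m + 1) * (277 * (real S * real S))"
        proof -
          have "real S \<le> real S * real S" "1 \<le> real S * real S"
            using mult_mono[of 1 "real S" 1 "real S"] S(1) by (auto simp: mult_le_cancel_left1)
          then have "real ?m * (272 * real S) + 5 \<le> real ?m * (277 * (real S * real S)) + 277 * (real S * real S)"
            by (intro add_mono mult_left_mono) auto
          then show ?thesis by (simp add: algebra_simps)
        qed
        also have "\<dots> \<le> real (?m + 1) * (2000 * ?K\<^sup>2 * L ^ 4)"
        proof -
          have "real S * real S \<le> (?K * L\<^sup>2) * (?K * L\<^sup>2)" using SL by (intro mult_mono) auto
          also have "\<dots> = ?K\<^sup>2 * L ^ 4" by (simp add: power2_eq_square power4_eq_xxxx)
          finally have "real S * real S \<le> ?K\<^sup>2 * L ^ 4" .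
          then have "277 * (real S * real S) \<le> 2000 * (?K\<^sup>2 * L ^ 4)"
            by (rule mult_mono[rotated]) simp_all
          then show ?thesis by (intro mult_left_mono) auto
        qed
        finally have "real t' \<le> soft_linear (2000 * ?K\<^sup>2) 4 p ?m"
          by (intro soft_linear_ge[OF p]) (auto simp: L_def)
        then show ?thesis using d(1,3) sol(2) by blast
      qed
      ultimately show ?case
        using run(1) t out(1,2) unit_laplacian_UWLS[OF arcs p] sol(1)
        by (intro exI[of _ t] exI[of _ s'] exI[of _ ?M] exI[of _ c']) blast
    qed
  qed
  then show "\<exists>f. (\<forall>m. f m \<le> 16 * 38880 * (real m * (log 2 (real p))\<^sup>2 / max 1 (log 2 (log 2 (real p))))) \<and>
      efficiently_reducible (2000 * 38880\<^sup>2) 4 p f (LS p) (UWLS p)"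
    by (intro exI[of _ f]) (simp add: f_def size_bound_def)
qed

end
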